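(* Suppose $P_X$ and $P_Y$ are probability distributions on $\mathbb{R}$ with finite second moments $\sigma_X^2$ and $\sigma_Y^2$, respectively (the means of $P_X$ and $P_Y$ need not coincide), and let $D$ be a similarity threshold (for the condition displayed below to be defined, $\sigma_X,\sigma_Y>0$ and $D\ge(\sigma_X-\sigma_Y)^2$). Then $$R_{\mathrm{ID}}(D,P_X,P_Y)\le\overline{R}_{\mathrm{ID}}(D,P_X,P_Y):=\inf_{P_{\hat X|X}}I(X;\hat X),$$ where the infimum is taken over all conditional distributions $P_{\hat X|X}$ (of a real-valued $\hat X$ given $X$) satisfying $$\sqrt{\mathbb{E}\left[\left(\sqrt{\tfrac{\sigma_X}{\sigma_Y}}\,Y-\hat X\right)^2\right]}\ \ge\ \sqrt{\mathbb{E}\left[\left(\sqrt{\tfrac{\sigma_Y}{\sigma_X}}\,X-\hat X\right)^2\right]}+\sqrt{D-(\sigma_X-\sigma_Y)^2}$$ for $(Y,X,\hat X)\sim P_Y(y)P_X(x)P_{\hat X|X}(\hat x|x)$. Moreover, $\mathbf{E}_{\mathrm{ID}}(R,D,P_X,P_Y)>0$ for any $R>\overline{R}_{\mathrm{ID}}(D,P_X,P_Y)$.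
   Context: $\log$ denotes the base-2 logarithm, and mutual information $I(X;\hat X)$ is in bits. The second moments are $\sigma_X^2=\mathbb{E}[X^2]$ and $\sigma_Y^2=\mathbb{E}[Y^2]$ for $X\sim P_X$, $Y\sim P_Y$. For $\mathbf{x},\mathbf{y}\in\mathbb{R}^n$ put $d(\mathbf{x},\mathbf{y})=\frac1n\|\mathbf{x}-\mathbf{y}\|^2$ (Euclidean norm). A rate-$R$ identification system of blocklength $n$ is a pair $(T,g)$ of maps $T:\mathbb{R}^n\to\{1,2,\dots,2^{nR}\}$ and $g:\{1,2,\dots,2^{nR}\}\times\mathbb{R}^n\to\{\mathtt{no},\mathtt{maybe}\}$. It is $D$-admissible if $g(T(\mathbf{x}),\mathbf{y})=\mathtt{maybe}$ for all $\mathbf{x},\mathbf{y}$ with $d(\mathbf{x},\mathbf{y})\le D$. Given distributions $P_X,P_Y$ on $\mathbb{R}$, let $\mathbf{X},\mathbf{Y}$ be independent random vectors in $\mathbb{R}^n$ with i.i.d. entries of law $P_X$ and $P_Y$ respectively. A rate $R$ is $D$-achievable if there is a sequence of rate-$R$ $D$-admissible systems $(T^{(n)},g^{(n)})$ of blocklength $n$ with $\lim_{n\to\infty}\Pr\{g^{(n)}(T^{(n)}(\mathbf{X}),\mathbf{Y})=\mathtt{maybe}\}=0$. The identification rate $R_{\mathrm{ID}}(D,P_X,P_Y)$ is the infimum of all $D$-achievable rates, where an infimum over the empty set is $\infty$. For $R\ge R_{\mathrm{ID}}(D,P_X,P_Y)$ the identification exponent is $$\mathbf{E}_{\mathrm{ID}}(R,D,P_X,P_Y)=\limsup_{n\to\infty}-\frac1n\log\inf_{g^{(n)},T^{(n)}}\Pr\{g^{(n)}(T^{(n)}(\mathbf{X}),\mathbf{Y})=\mathtt{maybe}\},$$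 the infimum being over all $D$-admissible systems of rate $R$ and blocklength $n$.
   Formalization: The single value D = E[(X−Y)²] (X, Y independent) is excluded: there the claim fails, e.g. for P_X = P_Y uniform on {−1, 1}, D = 2. Both expectations in the constraint are required to be finite, since allowing ∞ ≥ ∞ would make the bound false. *)

theory Defs
  imports "HOL-Probability.Probability"
begin

section \<open>Identification systems\<close>

text \<open>Vectors of length \<open>n\<close> are the extensional functions on \<open>{..<n}\<close>, that is, the
  points of the product space \<open>vec_space n\<close>.\<close>

abbreviation vec_space :: "nat \<Rightarrow> (nat \<Rightarrow> real) measure" where
  "vec_space n \<equiv> Pi\<^sub>M {..<n} (\<lambda>_. borel)"

abbreviation iid_law :: "nat \<Rightarrow> real measure \<Rightarrow> (nat \<Rightarrow> real) measure" where
  "iid_law n P \<equiv> Pi\<^sub>M {..<n} (\<lambda>_. P)"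

definition distortion :: "nat \<Rightarrow> (nat \<Rightarrow> real) \<Rightarrow> (nat \<Rightarrow> real) \<Rightarrow> real" where
  "distortion n x y = 1 / real n * (L2_set (\<lambda>i. x i - y i) {..<n})\<^sup>2"

datatype answer = No | Maybe

text \<open>The number of indices \<open>2\<^sup>n\<^sup>R\<close> is rounded down to an integer. For \<open>R < 0\<close> and \<open>n > 0\<close> there
  are no indices, hence no systems.\<close>

definition indices :: "nat \<Rightarrow> real \<Rightarrow> nat set" where
  "indices n R = {1..nat \<lfloor>2 powr (real n * R)\<rfloor>}"

text \<open>Both maps are required to be Borel measurable, since otherwise the probability of the
  answer \<open>Maybe\<close> need not be defined (and \<^const>\<open>measure\<close> would silently return \<open>0\<close>).\<close>

definition id_system ::
  "nat \<Rightarrow> real \<Rightarrow> ((nat \<Rightarrow> real) \<Rightarrow> nat) \<Rightarrow> (nat \<Rightarrow> (nat \<Rightarrow> real) \<Rightarrow> answer) \<Rightarrow> bool" where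
  "id_system n R T g \<longleftrightarrow>
     T \<in> vec_space n \<rightarrow>\<^sub>M count_space (indices n R) \<and>
     (\<forall>i\<in>indices n R. g i \<in> vec_space n \<rightarrow>\<^sub>M count_space UNIV)"

definition admissible ::
  "nat \<Rightarrow> real \<Rightarrow> ((nat \<Rightarrow> real) \<Rightarrow> nat) \<Rightarrow> (nat \<Rightarrow> (nat \<Rightarrow> real) \<Rightarrow> answer) \<Rightarrow> bool" where
  "admissible n D T g \<longleftrightarrow>
     (\<forall>x\<in>space (vec_space n). \<forall>y\<in>space (vec_space n).
        distortion n x y \<le> D \<longrightarrow> g (T x) y = Maybe)"

definition prob_maybe ::
  "nat \<Rightarrow> real measure \<Rightarrow> real measure \<Rightarrow>
   ((nat \<Rightarrow> real) \<Rightarrow> nat) \<Rightarrow> (nat \<Rightarrow> (nat \<Rightarrow> real) \<Rightarrow> answer) \<Rightarrow> real" where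
  "prob_maybe n PX PY T g =
     measure (iid_law n PX \<Otimes>\<^sub>M iid_law n PY)
       {(x, y) \<in> space (iid_law n PX \<Otimes>\<^sub>M iid_law n PY). g (T x) y = Maybe}"

definition achievable :: "real \<Rightarrow> real measure \<Rightarrow> real measure \<Rightarrow> real \<Rightarrow> bool" where
  "achievable D PX PY R \<longleftrightarrow>
     (\<exists>T g. (\<forall>n\<ge>1. id_system n R (T n) (g n) \<and> admissible n D (T n) (g n)) \<and>
            (\<lambda>n. prob_maybe n PX PY (T n) (g n)) \<longlonglongrightarrow> 0)"

definition id_rate :: "real \<Rightarrow> real measure \<Rightarrow> real measure \<Rightarrow> ereal" where
  "id_rate D PX PY = (INF R\<in>{R. achievable D PX PY R}. ereal R)"

text \<open>Extended logarithm, with \<open>log 0 = -\<infinity>\<close>; the library has \<open>log 2 0 = 0\<close>.\<close>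

definition elog2 :: "ereal \<Rightarrow> ereal" where
  "elog2 p = (if p \<le> 0 then - \<infinity> else if p = \<infinity> then \<infinity> else ereal (log 2 (real_of_ereal p)))"

definition id_exponent :: "real \<Rightarrow> real \<Rightarrow> real measure \<Rightarrow> real measure \<Rightarrow> ereal" where
  "id_exponent R D PX PY =
     limsup (\<lambda>n. - ereal (1 / real n) *
       elog2 (INF (T, g)\<in>{(T, g). id_system n R T g \<and> admissible n D T g}.
                ereal (prob_maybe n PX PY T g)))"

section \<open>The rate bound\<close>

definition rms :: "real measure \<Rightarrow> real" where
  "rms P = sqrt (\<integral>x. x\<^sup>2 \<partial>P)"

text \<open>A conditional distribution \<open>K\<close> is a Markov kernel on the real line;
  \<open>joint_law PX K\<close> is the law of the pair \<open>(X, X')\<close> with \<open>X\<close> of law \<open>PX\<close> and \<open>X'\<close> of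
  law \<open>K x\<close> given \<open>X = x\<close>.\<close>

definition joint_law :: "real measure \<Rightarrow> (real \<Rightarrow> real measure) \<Rightarrow> (real \<times> real) measure" where
  "joint_law PX K = PX \<bind> (\<lambda>x. distr (K x) (borel \<Otimes>\<^sub>M borel) (\<lambda>x'. (x, x')))"

text \<open>Extended-valued mutual information in bits of the two coordinates of \<open>J\<close>. The library's
  version is a Bochner integral of a Radon-Nikodym derivative; where the former is not finite or
  the latter does not exist, mutual information is \<open>\<infinity>\<close>. (The negative part of the density is
  always integrable, so that non-integrability does mean that the integral is \<open>\<infinity>\<close>.)\<close>

definition mutual_info :: "(real \<times> real) measure \<Rightarrow> ereal" where
  "mutual_info J =
     (let Q = distr J borel fst \<Otimes>\<^sub>M distr J borel snd in
      if absolutely_continuous Q J \<and> integrable J (entropy_density 2 Q J)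
      then ereal (prob_space.mutual_information J 2 borel borel fst snd)
      else \<infinity>)"

text \<open>The expectations are over \<open>(Y, (X, X'))\<close> with \<open>Y\<close> independent of \<open>(X, X')\<close>, and have to be
  finite: in terms of extended reals, every \<open>X'\<close> with infinite second moment would otherwise
  satisfy the inequality as \<open>\<infinity> \<ge> \<infinity>\<close>.\<close>

definition feasible ::
  "real \<Rightarrow> real measure \<Rightarrow> real measure \<Rightarrow> (real \<Rightarrow> real measure) \<Rightarrow> bool" where
  "feasible D PX PY K \<longleftrightarrow>
     (let L = PY \<Otimes>\<^sub>M joint_law PX K;
          \<sigma>X = rms PX; \<sigma>Y = rms PY;
          eY = (\<lambda>(y, x, x'). (sqrt (\<sigma>X / \<sigma>Y) * y - x')\<^sup>2);
          eX = (\<lambda>(y, x, x'). (sqrt (\<sigma>Y / \<sigma>X) * x - x')\<^sup>2)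
      in integrable L eY \<and> integrable L eX \<and>
         sqrt (\<integral>z. eY z \<partial>L) \<ge> sqrt (\<integral>z. eX z \<partial>L) + sqrt (D - (\<sigma>X - \<sigma>Y)\<^sup>2))"

definition rate_bound :: "real \<Rightarrow> real measure \<Rightarrow> real measure \<Rightarrow> ereal" where
  "rate_bound D PX PY =
     (INF K\<in>{K. K \<in> borel \<rightarrow>\<^sub>M prob_algebra borel \<and> feasible D PX PY K}.
        mutual_info (joint_law PX K))"

end

theory Submission
  imports Defs
begin

text \<open>
  Put \<open>a = \<surd>(\<sigma>X / \<sigma>Y)\<close> and \<open>b = 1 / a\<close>. The encoder covers \<open>X\<^sup>n\<close> with codewords \<open>z\<close> at roughly the
  prescribed distance from \<open>b X\<close>, as in lossy source coding; the decoder answers \<open>No\<close> if \<open>y\<close> is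
  typical and \<open>a y\<close> is about as far from \<open>z\<close> as an independent \<open>a Y\<close> would be. Since
  \<open>\<parallel>x - y\<parallel>\<^sup>2 = (1 - b\<^sup>2) \<parallel>x\<parallel>\<^sup>2 + (1 - a\<^sup>2) \<parallel>y\<parallel>\<^sup>2 + \<parallel>a y - b x\<parallel>\<^sup>2\<close> and
  \<open>\<parallel>a y - b x\<parallel> \<ge> \<parallel>a y - z\<parallel> - \<parallel>b x - z\<parallel>\<close>, such a pair is not similar.

  Only second moments are finite, whereas all error probabilities have to decay exponentially. So
  \<open>x\<close>, \<open>y\<close>, \<open>z\<close> and the density of the test channel are truncated, after which Chernoff bounds
  apply; large letters are removed from both vectors, and the number of removals is part of the
  typicality tests. This needs the constraint on the test channel to be strict. When it holds with
  equality, mixing in a quantization of an affine function of \<open>X\<close> makes it strict, unless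
  \<open>D = E(X - Y)\<^sup>2\<close>.
\<close>

section \<open>Covering by greedily chosen codewords\<close>

text \<open>The factors \<open>a\<close>, \<open>b\<close> give \<open>a Y\<close> and
  \<open>b X\<close> the common second moment \<open>\<sigma>X \<sigma>Y\<close>. The two other
  quadratic terms then have expectation \<open>(\<sigma>X - \<sigma>Y)^2\<close> in total, which is
  why \<open>D - (\<sigma>X - \<sigma>Y)^2\<close> is what remains of \<open>D\<close> for the
  distance of \<open>a y\<close> and \<open>b x\<close>. That a rejected pair is far apart follows
  pathwise from the tests; probability only enters in how often a test fails. Each test concerns a
  sum over the letters of a function that is bounded above and has negative mean, and this yields a
  moment generating function below 1.

  Equality in the constraint leaves no room for such tests. Along a suitable mixture the slack has a
  positive derivative unless \<open>E(a Y - b X)^2 = D - (\<sigma>X - \<sigma>Y)^2\<close>, that is,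
  \<open>D = E(X - Y)^2\<close>. That case really has to be excluded: for X = Y = 1 almost surely
  and D = 0, constant reconstructions are feasible and the bound is 0, but similar pairs have
  probability 1 and no rate is achievable.\<close>

lemma abs_exp_minus_one_le:
  fixes u c :: real
  assumes "u \<le> c" "0 \<le> c"
  shows "\<bar>exp u - 1\<bar> \<le> \<bar>u\<bar> * exp c"
proof (cases "u \<ge> 0")
  case True
  have "1 - u \<le> exp (-u)" using exp_ge_add_one_self[of "-u"] by simp
  then have "exp u * (1 - u) \<le> exp u * exp (-u)" by (intro mult_left_mono) auto
  then have "exp u - 1 \<le> u * exp u" by (simp add: exp_minus algebra_simps)
  also have "\<dots> \<le> u * exp c" using True assms by (intro mult_left_mono) auto
  finally show ?thesis using True by simp
next
  case False
  have "1 - exp u \<le> - u" using exp_ge_add_one_self[of u] by linarith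
  also have "- u \<le> (- u) * exp c"
    using False assms(2) mult_left_mono[of 1 "exp c" "- u"] by simp
  finally show ?thesis using False by simp
qed

text \<open>At \<open>t = 0\<close> the moment generating function is 1 and its right derivative is
  the mean of \<open>\<phi>\<close>, which is negative. The upper bound on \<open>\<phi>\<close>
  dominates the difference quotients by a multiple of \<open>\<bar>\<phi> x\<bar>\<close>, so
  integrability suffices and \<open>\<phi>\<close> may be unbounded below.\<close>

lemma (in prob_space) exp_moment_less_one:
  fixes \<phi> :: "'a \<Rightarrow> real"
  assumes int: "integrable M \<phi>" and bd: "\<And>x. x \<in> space M \<Longrightarrow> \<phi> x \<le> B"
    and neg: "expectation \<phi> < 0"
  shows "\<exists>t>0. (\<integral>\<^sup>+x. ennreal (exp (t * \<phi> x)) \<partial>M) < 1"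
proof -
  have [measurable]: "\<phi> \<in> borel_measurable M" using int by auto
  define c where "c = max B 0"
  define t where "t k = inverse (real (Suc k))" for k
  have t: "0 < t k" "t k \<le> 1" for k by (auto simp: t_def field_simps)
  have t0: "t \<longlonglongrightarrow> 0" unfolding t_def by (rule LIMSEQ_inverse_real_of_nat)
  define g where "g k x = (exp (t k * \<phi> x) - 1) / t k" for k x
  have le: "t k * \<phi> x \<le> c" if "x \<in> space M" for k x
  proof -
    have "t k * \<phi> x \<le> t k * c" using bd[OF that] t[of k] by (intro mult_left_mono) (auto simp: c_def)
    also have "\<dots> \<le> 1 * c" using t[of k] by (intro mult_right_mono) (auto simp: c_def)
    finally show ?thesis by simp
  qed
  have gb: "norm (g k x) \<le> \<bar>\<phi> x\<bar> * exp c" if "x \<in> space M" for k x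
  proof -
    have "\<bar>exp (t k * \<phi> x) - 1\<bar> \<le> \<bar>t k * \<phi> x\<bar> * exp c"
      by (rule abs_exp_minus_one_le[OF le[OF that]]) (simp add: c_def)
    then show ?thesis using t[of k] by (simp add: g_def abs_mult field_simps)
  qed
  have lim: "(\<lambda>k. g k x) \<longlonglongrightarrow> \<phi> x" for x
  proof -
    have "((\<lambda>h. exp (h * \<phi> x)) has_real_derivative \<phi> x) (at 0)"
      by (auto intro!: derivative_eq_intros)
    then have "((\<lambda>h. (exp ((0 + h) * \<phi> x) - exp (0 * \<phi> x)) / h) \<longlongrightarrow> \<phi> x) (at 0)"
      by (rule DERIV_D)
    moreover have "filterlim t (at 0) sequentially"
      using t0 t(1) by (intro filterlim_atI) (auto intro!: always_eventually simp: less_imp_neq[symmetric])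
    ultimately have "(\<lambda>k. (exp ((0 + t k) * \<phi> x) - exp (0 * \<phi> x)) / t k) \<longlonglongrightarrow> \<phi> x"
      by (rule filterlim_compose)
    then show ?thesis by (simp add: g_def)
  qed
  have "(\<lambda>k. expectation (g k)) \<longlonglongrightarrow> expectation \<phi>"
  proof (rule integral_dominated_convergence[where w="\<lambda>x. \<bar>\<phi> x\<bar> * exp c"])
    show "g k \<in> borel_measurable M" for k unfolding g_def by measurable
    show "integrable M (\<lambda>x. \<bar>\<phi> x\<bar> * exp c)" using int by auto
  qed (use lim gb in auto)
  then have "eventually (\<lambda>k. expectation (g k) < 0) sequentially"
    using order_tendstoD(2)[OF _ neg] by blast
  then obtain k where k: "expectation (g k) < 0"
    by (auto simp: eventually_sequentially)
  have ig: "integrable M (g k)"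
    by (rule Bochner_Integration.integrable_bound[where f="\<lambda>x. \<bar>\<phi> x\<bar> * exp c"])
      (use int gb in \<open>auto simp: g_def[abs_def]\<close>)
  have eq: "exp (t k * \<phi> x) = 1 + t k * g k x" for x using t[of k] by (simp add: g_def)
  have ie: "integrable M (\<lambda>x. exp (t k * \<phi> x))" unfolding eq using ig by auto
  have "expectation (\<lambda>x. exp (t k * \<phi> x)) = 1 + t k * expectation (g k)"
    unfolding eq using ig by (subst Bochner_Integration.integral_add) (auto simp: prob_space)
  also have "\<dots> < 1" using k t[of k] by (simp add: mult_pos_neg)
  finally have "(\<integral>\<^sup>+x. ennreal (exp (t k * \<phi> x)) \<partial>M) < 1"
    using ie by (subst nn_integral_eq_integral) auto
  then show ?thesis using t(1) by blast
qed

text \<open>The probabilistic method in pointwise form: if \<open>h\<close> exceeded its mean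
  \<open>c\<close> everywhere, the positive function \<open>h - c\<close> would have integral
  0.\<close>

lemma (in prob_space) ex_le_nn_integral:
  assumes [measurable]: "h \<in> borel_measurable M"
  shows "\<exists>s\<in>space M. h s \<le> (\<integral>\<^sup>+s. h s \<partial>M)"
proof (rule ccontr)
  assume "\<not> ?thesis"
  then have gt: "s \<in> space M \<Longrightarrow> (\<integral>\<^sup>+s. h s \<partial>M) < h s" for s by (auto simp: not_le)
  define c where "c = (\<integral>\<^sup>+s. h s \<partial>M)"
  obtain s0 where "s0 \<in> space M" using not_empty by blast
  \<comment> \<open>Finiteness, needed to subtract in \<open>ennreal\<close>, comes for free: the
    mean lies strictly below some value.\<close>
  then have fin: "c < top" using gt[of s0] unfolding c_def
    by (meson less_top order_less_le_trans top_greatest)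
  have "(\<integral>\<^sup>+s. (h s - c) \<partial>M) = c - (\<integral>\<^sup>+s. c \<partial>M)"
    unfolding c_def[symmetric]
    apply (subst nn_integral_diff)
    using fin gt by (auto simp: c_def emeasure_space_1 less_imp_le)
  then have "(\<integral>\<^sup>+s. (h s - c) \<partial>M) = 0" using fin by (simp add: emeasure_space_1)
  then have "AE s in M. h s - c = 0" by (subst (asm) nn_integral_0_iff_AE) auto
  moreover have "AE s in M. h s - c \<noteq> 0"
    using gt fin by (intro AE_I2) (auto simp: c_def diff_eq_0_iff_ennreal not_le[symmetric])
  ultimately have "AE s in M. False" by eventually_elim auto
  then show False by simp
qed

text \<open>Instead of drawing a random codebook, choose the codewords one after the other, each at least
  as good as the average of a random one. This avoids the product measure on codebooks.\<close>

lemma greedy_cover: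
  assumes "prob_space P" "prob_space Q" and Bad[measurable]: "Bad \<in> sets (P \<Otimes>\<^sub>M Q)"
  defines "r \<equiv> \<lambda>x. \<integral>\<^sup>+s. indicator Bad (x, s) \<partial>Q"
  assumes "w \<in> borel_measurable P"
  shows "\<exists>s. (\<forall>i. s i \<in> space Q) \<and>
    (\<integral>\<^sup>+x. w x * (\<Prod>i<N. indicator Bad (x, s i)) \<partial>P) \<le> (\<integral>\<^sup>+x. w x * r x ^ N \<partial>P)"
  using assms(5)
proof (induction N arbitrary: w)
  case 0
  interpret Q: prob_space Q by fact
  show ?case using Q.not_empty by auto
next
  case (Suc N)
  interpret P: prob_space P by fact
  interpret Q: prob_space Q by fact
  interpret PQ: pair_sigma_finite P Q ..
  note [measurable] = Suc.prems
  have [measurable]: "r \<in> borel_measurable P" unfolding r_def by measurable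
  have "(\<integral>\<^sup>+x. w x * r x ^ Suc N \<partial>P)
      = (\<integral>\<^sup>+x. (\<integral>\<^sup>+s. w x * r x ^ N * indicator Bad (x, s) \<partial>Q) \<partial>P)"
    by (intro nn_integral_cong, subst nn_integral_cmult)
      (auto simp: r_def mult_ac)
  also have "\<dots> = (\<integral>\<^sup>+s. (\<integral>\<^sup>+x. w x * r x ^ N * indicator Bad (x, s) \<partial>P) \<partial>Q)"
    by (rule PQ.Fubini'[symmetric]) measurable
  finally have eq: "(\<integral>\<^sup>+x. w x * r x ^ Suc N \<partial>P)
      = (\<integral>\<^sup>+s. (\<integral>\<^sup>+x. w x * r x ^ N * indicator Bad (x, s) \<partial>P) \<partial>Q)" .
  \<comment> \<open>The new codeword is judged by the weight \<open>w x * r x ^ N\<close>, which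
    counts the \<open>N\<close> remaining codewords by their random average. Once \<open>s0\<close>
    is fixed, \<open>w x * indicator Bad (x, s0)\<close> is the weight for the induction hypothesis;
    hence the generalization over \<open>w\<close>.\<close>
  have "(\<lambda>s. \<integral>\<^sup>+x. w x * r x ^ N * indicator Bad (x, s) \<partial>P) \<in> borel_measurable Q"
    by measurable
  from Q.ex_le_nn_integral[OF this] obtain s0 where s0: "s0 \<in> space Q"
    and le: "(\<integral>\<^sup>+x. w x * r x ^ N * indicator Bad (x, s0) \<partial>P) \<le> (\<integral>\<^sup>+x. w x * r x ^ Suc N \<partial>P)"
    unfolding eq by auto
  have m: "(\<lambda>x. w x * indicator Bad (x, s0)) \<in> borel_measurable P" using s0 by measurable
  from Suc.IH[OF m] obtain s where s: "\<forall>i. s i \<in> space Q"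
    and le2: "(\<integral>\<^sup>+x. w x * indicator Bad (x, s0) * (\<Prod>i<N. indicator Bad (x, s i)) \<partial>P)
      \<le> (\<integral>\<^sup>+x. w x * indicator Bad (x, s0) * r x ^ N \<partial>P)" by auto
  define s' where "s' i = (if i < N then s i else s0)" for i
  have "(\<integral>\<^sup>+x. w x * (\<Prod>i<Suc N. indicator Bad (x, s' i)) \<partial>P) =
      (\<integral>\<^sup>+x. w x * indicator Bad (x, s0) * (\<Prod>i<N. indicator Bad (x, s i)) \<partial>P)"
    by (simp add: s'_def mult_ac)
  also note le2
  also have "(\<integral>\<^sup>+x. w x * indicator Bad (x, s0) * r x ^ N \<partial>P)
      = (\<integral>\<^sup>+x. w x * r x ^ N * indicator Bad (x, s0) \<partial>P)" by (simp add: mult_ac)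
  also note le
  finally show ?case using s s0 by (intro exI[of _ s']) (auto simp: s'_def)
qed

text \<open>A convex function lies below its chord. The chord separates the two ways to miss in the
  covering argument: \<open>1 - u\<close> is a failure of the channel, \<open>exp (- t)\<close> a
  failure of the codebook.\<close>

lemma exp_chord_le:
  fixes u t :: real
  assumes "0 \<le> u" "u \<le> 1"
  shows "exp (- (u * t)) \<le> 1 - u + exp (- t)"
proof -
  have "convex_on UNIV (exp :: real \<Rightarrow> real)" by (rule exp_convex)
  from convex_onD[OF this, of u 0 "- t"] assms
  have "exp (- (u * t)) \<le> 1 - u + u * exp (- t)" by simp
  also have "u * exp (- t) \<le> 1 * exp (- t)" using assms by (intro mult_right_mono) auto
  finally show ?thesis by simp
qed

text \<open>\<open>F\<close> is the density of a channel law. Let \<open>u\<close> be the channel's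
  probability of \<open>Typ\<close> given \<open>x\<close>. Since \<open>F \<le> \<Lambda>\<close>
  on \<open>Typ\<close>, a codeword drawn from \<open>Q\<close> hits with probability at least
  \<open>u / \<Lambda>\<close>, so \<open>N\<close> independent ones all miss with probability at
  most \<open>(1 - u / \<Lambda>) ^ N \<le> exp (- u N / \<Lambda>)\<close>. The chord bound and
  integration over \<open>x\<close> give the two summands.\<close>

lemma covering:
  assumes "prob_space P" "prob_space Q" and Typ[measurable]: "Typ \<in> sets (P \<Otimes>\<^sub>M Q)"
    and F[measurable]: "F \<in> borel_measurable (P \<Otimes>\<^sub>M Q)"
    and F1: "\<And>x. x \<in> space P \<Longrightarrow> (\<integral>\<^sup>+s. F (x, s) \<partial>Q) = 1"
    and FL: "\<And>p. p \<in> Typ \<Longrightarrow> F p \<le> ennreal \<Lambda>" and "\<Lambda> > 0"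
  shows "\<exists>s. (\<forall>i. s i \<in> space Q) \<and>
    emeasure P {x \<in> space P. \<forall>i<N. (x, s i) \<notin> Typ}
      \<le> (\<integral>\<^sup>+p. F p * indicator (- Typ) p \<partial>(P \<Otimes>\<^sub>M Q)) + ennreal (exp (- (real N / \<Lambda>)))"
proof -
  interpret P: prob_space P by fact
  interpret Q: prob_space Q by fact
  interpret PQ: pair_sigma_finite P Q ..
  define Bad where "Bad = space (P \<Otimes>\<^sub>M Q) - Typ"
  have [measurable]: "Bad \<in> sets (P \<Otimes>\<^sub>M Q)" by (auto simp: Bad_def)
  define r where "r = (\<lambda>x. \<integral>\<^sup>+s. indicator Bad (x, s) \<partial>Q)"
  have [measurable]: "r \<in> borel_measurable P" unfolding r_def by measurable
  define v where "v = (\<lambda>x. \<integral>\<^sup>+s. F (x, s) * indicator Bad (x, s) \<partial>Q)"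
  have [measurable]: "v \<in> borel_measurable P" unfolding v_def by measurable
  obtain s where s: "\<forall>i. s i \<in> space Q" and
    le: "(\<integral>\<^sup>+x. 1 * (\<Prod>i<N. indicator Bad (x, s i)) \<partial>P) \<le> (\<integral>\<^sup>+x. 1 * r x ^ N \<partial>P)"
    using greedy_cover[OF assms(1,2), of Bad "\<lambda>_. 1" N] unfolding r_def by auto
  have [measurable]: "s i \<in> space Q" for i using s by auto
  have "emeasure P {x \<in> space P. \<forall>i<N. (x, s i) \<notin> Typ} =
      (\<integral>\<^sup>+x. indicator {x \<in> space P. \<forall>i<N. (x, s i) \<notin> Typ} x \<partial>P)"
    by (subst nn_integral_indicator) (auto intro!: sets.sets_Collect_countable_All measurable)
  also have "\<dots> = (\<integral>\<^sup>+x. 1 * (\<Prod>i<N. indicator Bad (x, s i)) \<partial>P)"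
    using s by (intro nn_integral_cong) (auto simp: indicator_def Bad_def space_pair_measure)
  also note le
  also have "(\<integral>\<^sup>+x. 1 * r x ^ N \<partial>P) \<le> (\<integral>\<^sup>+x. v x + ennreal (exp (- (real N / \<Lambda>))) \<partial>P)"
  proof (rule nn_integral_mono)
    fix x assume x: "x \<in> space P"
    define u where "u = (\<integral>\<^sup>+s. F (x, s) * indicator Typ (x, s) \<partial>Q)"
    define q where "q = (\<integral>\<^sup>+s. indicator Typ (x, s) \<partial>Q)"
    have [measurable]: "(\<lambda>s. F (x, s)) \<in> borel_measurable Q" using x by measurable
    have [measurable]: "(\<lambda>s. indicator Typ (x, s) :: ennreal) \<in> borel_measurable Q"
      "(\<lambda>s. indicator Bad (x, s) :: ennreal) \<in> borel_measurable Q" using x by measurable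
    have "u + v x = (\<integral>\<^sup>+s. F (x, s) * indicator Typ (x, s) + F (x, s) * indicator Bad (x, s) \<partial>Q)"
      unfolding u_def v_def by (subst nn_integral_add) auto
    also have "\<dots> = (\<integral>\<^sup>+s. F (x, s) \<partial>Q)"
      using x by (intro nn_integral_cong) (auto simp: Bad_def indicator_def space_pair_measure)
    finally have uv: "u + v x = 1" using F1[OF x] by simp
    have "q + r x = (\<integral>\<^sup>+s. indicator Typ (x, s) + indicator Bad (x, s) \<partial>Q)"
      unfolding q_def r_def by (subst nn_integral_add) auto
    also have "\<dots> = (\<integral>\<^sup>+s. 1 \<partial>Q)"
      using x by (intro nn_integral_cong) (auto simp: Bad_def indicator_def space_pair_measure)
    finally have qr: "q + r x = 1" by (simp add: Q.emeasure_space_1)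
    have "u \<le> (\<integral>\<^sup>+s. ennreal \<Lambda> * indicator Typ (x, s) \<partial>Q)"
      unfolding u_def using FL by (intro nn_integral_mono) (auto simp: indicator_def)
    also have "\<dots> = ennreal \<Lambda> * q" unfolding q_def by (subst nn_integral_cmult) auto
    finally have uq: "u \<le> ennreal \<Lambda> * q" .
    have fin: "u \<le> 1" "v x \<le> 1" unfolding uv[symmetric] by auto
    have fin': "q \<le> 1" "r x \<le> 1" unfolding qr[symmetric] by auto
    have ex: "\<exists>b'\<ge>0. b = ennreal b'" if "b \<le> 1" for b :: ennreal
      using that le_ennreal_iff[of 1 b] by auto
    obtain u' v' where real1: "u = ennreal u'" "v x = ennreal v'" "0 \<le> u'" "0 \<le> v'"
      using ex[OF fin(1)] ex[OF fin(2)] by blast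
    obtain q' r' where real2: "q = ennreal q'" "r x = ennreal r'" "0 \<le> q'" "0 \<le> r'"
      using ex[OF fin'(1)] ex[OF fin'(2)] by blast
    note real = real1 real2
    have e1: "u' + v' = 1" using uv real1 by (simp flip: ennreal_plus)
    have e2: "q' + r' = 1" using qr real2 by (simp flip: ennreal_plus)
    have e3: "u' \<le> \<Lambda> * q'"
      using uq real1 real2 \<open>\<Lambda> > 0\<close> by (simp add: ennreal_le_iff flip: ennreal_mult)
    note e = e1 e2 e3
    have "u' / \<Lambda> \<le> q'" using e3 \<open>\<Lambda> > 0\<close> by (simp add: field_simps)
    then have "r' \<le> 1 - u' / \<Lambda>" using e2 by simp
    also have "\<dots> \<le> exp (- (u' / \<Lambda>))" using exp_ge_add_one_self[of "- (u' / \<Lambda>)"] by simp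
    finally have "r' ^ N \<le> exp (- (u' / \<Lambda>)) ^ N" using real by (intro power_mono) auto
    also have "\<dots> = exp (- (u' * (real N / \<Lambda>)))" by (simp flip: exp_of_nat_mult)
    also have "\<dots> \<le> 1 - u' + exp (- (real N / \<Lambda>))" using e real by (intro exp_chord_le) auto
    finally have "r' ^ N \<le> v' + exp (- (real N / \<Lambda>))" using e by simp
    then show "1 * r x ^ N \<le> v x + ennreal (exp (- (real N / \<Lambda>)))"
      using real by (simp add: ennreal_power ennreal_leI flip: ennreal_plus)
  qed
  also have "\<dots> = (\<integral>\<^sup>+x. v x \<partial>P) + ennreal (exp (- (real N / \<Lambda>)))"
    by (subst nn_integral_add) (auto simp: P.emeasure_space_1)
  also have "(\<integral>\<^sup>+x. v x \<partial>P) = (\<integral>\<^sup>+p. F p * indicator Bad p \<partial>(P \<Otimes>\<^sub>M Q))"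
    unfolding v_def by (subst Q.nn_integral_fst[symmetric]) auto
  also have "\<dots> = (\<integral>\<^sup>+p. F p * indicator (- Typ) p \<partial>(P \<Otimes>\<^sub>M Q))"
    by (intro nn_integral_cong) (auto simp: Bad_def indicator_def)
  finally show ?thesis using s by blast
qed

section \<open>Typicality for a test channel\<close>

text \<open>The channel is given by its density \<open>f\<close> against a reference law
  \<open>Q\<close>, which need not be the law of its output. So \<open>ln f\<close> integrates to
  the mutual information plus the divergence of the output law from \<open>Q\<close>, an upper bound
  that survives truncation, quantization and mixing. Letters live in an abstract space, as mixtures
  attach labels to them. Normalization holds for every \<open>x\<close>, not just almost every one,
  since sections are integrated pointwise.\<close>

locale test_channel = PX: real_distribution PX + Q: prob_space Q
  for PX :: "real measure" and Q :: "'s measure" +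
  fixes f :: "real \<times> 's \<Rightarrow> real"
  assumes f_measurable[measurable]: "f \<in> borel_measurable (PX \<Otimes>\<^sub>M Q)"
    and f_nonneg: "\<And>p. 0 \<le> f p"
    and f_normalized: "\<And>x. (\<integral>\<^sup>+s. ennreal (f (x, s)) \<partial>Q) = 1"
begin

definition J :: "(real \<times> 's) measure" where
  "J = density (PX \<Otimes>\<^sub>M Q) (\<lambda>p. ennreal (f p))"

lemma sets_J[simp, measurable_cong]: "sets J = sets (PX \<Otimes>\<^sub>M Q)"
  by (simp add: J_def)

lemma space_J: "space J = UNIV \<times> space Q"
  by (simp add: J_def space_pair_measure)

sublocale PXQ: pair_prob_space PX Q ..

lemma prob_space_J: "prob_space J"
proof
  have "emeasure J (space J) = (\<integral>\<^sup>+p. ennreal (f p) \<partial>(PX \<Otimes>\<^sub>M Q))"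
    unfolding J_def space_density
    by (subst emeasure_density[OF _ sets.top]) (auto intro!: nn_integral_cong)
  also have "\<dots> = (\<integral>\<^sup>+x. (\<integral>\<^sup>+s. ennreal (f (x, s)) \<partial>Q) \<partial>PX)"
    by (subst Q.nn_integral_fst) auto
  also have "\<dots> = 1" by (simp add: f_normalized PX.emeasure_space_1[simplified])
  finally show "emeasure J (space J) = 1" .
qed

lemma nn_integral_J:
  assumes "k \<in> borel_measurable (PX \<Otimes>\<^sub>M Q)"
  shows "(\<integral>\<^sup>+p. k p \<partial>J) = (\<integral>\<^sup>+p. ennreal (f p) * k p \<partial>(PX \<Otimes>\<^sub>M Q))"
  unfolding J_def using assms by (subst nn_integral_density) auto

section \<open>Products of letters and Chernoff bounds\<close>

abbreviation words :: "nat \<Rightarrow> (nat \<Rightarrow> 's) measure" where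
  "words n \<equiv> Pi\<^sub>M {..<n} (\<lambda>_. Q)"

lemma nn_integral_prod_letters:
  assumes k[measurable]: "k \<in> borel_measurable (PX \<Otimes>\<^sub>M Q)"
  shows "(\<integral>\<^sup>+p. (\<Prod>i<n. k (fst p i, snd p i)) \<partial>(iid_law n PX \<Otimes>\<^sub>M words n))
    = (\<integral>\<^sup>+p. k p \<partial>(PX \<Otimes>\<^sub>M Q)) ^ n"
proof -
  interpret Qn': prob_space "words n" by (rule prob_space_PiM) (rule Q.prob_space_axioms)
  interpret PXn: product_prob_space "\<lambda>_. PX" "{..<n}" ..
  interpret Qn: product_prob_space "\<lambda>_. Q" "{..<n}" ..
  have "(\<integral>\<^sup>+p. (\<Prod>i<n. k (fst p i, snd p i)) \<partial>(iid_law n PX \<Otimes>\<^sub>M words n))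
    = (\<integral>\<^sup>+x. (\<integral>\<^sup>+s. (\<Prod>i<n. k (x i, s i)) \<partial>words n) \<partial>iid_law n PX)"
    by (subst Qn'.nn_integral_fst[symmetric]) auto
  also have "\<dots> = (\<integral>\<^sup>+x. (\<Prod>i<n. \<integral>\<^sup>+s. k (x i, s) \<partial>Q) \<partial>iid_law n PX)"
    by (intro nn_integral_cong Qn.product_nn_integral_prod) (auto intro: measurable_Pair2)
  also have "\<dots> = (\<Prod>i<n. (\<integral>\<^sup>+x. (\<integral>\<^sup>+s. k (x, s) \<partial>Q) \<partial>PX))"
    by (intro PXn.product_nn_integral_prod) auto
  also have "\<dots> = (\<integral>\<^sup>+p. k p \<partial>(PX \<Otimes>\<^sub>M Q)) ^ n"
    by (simp add: Q.nn_integral_fst)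
  finally show ?thesis .
qed

definition F :: "nat \<Rightarrow> (nat \<Rightarrow> real) \<times> (nat \<Rightarrow> 's) \<Rightarrow> ennreal" where
  "F n p = (\<Prod>i<n. ennreal (f (fst p i, snd p i)))"

lemma F_measurable[measurable]: "F n \<in> borel_measurable (iid_law n PX \<Otimes>\<^sub>M words n)"
  unfolding F_def by measurable

lemma F_normalized: "(\<integral>\<^sup>+s. F n (x, s) \<partial>words n) = 1"
proof -
  interpret Qn: product_prob_space "\<lambda>_. Q" "{..<n}" ..
  have "(\<integral>\<^sup>+s. F n (x, s) \<partial>words n) = (\<Prod>i<n. \<integral>\<^sup>+s. ennreal (f (x i, s)) \<partial>Q)"
    unfolding F_def fst_conv snd_conv
    by (rule Qn.product_nn_integral_prod) (auto intro: measurable_Pair2)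
  then show ?thesis by (simp add: f_normalized)
qed

lemma nn_integral_F_prod:
  assumes "k \<in> borel_measurable (PX \<Otimes>\<^sub>M Q)"
  shows "(\<integral>\<^sup>+p. F n p * (\<Prod>i<n. k (fst p i, snd p i)) \<partial>(iid_law n PX \<Otimes>\<^sub>M words n))
    = (\<integral>\<^sup>+p. k p \<partial>J) ^ n"
  unfolding F_def prod.distrib[symmetric] nn_integral_J[OF assms]
  by (rule nn_integral_prod_letters) (use assms in measurable)

text \<open>Markov's inequality for \<open>exp (t * ...)\<close> under the law with density
  \<open>F n\<close>, where the exponential of the sum factorizes over the letters.\<close>

lemma chernoff_encoder:
  assumes [measurable]: "\<phi> \<in> borel_measurable (PX \<Otimes>\<^sub>M Q)" and "t > 0"
  shows "(\<integral>\<^sup>+p. F n p * indicator {p. (\<Sum>i<n. \<phi> (fst p i, snd p i)) \<ge> 0} p \<partial>(iid_law n PX \<Otimes>\<^sub>M words n))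
    \<le> (\<integral>\<^sup>+p. ennreal (exp (t * \<phi> p)) \<partial>J) ^ n"
proof -
  have "indicator {p. (\<Sum>i<n. \<phi> (fst p i, snd p i)) \<ge> 0} p
      \<le> (\<Prod>i<n. ennreal (exp (t * \<phi> (fst p i, snd p i))))" for p
  proof -
    have "(\<Prod>i<n. ennreal (exp (t * \<phi> (fst p i, snd p i)))) = ennreal (exp (t * (\<Sum>i<n. \<phi> (fst p i, snd p i))))"
      by (simp add: prod_ennreal exp_sum sum_distrib_left)
    then show ?thesis using \<open>t > 0\<close> by (auto simp: indicator_def simp flip: ennreal_1 intro!: ennreal_leI)
  qed
  then have "(\<integral>\<^sup>+p. F n p * indicator {p. (\<Sum>i<n. \<phi> (fst p i, snd p i)) \<ge> 0} p \<partial>(iid_law n PX \<Otimes>\<^sub>M words n))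
    \<le> (\<integral>\<^sup>+p. F n p * (\<Prod>i<n. ennreal (exp (t * \<phi> (fst p i, snd p i)))) \<partial>(iid_law n PX \<Otimes>\<^sub>M words n))"
    by (intro nn_integral_mono mult_left_mono) auto
  also have "\<dots> = (\<integral>\<^sup>+p. ennreal (exp (t * \<phi> p)) \<partial>J) ^ n"
    by (rule nn_integral_F_prod) measurable
  finally show ?thesis .
qed

text \<open>The probability that an independent \<open>Y\<close> fails the decoder's test
  \<open>\<psi>\<close> against the fixed codeword \<open>s\<close>. As an integral of an indicator
  instead of the measure of a set, it is measurable in \<open>s\<close> by Fubini.\<close>

definition confusion :: "real measure \<Rightarrow> nat \<Rightarrow> ('s \<times> real \<Rightarrow> real) \<Rightarrow> (nat \<Rightarrow> 's) \<Rightarrow> ennreal" where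
  "confusion PY n \<psi> s = (\<integral>\<^sup>+y. indicator {y. (\<Sum>i<n. \<psi> (s i, y i)) \<ge> 0} y \<partial>iid_law n PY)"

lemma confusion_measurable[measurable]:
  assumes "real_distribution PY" and [measurable]: "\<psi> \<in> borel_measurable (Q \<Otimes>\<^sub>M PY)"
  shows "confusion PY n \<psi> \<in> borel_measurable (words n)"
proof -
  interpret PY: real_distribution PY by fact
  interpret PYn': prob_space "iid_law n PY" by (rule prob_space_PiM) (rule PY.prob_space_axioms)
  have "confusion PY n \<psi> = (\<lambda>s. (\<integral>\<^sup>+y. (if (\<Sum>i<n. \<psi> (s i, y i)) \<ge> 0 then 1 else 0) \<partial>iid_law n PY))"
    unfolding confusion_def by (intro ext nn_integral_cong) (auto simp: indicator_def)
  also have "\<dots> \<in> borel_measurable (words n)" by measurable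
  finally show ?thesis .
qed

text \<open>Chernoff's bound is first applied to \<open>y\<close> with the codeword fixed. It
  factorizes over the letters of \<open>s\<close>, so the average over the channel is again an
  \<open>n\<close>-th power.\<close>

lemma chernoff_decoder:
  assumes "real_distribution PY" and \<psi>[measurable]: "\<psi> \<in> borel_measurable (Q \<Otimes>\<^sub>M PY)" and "t > 0"
  shows "(\<integral>\<^sup>+p. F n p * confusion PY n \<psi> (snd p) \<partial>(iid_law n PX \<Otimes>\<^sub>M words n))
    \<le> (\<integral>\<^sup>+p. (\<integral>\<^sup>+y. ennreal (exp (t * \<psi> (snd p, y))) \<partial>PY) \<partial>J) ^ n"
proof -
  interpret PY: real_distribution PY by fact
  interpret PYn: product_prob_space "\<lambda>_. PY" "{..<n}" ..
  have *: "confusion PY n \<psi> s \<le> (\<Prod>i<n. (\<integral>\<^sup>+y. ennreal (exp (t * \<psi> (s i, y))) \<partial>PY))"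
    if s: "s \<in> space (words n)" for s
  proof -
    have [simp]: "s i \<in> space Q" if "i < n" for i using s that by (auto simp: space_PiM)
    have "confusion PY n \<psi> s \<le> (\<integral>\<^sup>+y. (\<Prod>i<n. ennreal (exp (t * \<psi> (s i, y i)))) \<partial>iid_law n PY)"
      unfolding confusion_def
    proof (rule nn_integral_mono)
      fix y
      have "(\<Prod>i<n. ennreal (exp (t * \<psi> (s i, y i)))) = ennreal (exp (t * (\<Sum>i<n. \<psi> (s i, y i))))"
        by (simp add: prod_ennreal exp_sum sum_distrib_left)
      then show "indicator {y. (\<Sum>i<n. \<psi> (s i, y i)) \<ge> 0} y \<le> (\<Prod>i<n. ennreal (exp (t * \<psi> (s i, y i))))"
        using \<open>t > 0\<close> by (auto simp: indicator_def simp flip: ennreal_1 intro!: ennreal_leI)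
    qed
    also have "\<dots> = (\<Prod>i<n. (\<integral>\<^sup>+y. ennreal (exp (t * \<psi> (s i, y))) \<partial>PY))"
      using s by (intro PYn.product_nn_integral_prod) auto
    finally show ?thesis .
  qed
  have "(\<integral>\<^sup>+p. F n p * confusion PY n \<psi> (snd p) \<partial>(iid_law n PX \<Otimes>\<^sub>M words n))
    \<le> (\<integral>\<^sup>+p. F n p * (\<Prod>i<n. (\<lambda>q. (\<integral>\<^sup>+y. ennreal (exp (t * \<psi> (snd q, y))) \<partial>PY)) (fst p i, snd p i)) \<partial>(iid_law n PX \<Otimes>\<^sub>M words n))"
    using * by (intro nn_integral_mono mult_left_mono) (auto simp: space_pair_measure)
  also have "\<dots> = (\<integral>\<^sup>+p. (\<integral>\<^sup>+y. ennreal (exp (t * \<psi> (snd p, y))) \<partial>PY) \<partial>J) ^ n"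
    by (rule nn_integral_F_prod) measurable
  finally show ?thesis .
qed

text \<open>A small probability of confusion is part of typicality: by Markov's inequality it holds with
  high probability, and so the independence of \<open>Y\<close> from the chosen codeword needs no further care.\<close>

definition typical :: "real measure \<Rightarrow> nat \<Rightarrow> real \<Rightarrow> (real \<times> 's \<Rightarrow> real) set \<Rightarrow> ('s \<times> real \<Rightarrow> real) set
    \<Rightarrow> ((nat \<Rightarrow> real) \<times> (nat \<Rightarrow> 's)) set" where
  "typical PY n \<kappa> \<Phi> \<Psi> = {p \<in> space (iid_law n PX \<Otimes>\<^sub>M words n).
     (\<forall>\<phi>\<in>\<Phi>. (\<Sum>i<n. \<phi> (fst p i, snd p i)) < 0) \<and> (\<forall>\<psi>\<in>\<Psi>. confusion PY n \<psi> (snd p) \<le> ennreal (\<kappa> ^ n))}"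

lemma sets_typical:
  assumes "real_distribution PY" "finite \<Phi>" "finite \<Psi>"
    and [measurable]: "\<And>\<phi>. \<phi> \<in> \<Phi> \<Longrightarrow> \<phi> \<in> borel_measurable (PX \<Otimes>\<^sub>M Q)"
      "\<And>\<psi>. \<psi> \<in> \<Psi> \<Longrightarrow> \<psi> \<in> borel_measurable (Q \<Otimes>\<^sub>M PY)"
  shows "typical PY n \<kappa> \<Phi> \<Psi> \<in> sets (iid_law n PX \<Otimes>\<^sub>M words n)"
proof -
  have "{p \<in> space (iid_law n PX \<Otimes>\<^sub>M words n). \<forall>\<phi>\<in>\<Phi>. (\<Sum>i<n. \<phi> (fst p i, snd p i)) < 0}
      \<in> sets (iid_law n PX \<Otimes>\<^sub>M words n)"
    using assms(2) by (intro sets.sets_Collect_finite_All) measurable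
  moreover have "{p \<in> space (iid_law n PX \<Otimes>\<^sub>M words n). \<forall>\<psi>\<in>\<Psi>. confusion PY n \<psi> (snd p) \<le> ennreal (\<kappa> ^ n)}
      \<in> sets (iid_law n PX \<Otimes>\<^sub>M words n)"
  proof (intro sets.sets_Collect_finite_All assms(3))
    fix \<psi> assume "\<psi> \<in> \<Psi>"
    then have [measurable]: "confusion PY n \<psi> \<in> borel_measurable (words n)"
      using assms by (intro confusion_measurable) auto
    show "{p \<in> space (iid_law n PX \<Otimes>\<^sub>M words n). confusion PY n \<psi> (snd p) \<le> ennreal (\<kappa> ^ n)}
      \<in> sets (iid_law n PX \<Otimes>\<^sub>M words n)" by measurable
  qed
  ultimately show ?thesis unfolding typical_def
    by (rule sets.Int[THEN back_subst[of "\<lambda>A. A \<in> _"]]) auto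
qed

text \<open>A union bound over the tests. The square root comes from Markov's inequality: the
  average confusion is at most \<open>\<rho> ^ n\<close>, so it exceeds the threshold
  \<open>sqrt \<rho> ^ n\<close> with probability at most
  \<open>\<rho> ^ n / sqrt \<rho> ^ n = sqrt \<rho> ^ n\<close>.\<close>

lemma atypical_bound:
  assumes "real_distribution PY" "finite \<Phi>" "finite \<Psi>" "0 < \<rho>" "\<rho> < 1"
    and \<Phi>m: "\<And>\<phi>. \<phi> \<in> \<Phi> \<Longrightarrow> \<phi> \<in> borel_measurable (PX \<Otimes>\<^sub>M Q)"
    and \<Psi>m: "\<And>\<psi>. \<psi> \<in> \<Psi> \<Longrightarrow> \<psi> \<in> borel_measurable (Q \<Otimes>\<^sub>M PY)"
    and \<Phi>: "\<And>\<phi>. \<phi> \<in> \<Phi> \<Longrightarrow> \<exists>t>0. (\<integral>\<^sup>+p. ennreal (exp (t * \<phi> p)) \<partial>J) \<le> ennreal \<rho>"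
    and \<Psi>: "\<And>\<psi>. \<psi> \<in> \<Psi> \<Longrightarrow> \<exists>t>0. (\<integral>\<^sup>+p. (\<integral>\<^sup>+y. ennreal (exp (t * \<psi> (snd p, y))) \<partial>PY) \<partial>J) \<le> ennreal \<rho>"
  shows "(\<integral>\<^sup>+p. F n p * indicator (- typical PY n (sqrt \<rho>) \<Phi> \<Psi>) p \<partial>(iid_law n PX \<Otimes>\<^sub>M words n))
    \<le> ennreal (real (card \<Phi> + card \<Psi>) * sqrt \<rho> ^ n)"
proof -
  let ?M = "iid_law n PX \<Otimes>\<^sub>M words n"
  define \<kappa> where "\<kappa> = sqrt \<rho>"
  have "0 < \<kappa>" "\<kappa> \<le> 1" and \<kappa>2: "\<kappa> * \<kappa> = \<rho>" using assms(4,5) by (auto simp: \<kappa>_def)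
  then have \<kappa>: "0 < \<kappa>" "\<rho> \<le> \<kappa>" "\<kappa> * \<kappa> = \<rho>" using mult_left_mono[of \<kappa> 1 \<kappa>] by auto
  define E where "E \<phi> = {p. (\<Sum>i<n. \<phi> (fst p i, snd p i)) \<ge> 0}" for \<phi> :: "real \<times> 's \<Rightarrow> real"
  \<comment> \<open>Markov's majorant of the indicator that the confusion exceeds
    \<open>\<kappa> ^ n\<close>.\<close>
  define \<beta> where "\<beta> \<psi> p = confusion PY n \<psi> (snd p) * ennreal (inverse (\<kappa> ^ n))"
    for \<psi> and p :: "(nat \<Rightarrow> real) \<times> (nat \<Rightarrow> 's)"
  have [measurable]: "\<And>\<phi>. \<phi> \<in> \<Phi> \<Longrightarrow> (\<lambda>p. F n p * indicator (E \<phi>) p) \<in> borel_measurable ?M"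
  proof -
    fix \<phi> assume "\<phi> \<in> \<Phi>"
    note [measurable] = \<Phi>m[OF this]
    have "(\<lambda>p. F n p * indicator (E \<phi>) p) = (\<lambda>p. F n p * (if (\<Sum>i<n. \<phi> (fst p i, snd p i)) \<ge> 0 then 1 else 0))"
      by (auto simp: E_def indicator_def fun_eq_iff)
    also have "\<dots> \<in> borel_measurable ?M" by measurable
    finally show "(\<lambda>p. F n p * indicator (E \<phi>) p) \<in> borel_measurable ?M" .
  qed
  have [measurable]: "\<And>\<psi>. \<psi> \<in> \<Psi> \<Longrightarrow> confusion PY n \<psi> \<in> borel_measurable (words n)"
    using assms(1) \<Psi>m by (rule confusion_measurable)
  have [measurable]: "\<And>\<psi>. \<psi> \<in> \<Psi> \<Longrightarrow> (\<lambda>p. F n p * \<beta> \<psi> p) \<in> borel_measurable ?M"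
    unfolding \<beta>_def by measurable
  have "F n p * indicator (- typical PY n \<kappa> \<Phi> \<Psi>) p
      \<le> (\<Sum>\<phi>\<in>\<Phi>. F n p * indicator (E \<phi>) p) + (\<Sum>\<psi>\<in>\<Psi>. F n p * \<beta> \<psi> p)" if "p \<in> space ?M" for p
  proof (cases "p \<in> typical PY n \<kappa> \<Phi> \<Psi>")
    case False
    then consider \<phi> where "\<phi> \<in> \<Phi>" "p \<in> E \<phi>" | \<psi> where "\<psi> \<in> \<Psi>" "ennreal (\<kappa> ^ n) < confusion PY n \<psi> (snd p)"
      using \<open>p \<in> space ?M\<close> by (auto simp: typical_def E_def not_less not_le)
    then show ?thesis
    proof cases
      case 1
      have "F n p * indicator (- typical PY n \<kappa> \<Phi> \<Psi>) p \<le> F n p * indicator (E \<phi>) p"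
        using 1 by (intro mult_left_mono) (auto simp: indicator_def)
      also have "\<dots> \<le> (\<Sum>\<phi>\<in>\<Phi>. F n p * indicator (E \<phi>) p)"
        using 1 assms(2) by (intro member_le_sum) auto
      finally show ?thesis by (simp add: add_increasing2)
    next
      case 2
      have "1 = ennreal (\<kappa> ^ n) * ennreal (inverse (\<kappa> ^ n))"
        using \<kappa> by (simp flip: ennreal_mult)
      also have "\<dots> \<le> \<beta> \<psi> p" unfolding \<beta>_def using 2 by (intro mult_right_mono) auto
      finally have "1 \<le> \<beta> \<psi> p" .
      then have "F n p * indicator (- typical PY n \<kappa> \<Phi> \<Psi>) p \<le> F n p * \<beta> \<psi> p"
        by (intro mult_left_mono) (auto simp: indicator_def)
      also have "\<dots> \<le> (\<Sum>\<psi>\<in>\<Psi>. F n p * \<beta> \<psi> p)"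
        using 2 assms(3) by (intro member_le_sum) auto
      finally show ?thesis by (simp add: add_increasing)
    qed
  qed auto
  then have "(\<integral>\<^sup>+p. F n p * indicator (- typical PY n \<kappa> \<Phi> \<Psi>) p \<partial>?M)
      \<le> (\<integral>\<^sup>+p. (\<Sum>\<phi>\<in>\<Phi>. F n p * indicator (E \<phi>) p) + (\<Sum>\<psi>\<in>\<Psi>. F n p * \<beta> \<psi> p) \<partial>?M)"
    by (rule nn_integral_mono)
  also have "\<dots> = (\<Sum>\<phi>\<in>\<Phi>. (\<integral>\<^sup>+p. F n p * indicator (E \<phi>) p \<partial>?M)) + (\<Sum>\<psi>\<in>\<Psi>. (\<integral>\<^sup>+p. F n p * \<beta> \<psi> p \<partial>?M))"
    by (subst nn_integral_add) (auto simp: nn_integral_sum)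
  also have "\<dots> \<le> (\<Sum>\<phi>\<in>\<Phi>. ennreal (\<kappa> ^ n)) + (\<Sum>\<psi>\<in>\<Psi>. ennreal (\<kappa> ^ n))"
  proof (intro add_mono sum_mono)
    fix \<phi> assume \<phi>: "\<phi> \<in> \<Phi>"
    obtain t where t: "t > 0" "(\<integral>\<^sup>+p. ennreal (exp (t * \<phi> p)) \<partial>J) \<le> ennreal \<rho>"
      using \<Phi>[OF \<phi>] by auto
    have "(\<integral>\<^sup>+p. F n p * indicator (E \<phi>) p \<partial>?M) \<le> (\<integral>\<^sup>+p. ennreal (exp (t * \<phi> p)) \<partial>J) ^ n"
      unfolding E_def by (rule chernoff_encoder[OF \<Phi>m[OF \<phi>] t(1)])
    also have "\<dots> \<le> ennreal \<rho> ^ n" using t(2) by (intro power_mono) auto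
    also have "\<dots> = ennreal (\<rho> ^ n)" using assms(4) by (simp add: ennreal_power)
    also have "\<dots> \<le> ennreal (\<kappa> ^ n)" using \<kappa> assms(4) by (intro ennreal_leI power_mono) auto
    finally show "(\<integral>\<^sup>+p. F n p * indicator (E \<phi>) p \<partial>?M) \<le> ennreal (\<kappa> ^ n)" .
  next
    fix \<psi> assume \<psi>: "\<psi> \<in> \<Psi>"
    obtain t where t: "t > 0" "(\<integral>\<^sup>+p. (\<integral>\<^sup>+y. ennreal (exp (t * \<psi> (snd p, y))) \<partial>PY) \<partial>J) \<le> ennreal \<rho>"
      using \<Psi>[OF \<psi>] by auto
    have "(\<integral>\<^sup>+p. F n p * \<beta> \<psi> p \<partial>?M) = (\<integral>\<^sup>+p. F n p * confusion PY n \<psi> (snd p) \<partial>?M) * ennreal (inverse (\<kappa> ^ n))"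
      unfolding \<beta>_def using \<psi> by (subst nn_integral_multc[symmetric]) (auto simp: mult_ac)
    also have "\<dots> \<le> (\<integral>\<^sup>+p. (\<integral>\<^sup>+y. ennreal (exp (t * \<psi> (snd p, y))) \<partial>PY) \<partial>J) ^ n * ennreal (inverse (\<kappa> ^ n))"
      by (intro mult_right_mono chernoff_decoder[OF assms(1) \<Psi>m[OF \<psi>] t(1)]) auto
    also have "\<dots> \<le> ennreal \<rho> ^ n * ennreal (inverse (\<kappa> ^ n))"
      using t(2) by (intro mult_right_mono power_mono) auto
    also have "\<dots> = ennreal (\<rho> ^ n * inverse (\<kappa> ^ n))"
      using assms(4) \<kappa>(1) ennreal_power[of \<rho> n] ennreal_mult[of "\<rho> ^ n" "inverse (\<kappa> ^ n)"] by auto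
    also have "\<rho> ^ n * inverse (\<kappa> ^ n) = \<kappa> ^ n"
      unfolding \<kappa>2[symmetric] using \<kappa>(1) by (simp add: power_mult_distrib)
    finally show "(\<integral>\<^sup>+p. F n p * \<beta> \<psi> p \<partial>?M) \<le> ennreal (\<kappa> ^ n)" .
  qed
  also have "\<dots> = ennreal (real (card \<Phi> + card \<Psi>) * \<kappa> ^ n)"
    using \<kappa>(1) by (simp add: ennreal_of_nat_eq_real_of_nat algebra_simps flip: ennreal_plus ennreal_mult)
  finally show ?thesis by (simp add: \<kappa>_def)
qed

end

section \<open>From typical pairs to an identification system\<close>

lemma (in test_channel) ex_id_system:
  assumes "real_distribution PY" "finite \<Phi>" "finite \<Psi>" "0 < \<rho>" "\<rho> < 1" "n \<ge> 1" "R \<ge> 0"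
    and \<Phi>m: "\<And>\<phi>. \<phi> \<in> \<Phi> \<Longrightarrow> \<phi> \<in> borel_measurable (PX \<Otimes>\<^sub>M Q)"
    and \<Psi>m: "\<And>\<psi>. \<psi> \<in> \<Psi> \<Longrightarrow> \<psi> \<in> borel_measurable (Q \<Otimes>\<^sub>M PY)"
    and \<Phi>: "\<And>\<phi>. \<phi> \<in> \<Phi> \<Longrightarrow> \<exists>t>0. (\<integral>\<^sup>+p. ennreal (exp (t * \<phi> p)) \<partial>J) \<le> ennreal \<rho>"
    and \<Psi>: "\<And>\<psi>. \<psi> \<in> \<Psi> \<Longrightarrow> \<exists>t>0. (\<integral>\<^sup>+p. (\<integral>\<^sup>+y. ennreal (exp (t * \<psi> (snd p, y))) \<partial>PY) \<partial>J) \<le> ennreal \<rho>"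
    and info: "(\<lambda>p. ln (f p) - c) \<in> \<Phi>"
  shows "\<exists>T g. id_system n R T g \<and>
    (\<forall>x\<in>space (vec_space n). \<forall>y. g (T x) y = No \<longrightarrow>
      (\<exists>s. (\<forall>\<phi>\<in>\<Phi>. (\<Sum>i<n. \<phi> (x i, s i)) < 0) \<and> (\<forall>\<psi>\<in>\<Psi>. (\<Sum>i<n. \<psi> (s i, y i)) < 0))) \<and>
    prob_maybe n PX PY T g \<le> real (card \<Phi> + 2 * card \<Psi>) * sqrt \<rho> ^ n
      + exp (- (real (nat \<lfloor>2 powr (real n * R)\<rfloor> - 1) / exp (real n * c)))"
proof -
  interpret PY: real_distribution PY by fact
  interpret Pn: prob_space "iid_law n PX" by (rule prob_space_PiM) (rule PX.prob_space_axioms)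
  interpret PYn: prob_space "iid_law n PY" by (rule prob_space_PiM) (rule PY.prob_space_axioms)
  interpret Qn: prob_space "words n" by (rule prob_space_PiM) (rule Q.prob_space_axioms)
  define \<kappa> where "\<kappa> = sqrt \<rho>"
  have \<kappa>: "0 < \<kappa>" using assms by (simp add: \<kappa>_def)
  define I where "I = nat \<lfloor>2 powr (real n * R)\<rfloor>"
  define N where "N = I - 1"
  have "1 \<le> 2 powr (real n * R)" using assms by (intro ge_one_powr_ge_zero) auto
  then have "1 \<le> I" unfolding I_def by linarith
  then have IN: "I = Suc N" by (simp add: N_def)
  define Typ where "Typ = typical PY n \<kappa> \<Phi> \<Psi>"
  have Typ[measurable]: "Typ \<in> sets (iid_law n PX \<Otimes>\<^sub>M words n)"
    unfolding Typ_def by (rule sets_typical) (use assms in auto)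
  \<comment> \<open>The information test bounds the product of the densities by
    \<open>exp (n * c)\<close>. Because \<open>ln 0 = 0\<close>, it says nothing where a density
    vanishes, but there \<open>F n p = 0\<close>.\<close>
  have FL: "F n p \<le> ennreal (exp (real n * c))" if "p \<in> Typ" for p
  proof (cases "\<forall>i<n. f (fst p i, snd p i) > 0")
    case True
    have "(\<Sum>i<n. ln (f (fst p i, snd p i)) - c) < 0"
      using that info unfolding Typ_def typical_def by fastforce
    then have *: "(\<Sum>i<n. ln (f (fst p i, snd p i))) \<le> real n * c" by (simp add: sum_subtractf)
    have "F n p = ennreal (\<Prod>i<n. f (fst p i, snd p i))"
      unfolding F_def by (simp add: prod_ennreal f_nonneg)
    also have "(\<Prod>i<n. f (fst p i, snd p i)) = exp (\<Sum>i<n. ln (f (fst p i, snd p i)))"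
      using True by (simp add: exp_sum)
    also have "ennreal \<dots> \<le> ennreal (exp (real n * c))" using * by (intro ennreal_leI) simp
    finally show ?thesis .
  next
    case False
    then obtain i where "i < n" "f (fst p i, snd p i) = 0" using f_nonneg by (metis order_le_less)
    then have "F n p = 0" unfolding F_def by (intro prod_zero) (auto intro!: bexI[of _ i])
    then show ?thesis by simp
  qed
  have "\<exists>s. (\<forall>i. s i \<in> space (words n)) \<and>
    emeasure (iid_law n PX) {x \<in> space (iid_law n PX). \<forall>i<N. (x, s i) \<notin> Typ}
      \<le> (\<integral>\<^sup>+p. F n p * indicator (- Typ) p \<partial>(iid_law n PX \<Otimes>\<^sub>M words n)) + ennreal (exp (- (real N / exp (real n * c))))"
    using FL by (intro covering[OF Pn.prob_space_axioms Qn.prob_space_axioms Typ F_measurable F_normalized]) auto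
  then obtain s where s: "\<And>i. s i \<in> space (words n)" and
    cov: "emeasure (iid_law n PX) {x \<in> space (iid_law n PX). \<forall>i<N. (x, s i) \<notin> Typ}
      \<le> (\<integral>\<^sup>+p. F n p * indicator (- Typ) p \<partial>(iid_law n PX \<Otimes>\<^sub>M words n)) + ennreal (exp (- (real N / exp (real n * c))))" by blast
  have atyp: "(\<integral>\<^sup>+p. F n p * indicator (- Typ) p \<partial>(iid_law n PX \<Otimes>\<^sub>M words n))
      \<le> ennreal (real (card \<Phi> + card \<Psi>) * \<kappa> ^ n)"
    unfolding Typ_def \<kappa>_def by (rule atypical_bound) (use assms in auto)
  have [measurable]: "{x \<in> space (iid_law n PX). (x, s i) \<in> Typ} \<in> sets (iid_law n PX)" for i
    using s[of i] by measurable
  have predTyp[measurable]: "Measurable.pred (iid_law n PX) (\<lambda>x. (x, s i) \<in> Typ)" for i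
    unfolding pred_def by measurable
  \<comment> \<open>Codewords are numbered from 0 and indices from 1. An \<open>x\<close> without a
    typical codeword gets the spare index \<open>I = Suc N\<close>, for which \<open>g\<close>
    always answers \<open>Maybe\<close>.\<close>
  define T where "T x = (if \<exists>i<N. (x, s i) \<in> Typ then Suc (LEAST i. (x, s i) \<in> Typ) else I)" for x
  define g where "g j y = (if j \<le> N \<and> (\<forall>\<psi>\<in>\<Psi>. (\<Sum>i<n. \<psi> (s (j - 1) i, y i)) < 0) then No else Maybe)"
    for j and y :: "nat \<Rightarrow> real"
  have T1: "1 \<le> T x \<and> T x \<le> N \<and> (x, s (T x - 1)) \<in> Typ" if ex: "\<exists>i<N. (x, s i) \<in> Typ" for x
  proof -
    obtain i where i: "i < N" "(x, s i) \<in> Typ" using ex by blast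
    have "(LEAST i. (x, s i) \<in> Typ) \<le> i" by (rule Least_le) (rule i)
    moreover have "(x, s (LEAST i. (x, s i) \<in> Typ)) \<in> Typ" by (rule LeastI) (rule i)
    ultimately show ?thesis using i ex by (simp add: T_def)
  qed
  have T2: "T x = I" if "\<not> (\<exists>i<N. (x, s i) \<in> Typ)" for x using that unfolding T_def by (rule if_not_P)
  have Trange: "T x \<in> {1..I}" for x
    using T1[of x] T2[of x] IN by (cases "\<exists>i<N. (x, s i) \<in> Typ") auto
  have Tm0: "T \<in> iid_law n PX \<rightarrow>\<^sub>M count_space UNIV"
    unfolding T_def by measurable
  have sets_eq: "sets (iid_law n PX) = sets (vec_space n)" "sets (iid_law n PY) = sets (vec_space n)"
    by (auto intro!: sets_PiM_cong)
  have space_eq: "space (iid_law n PX) = space (vec_space n)" "space (iid_law n PY) = space (vec_space n)"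
    using sets_eq_imp_space_eq sets_eq by blast+
  have Tm: "T \<in> vec_space n \<rightarrow>\<^sub>M count_space (indices n R)"
  proof -
    have "T \<in> vec_space n \<rightarrow>\<^sub>M count_space UNIV"
      using Tm0 measurable_cong_sets[OF sets_eq(1) refl] by blast
    then have "T -` {j} \<inter> space (vec_space n) \<in> sets (vec_space n)" for j
      by (rule measurable_sets) simp
    then show ?thesis using Trange
      by (auto simp: measurable_count_space_eq_countable indices_def I_def)
  qed
  have gm: "g j \<in> iid_law n PY \<rightarrow>\<^sub>M count_space UNIV" for j
  proof -
    have "Measurable.pred (iid_law n PY) (\<lambda>y. \<forall>\<psi>\<in>\<Psi>. (\<Sum>i<n. \<psi> (s (j - 1) i, y i)) < 0)"
    proof (intro pred_intros_finite(3) assms(3))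
      fix \<psi> assume "\<psi> \<in> \<Psi>"
      note [measurable] = \<Psi>m[OF this]
      have [measurable]: "s (j - 1) i \<in> space Q" if "i \<in> {..<n}" for i
        using s[of "j - 1"] that by (auto simp: space_PiM)
      show "Measurable.pred (iid_law n PY) (\<lambda>y. (\<Sum>i<n. \<psi> (s (j - 1) i, y i)) < 0)"
        by measurable
    qed
    note [measurable] = this
    show ?thesis unfolding g_def by measurable
  qed
  have sys: "id_system n R T g"
    unfolding id_system_def using Tm gm measurable_cong_sets[OF sets_eq(2) refl] by blast
  have sound: "\<exists>s. (\<forall>\<phi>\<in>\<Phi>. (\<Sum>i<n. \<phi> (x i, s i)) < 0) \<and> (\<forall>\<psi>\<in>\<Psi>. (\<Sum>i<n. \<psi> (s i, y i)) < 0)"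
    if "g (T x) y = No" for x y
  proof -
    have g: "T x \<le> N" "\<forall>\<psi>\<in>\<Psi>. (\<Sum>i<n. \<psi> (s (T x - 1) i, y i)) < 0"
      using that by (auto simp: g_def split: if_splits)
    then have "\<exists>i<N. (x, s i) \<in> Typ" using T2[of x] IN by auto
    from T1[OF this] show ?thesis
      using g by (intro exI[of _ "s (T x - 1)"]) (auto simp: Typ_def typical_def)
  qed
  define E where "E = {(x, y) \<in> space (iid_law n PX \<Otimes>\<^sub>M iid_law n PY). g (T x) y = Maybe}"
  define U where "U = {x \<in> space (iid_law n PX). \<forall>i<N. (x, s i) \<notin> Typ}"
  have [measurable]: "U \<in> sets (iid_law n PX)"
    unfolding U_def by measurable
  have E_alt: "E = {p \<in> space (iid_law n PX \<Otimes>\<^sub>M iid_law n PY). \<exists>j\<in>{1..I}. T (fst p) = j \<and> g j (snd p) = Maybe}"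
    unfolding E_def using Trange by auto
  have [measurable]: "E \<in> sets (iid_law n PX \<Otimes>\<^sub>M iid_law n PY)"
    unfolding E_alt using Tm0 gm by measurable
  \<comment> \<open>For a covered \<open>x\<close> the chosen codeword is typical, hence has small
    confusion by definition, no matter how it depends on \<open>x\<close>. This is the second
    contribution of \<open>card \<Psi>\<close> to the final bound; the first one is in
    \<open>atyp\<close>.\<close>
  have cond: "emeasure (iid_law n PY) (Pair x -` E)
      \<le> indicator U x + ennreal (real (card \<Psi>) * \<kappa> ^ n)" if x: "x \<in> space (iid_law n PX)" for x
  proof (cases "x \<in> U")
    case True
    have "emeasure (iid_law n PY) (Pair x -` E) \<le> 1" by (rule PYn.emeasure_le_1)
    then show ?thesis using True by (simp add: add_increasing2)
  next
    case False
    then have "\<exists>i<N. (x, s i) \<in> Typ" using x by (auto simp: U_def)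
    note t = T1[OF this]
    define s' where "s' = s (T x - 1)"
    have s': "s' \<in> space (words n)" unfolding s'_def by (rule s)
    have [measurable]: "s' i \<in> space Q" if "i \<in> {..<n}" for i
      using s' that by (auto simp: space_PiM)
    define V where "V \<psi> = {y \<in> space (iid_law n PY). (\<Sum>i<n. \<psi> (s' i, y i)) \<ge> 0}" for \<psi> :: "'s \<times> real \<Rightarrow> real"
    have Vm: "V \<psi> \<in> sets (iid_law n PY)" if "\<psi> \<in> \<Psi>" for \<psi>
    proof -
      note [measurable] = \<Psi>m[OF that]
      show ?thesis unfolding V_def by measurable
    qed
    have Vle: "emeasure (iid_law n PY) (V \<psi>) \<le> ennreal (\<kappa> ^ n)" if "\<psi> \<in> \<Psi>" for \<psi>
    proof -
      have "emeasure (iid_law n PY) (V \<psi>) = confusion PY n \<psi> s'"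
        unfolding confusion_def using Vm[OF that]
        by (simp only: nn_integral_indicator[symmetric]) (auto intro!: nn_integral_cong simp: V_def indicator_def)
      also have "\<dots> \<le> ennreal (\<kappa> ^ n)"
        using t that unfolding s'_def Typ_def typical_def by auto
      finally show ?thesis .
    qed
    have "Pair x -` E \<subseteq> (\<Union>\<psi>\<in>\<Psi>. V \<psi>)"
      using t unfolding E_def g_def V_def s'_def
      by (auto simp: space_pair_measure not_less split: if_splits)
    then have "emeasure (iid_law n PY) (Pair x -` E) \<le> emeasure (iid_law n PY) (\<Union>\<psi>\<in>\<Psi>. V \<psi>)"
      using Vm assms(3) by (intro emeasure_mono sets.finite_UN) auto
    also have "\<dots> \<le> (\<Sum>\<psi>\<in>\<Psi>. emeasure (iid_law n PY) (V \<psi>))"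
      using Vm assms(3) by (intro emeasure_subadditive_finite) auto
    also have "\<dots> \<le> (\<Sum>\<psi>\<in>\<Psi>. ennreal (\<kappa> ^ n))" using Vle by (rule sum_mono)
    also have "\<dots> = ennreal (real (card \<Psi>) * \<kappa> ^ n)"
      using \<kappa> by (simp add: ennreal_mult ennreal_of_nat_eq_real_of_nat)
    finally show ?thesis by (simp add: add_increasing)
  qed
  have "emeasure (iid_law n PX \<Otimes>\<^sub>M iid_law n PY) E
      = (\<integral>\<^sup>+x. emeasure (iid_law n PY) (Pair x -` E) \<partial>iid_law n PX)"
    by (rule PYn.emeasure_pair_measure_alt) measurable
  also have "\<dots> \<le> (\<integral>\<^sup>+x. indicator U x + ennreal (real (card \<Psi>) * \<kappa> ^ n) \<partial>iid_law n PX)"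
    using cond by (rule nn_integral_mono)
  also have "\<dots> = emeasure (iid_law n PX) U + ennreal (real (card \<Psi>) * \<kappa> ^ n)"
    by (subst nn_integral_add) (auto simp: Pn.emeasure_space_1)
  also have "\<dots> \<le> (ennreal (real (card \<Phi> + card \<Psi>) * \<kappa> ^ n) + ennreal (exp (- (real N / exp (real n * c)))))
      + ennreal (real (card \<Psi>) * \<kappa> ^ n)"
    unfolding U_def using cov atyp by (intro add_mono order_refl) (meson add_mono order_refl order_trans)
  also have "\<dots> = ennreal (real (card \<Phi> + 2 * card \<Psi>) * \<kappa> ^ n + exp (- (real N / exp (real n * c))))"
    using \<kappa> by (simp add: algebra_simps flip: ennreal_plus)
  finally have "measure (iid_law n PX \<Otimes>\<^sub>M iid_law n PY) E
      \<le> real (card \<Phi> + 2 * card \<Psi>) * \<kappa> ^ n + exp (- (real N / exp (real n * c)))"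
    unfolding measure_def using \<kappa> by (intro enn2real_leI) auto
  then have "prob_maybe n PX PY T g \<le> real (card \<Phi> + 2 * card \<Psi>) * \<kappa> ^ n
      + exp (- (real N / exp (real n * c)))"
    unfolding prob_maybe_def E_def .
  then show ?thesis
    using sys sound unfolding \<kappa>_def N_def I_def by blast
qed

text \<open>The left-hand side decays doubly exponentially if \<open>c < R * ln 2\<close>;
  \<open>exp u \<ge> u\<close> weakens this to a geometric rate. Rounding down and the spare index
  cost less than 2 codewords, whence the factor \<open>exp 2\<close>; \<open>c \<ge> 0\<close> keeps
  this loss bounded after division by \<open>exp (n * c)\<close>.\<close>

lemma exp_overflow_bound:
  fixes R c :: real and n :: nat
  assumes "c \<ge> 0"
  shows "exp (- (real (nat \<lfloor>2 powr (real n * R)\<rfloor> - 1) / exp (real n * c))) \<le> exp 2 * exp (c - R * ln 2) ^ n"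
proof -
  define N where "N = nat \<lfloor>2 powr (real n * R)\<rfloor> - 1"
  have "2 powr (real n * R) - 2 \<le> real N" unfolding N_def by linarith
  moreover have "1 \<le> exp (real n * c)" using assms by simp
  ultimately have "2 powr (real n * R) - 2 * exp (real n * c) \<le> real N" by linarith
  then have "2 powr (real n * R) / exp (real n * c) - 2 \<le> real N / exp (real n * c)"
    using divide_right_mono[of _ "real N" "exp (real n * c)"] by (fastforce simp: diff_divide_distrib)
  moreover have "2 powr (real n * R) / exp (real n * c) = exp (real n * (R * ln 2 - c))"
    by (simp add: powr_def exp_diff[symmetric] algebra_simps)
  moreover have "real n * (R * ln 2 - c) \<le> exp (real n * (R * ln 2 - c))"
    using exp_ge_add_one_self[of "real n * (R * ln 2 - c)"] by linarith
  ultimately have "- (real N / exp (real n * c)) \<le> 2 + real n * (c - R * ln 2)"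
    by (simp add: algebra_simps)
  then have "exp (- (real N / exp (real n * c))) \<le> exp (2 + real n * (c - R * ln 2))" by simp
  also have "\<dots> = exp 2 * exp (c - R * ln 2) ^ n" by (simp add: exp_add exp_of_nat_mult)
  finally show ?thesis by (simp add: N_def)
qed

text \<open>Finitely many tests share a common margin \<open>\<rho>\<close>, while the parameter
  \<open>t\<close> may differ from test to test.\<close>

lemma finite_uniform_less_one:
  fixes h :: "'i \<Rightarrow> real \<Rightarrow> ennreal"
  assumes "finite S" "\<And>i. i \<in> S \<Longrightarrow> \<exists>t>0. h i t < 1"
  shows "\<exists>\<rho>. 0 < \<rho> \<and> \<rho> < 1 \<and> (\<forall>i\<in>S. \<exists>t>0. h i t \<le> ennreal \<rho>)"
  using assms
proof (induction S)
  case empty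
  then show ?case by (intro exI[of _ "1/2"]) auto
next
  case (insert i S)
  then obtain \<rho> where \<rho>: "0 < \<rho>" "\<rho> < 1" "\<forall>i\<in>S. \<exists>t>0. h i t \<le> ennreal \<rho>" by auto
  obtain t where t: "t > 0" "h i t < 1" using insert.prems[of i] by auto
  obtain \<rho>' where r: "0 \<le> \<rho>'" "h i t = ennreal \<rho>'"
    using t(2) by (metis ennreal_cases ennreal_one_neq_top less_imp_le neq_top_trans)
  then have "\<rho>' < 1" using t(2) by (simp add: ennreal_less_one_iff)
  have "\<forall>i\<in>insert i S. \<exists>t>0. h i t \<le> ennreal (max \<rho> \<rho>')"
  proof
    fix j assume "j \<in> insert i S"
    then show "\<exists>t>0. h j t \<le> ennreal (max \<rho> \<rho>')"
    proof (elim insertE)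
      assume "j = i" then show ?thesis using t r by (auto intro!: exI[of _ t] ennreal_leI)
    next
      assume "j \<in> S"
      then obtain t where "t > 0" "h j t \<le> ennreal \<rho>" using \<rho> by auto
      moreover have "ennreal \<rho> \<le> ennreal (max \<rho> \<rho>')" by (intro ennreal_leI) auto
      ultimately show ?thesis by (auto intro: order_trans)
    qed
  qed
  then show ?case using \<rho> \<open>\<rho>' < 1\<close> by (intro exI[of _ "max \<rho> \<rho>'"]) auto
qed

text \<open>Negative means give exponential moments below 1, hence geometric decay for all tests.
  The information is handled as one more encoder test, \<open>ln f - c\<close>; the bound
  \<open>L\<close> on the density makes it bounded above like the others.\<close>

theorem (in test_channel) id_coding:
  fixes \<Phi> :: "(real \<times> 's \<Rightarrow> real) set" and \<Psi> :: "('s \<times> real \<Rightarrow> real) set"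
  assumes "real_distribution PY" "finite \<Phi>" "finite \<Psi>" and "R > 0"
    and \<Phi>: "\<And>\<phi>. \<phi> \<in> \<Phi> \<Longrightarrow> integrable J \<phi> \<and> (\<integral>p. \<phi> p \<partial>J) < 0"
    and \<Phi>b: "\<And>\<phi>. \<phi> \<in> \<Phi> \<Longrightarrow> \<exists>B. \<forall>p\<in>space J. \<phi> p \<le> B"
    and \<Psi>m: "\<And>\<psi>. \<psi> \<in> \<Psi> \<Longrightarrow> \<psi> \<in> borel_measurable (Q \<Otimes>\<^sub>M PY)"
    and \<Psi>: "\<And>\<psi>. \<psi> \<in> \<Psi> \<Longrightarrow> integrable (J \<Otimes>\<^sub>M PY) (\<lambda>q. \<psi> (snd (fst q), snd q))
        \<and> (\<integral>q. \<psi> (snd (fst q), snd q) \<partial>(J \<Otimes>\<^sub>M PY)) < 0"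
    and \<Psi>b: "\<And>\<psi>. \<psi> \<in> \<Psi> \<Longrightarrow> \<exists>B. \<forall>q\<in>space (Q \<Otimes>\<^sub>M PY). \<psi> q \<le> B"
    and info: "integrable J (\<lambda>p. ln (f p))" "(\<integral>p. ln (f p) \<partial>J) < R * ln 2"
    and fb: "\<And>p. f p \<le> L"
  shows "\<exists>C \<kappa>. 0 < C \<and> 0 < \<kappa> \<and> \<kappa> < 1 \<and> (\<forall>n\<ge>1. \<exists>T g. id_system n R T g \<and>
    (\<forall>x\<in>space (vec_space n). \<forall>y. g (T x) y = No \<longrightarrow>
      (\<exists>s. (\<forall>\<phi>\<in>\<Phi>. (\<Sum>i<n. \<phi> (x i, s i)) < 0) \<and> (\<forall>\<psi>\<in>\<Psi>. (\<Sum>i<n. \<psi> (s i, y i)) < 0))) \<and>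
    prob_maybe n PX PY T g \<le> C * \<kappa> ^ n)"
proof -
  interpret PY: real_distribution PY by fact
  interpret J: prob_space J by (rule prob_space_J)
  interpret JY: pair_prob_space J PY ..
  have "max 0 (\<integral>p. ln (f p) \<partial>J) < R * ln 2" using info \<open>R > 0\<close> by simp
  \<comment> \<open>Above the information, \<open>c\<close> gives the information test a negative
    mean; below the rate in nats, it makes the codebook exponentially larger than required.
    Nonnegativity is for \<open>exp_overflow_bound\<close>.\<close>
  then obtain c where c: "0 \<le> c" "(\<integral>p. ln (f p) \<partial>J) < c" "c < R * ln 2"
    using dense by (metis less_imp_le max_less_iff_conj)
  define \<Phi>' where "\<Phi>' = insert (\<lambda>p. ln (f p) - c) \<Phi>"
  have "finite \<Phi>'" using assms by (simp add: \<Phi>'_def)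
  have \<Phi>': "integrable J \<phi> \<and> (\<integral>p. \<phi> p \<partial>J) < 0" if "\<phi> \<in> \<Phi>'" for \<phi>
    using that \<Phi> info c by (auto simp: \<Phi>'_def J.prob_space)
  \<comment> \<open>The outer maximum with 0 covers \<open>f p = 0\<close>, where
    \<open>ln 0 = 0\<close>.\<close>
  have lnb: "ln (f p) \<le> max 0 (ln (max 1 L))" for p
  proof (cases "f p = 0")
    case False
    then have "0 < f p" using f_nonneg[of p] by linarith
    then have "ln (f p) \<le> ln (max 1 L)" using fb[of p] by (subst ln_le_cancel_iff) auto
    then show ?thesis by simp
  qed simp
  have \<Phi>'b: "\<exists>B. \<forall>p\<in>space J. \<phi> p \<le> B" if "\<phi> \<in> \<Phi>'" for \<phi>
  proof (cases "\<phi> \<in> \<Phi>")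
    case True
    then show ?thesis by (rule \<Phi>b)
  next
    case False
    then have "\<phi> = (\<lambda>p. ln (f p) - c)" using that by (simp add: \<Phi>'_def)
    then show ?thesis using lnb by (intro exI[of _ "max 0 (ln (max 1 L)) - c"]) auto
  qed
  have \<Phi>'m: "\<phi> \<in> borel_measurable (PX \<Otimes>\<^sub>M Q)" if "\<phi> \<in> \<Phi>'" for \<phi>
  proof -
    have "\<phi> \<in> borel_measurable J" using \<Phi>'[OF that] by auto
    then show ?thesis by measurable
  qed
  have "\<exists>t>0. (\<integral>\<^sup>+p. ennreal (exp (t * \<phi> p)) \<partial>J) < 1" if \<phi>: "\<phi> \<in> \<Phi>'" for \<phi>
  proof -
    obtain B where "\<forall>p\<in>space J. \<phi> p \<le> B" using \<Phi>'b[OF \<phi>] by blast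
    then show ?thesis
      using \<Phi>'[OF \<phi>] by (intro J.exp_moment_less_one[where B=B]) auto
  qed
  from finite_uniform_less_one[OF \<open>finite \<Phi>'\<close>, of "\<lambda>\<phi> t. \<integral>\<^sup>+p. ennreal (exp (t * \<phi> p)) \<partial>J", OF this] obtain \<rho>1
    where \<rho>1: "0 < \<rho>1" "\<rho>1 < 1"
      "\<And>\<phi>. \<phi> \<in> \<Phi>' \<Longrightarrow> \<exists>t>0. (\<integral>\<^sup>+p. ennreal (exp (t * \<phi> p)) \<partial>J) \<le> ennreal \<rho>1" by blast
  have "\<exists>t>0. (\<integral>\<^sup>+p. (\<integral>\<^sup>+y. ennreal (exp (t * \<psi> (snd p, y))) \<partial>PY) \<partial>J) < 1" if \<psi>: "\<psi> \<in> \<Psi>" for \<psi>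
  proof -
    note [measurable] = \<Psi>m[OF \<psi>]
    obtain B where B: "\<forall>p\<in>space (Q \<Otimes>\<^sub>M PY). \<psi> p \<le> B" using \<Psi>b[OF \<psi>] by blast
    have "\<exists>t>0. (\<integral>\<^sup>+q. ennreal (exp (t * \<psi> (snd (fst q), snd q))) \<partial>(J \<Otimes>\<^sub>M PY)) < 1"
      using \<Psi>[OF \<psi>] B
      by (intro JY.exp_moment_less_one[where B=B]) (auto simp: space_pair_measure space_J)
    moreover have "(\<integral>\<^sup>+q. ennreal (exp (t * \<psi> (snd (fst q), snd q))) \<partial>(J \<Otimes>\<^sub>M PY))
        = (\<integral>\<^sup>+p. (\<integral>\<^sup>+y. ennreal (exp (t * \<psi> (snd p, y))) \<partial>PY) \<partial>J)" for t
      by (subst PY.nn_integral_fst[symmetric]) auto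
    ultimately show ?thesis by simp
  qed
  from finite_uniform_less_one[OF \<open>finite \<Psi>\<close>,
    of "\<lambda>\<psi> t. \<integral>\<^sup>+p. (\<integral>\<^sup>+y. ennreal (exp (t * \<psi> (snd p, y))) \<partial>PY) \<partial>J", OF this] obtain \<rho>2
    where \<rho>2: "0 < \<rho>2" "\<rho>2 < 1"
      "\<And>\<psi>. \<psi> \<in> \<Psi> \<Longrightarrow> \<exists>t>0. (\<integral>\<^sup>+p. (\<integral>\<^sup>+y. ennreal (exp (t * \<psi> (snd p, y))) \<partial>PY) \<partial>J) \<le> ennreal \<rho>2" by blast
  define \<rho> where "\<rho> = max \<rho>1 \<rho>2"
  have \<rho>: "0 < \<rho>" "\<rho> < 1" "ennreal \<rho>1 \<le> ennreal \<rho>" "ennreal \<rho>2 \<le> ennreal \<rho>"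
    using \<rho>1 \<rho>2 by (auto simp: \<rho>_def intro!: ennreal_leI)
  have b1: "\<exists>t>0. (\<integral>\<^sup>+p. ennreal (exp (t * \<phi> p)) \<partial>J) \<le> ennreal \<rho>" if "\<phi> \<in> \<Phi>'" for \<phi>
    using \<rho>1(3)[OF that] \<rho>(3) order_trans by blast
  have b2: "\<exists>t>0. (\<integral>\<^sup>+p. (\<integral>\<^sup>+y. ennreal (exp (t * \<psi> (snd p, y))) \<partial>PY) \<partial>J) \<le> ennreal \<rho>" if "\<psi> \<in> \<Psi>" for \<psi>
    using \<rho>2(3)[OF that] \<rho>(4) order_trans by blast
  define e where "e = exp (c - R * ln 2)"
  have e: "0 < e" "e < 1" using c by (auto simp: e_def)
  define \<kappa> where "\<kappa> = max (sqrt \<rho>) e"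
  have \<kappa>: "0 < \<kappa>" "\<kappa> < 1" using \<rho> e by (auto simp: \<kappa>_def)
  define C where "C = real (card \<Phi>' + 2 * card \<Psi>) + exp 2"
  have "C > 0" by (simp add: C_def add_nonneg_pos)
  moreover have "\<exists>T g. id_system n R T g \<and>
    (\<forall>x\<in>space (vec_space n). \<forall>y. g (T x) y = No \<longrightarrow>
      (\<exists>s. (\<forall>\<phi>\<in>\<Phi>. (\<Sum>i<n. \<phi> (x i, s i)) < 0) \<and> (\<forall>\<psi>\<in>\<Psi>. (\<Sum>i<n. \<psi> (s i, y i)) < 0))) \<and>
    prob_maybe n PX PY T g \<le> C * \<kappa> ^ n" if "n \<ge> 1" for n
  proof -
    have n: "n \<ge> 1" by fact
    obtain T g where Tg: "id_system n R T g"
      "\<forall>x\<in>space (vec_space n). \<forall>y. g (T x) y = No \<longrightarrow>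
        (\<exists>s. (\<forall>\<phi>\<in>\<Phi>'. (\<Sum>i<n. \<phi> (x i, s i)) < 0) \<and> (\<forall>\<psi>\<in>\<Psi>. (\<Sum>i<n. \<psi> (s i, y i)) < 0))"
      "prob_maybe n PX PY T g \<le> real (card \<Phi>' + 2 * card \<Psi>) * sqrt \<rho> ^ n
        + exp (- (real (nat \<lfloor>2 powr (real n * R)\<rfloor> - 1) / exp (real n * c)))"
      using ex_id_system[OF assms(1) \<open>finite \<Phi>'\<close> assms(3) \<rho>(1,2) n less_imp_le[OF \<open>R > 0\<close>] \<Phi>'m \<Psi>m b1 b2, of c]
      unfolding \<Phi>'_def by blast
    note Tg(3)
    also have "exp (- (real (nat \<lfloor>2 powr (real n * R)\<rfloor> - 1) / exp (real n * c))) \<le> exp 2 * e ^ n"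
      unfolding e_def by (rule exp_overflow_bound[OF c(1)])
    also have "real (card \<Phi>' + 2 * card \<Psi>) * sqrt \<rho> ^ n + exp 2 * e ^ n
        \<le> real (card \<Phi>' + 2 * card \<Psi>) * \<kappa> ^ n + exp 2 * \<kappa> ^ n"
      using \<rho> e by (intro add_mono mult_left_mono power_mono) (auto simp: \<kappa>_def)
    also have "\<dots> = C * \<kappa> ^ n" by (simp add: C_def algebra_simps)
    finally have "prob_maybe n PX PY T g \<le> C * \<kappa> ^ n" by simp
    then show ?thesis using Tg(1,2) unfolding \<Phi>'_def by blast
  qed
  ultimately show ?thesis using \<kappa> by blast
qed

section \<open>Unbounded densities\<close>

text \<open>With \<open>r = sqrt x\<close> this is \<open>ln (1 / r) \<le> 1 / r\<close>. It yields
  the continuity of \<open>x * ln x\<close> at 0, consistent with \<open>ln 0 = 0\<close>, and its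
  boundedness on the unit interval.\<close>

lemma abs_x_ln_x_le_sqrt:
  fixes x :: real
  assumes "0 \<le> x" "x \<le> 1"
  shows "\<bar>x * ln x\<bar> \<le> 2 * sqrt x"
proof (cases "x = 0")
  case False
  then have x: "0 < x" using assms by simp
  define r where "r = sqrt x"
  have r: "0 < r" "x = r * r" using x by (auto simp: r_def)
  have "ln (1 / r) \<le> 1 / r" using ln_bound[of "1 / r"] r by simp
  then have "- ln r \<le> 1 / r" using r by (simp add: ln_div)
  then have "r * r * (- ln r) \<le> r * r * (1 / r)" using r by (intro mult_left_mono) auto
  then have "- (x * ln x) \<le> 2 * r" using r by (simp add: ln_mult)
  moreover have "x * ln x \<le> 0" using x assms by (simp add: mult_nonneg_nonpos)
  ultimately show ?thesis by (simp add: r_def)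
qed simp

lemma tendsto_x_ln_x:
  fixes X :: "nat \<Rightarrow> real"
  assumes X: "X \<longlonglongrightarrow> a" and nonneg: "\<And>n. 0 \<le> X n"
  shows "(\<lambda>n. X n * ln (X n)) \<longlonglongrightarrow> a * ln a"
proof (cases "a = 0")
  case False
  then show ?thesis using X by (intro tendsto_intros) auto
next
  case True
  have "(\<lambda>n. 2 * sqrt (X n)) \<longlonglongrightarrow> 2 * sqrt a" by (intro tendsto_intros X)
  then have "(\<lambda>n. 2 * sqrt (X n)) \<longlonglongrightarrow> 0" using True by simp
  moreover have "eventually (\<lambda>n. X n < 1) sequentially"
    using order_tendstoD(2)[OF X] True by simp
  then have "eventually (\<lambda>n. norm (X n * ln (X n)) \<le> 2 * sqrt (X n)) sequentially"
    by eventually_elim (use nonneg abs_x_ln_x_le_sqrt in auto)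
  ultimately have "(\<lambda>n. X n * ln (X n)) \<longlonglongrightarrow> 0" by (rule Lim_null_comparison[rotated])
  then show ?thesis using True by simp
qed

text \<open>An integrable majorant for the information of truncated densities, which exceed the
  original one by at most 1. For \<open>g \<le> 1\<close> the left-hand side is at most 2; beyond
  that \<open>x * ln x\<close> increases, and \<open>ln (f + 1) \<le> ln f + 1 / f\<close> brings
  \<open>f + 1\<close> back to \<open>f\<close>.\<close>

lemma abs_x_ln_x_dominated:
  fixes f g :: real
  assumes "0 \<le> f" "0 \<le> g" "g \<le> f + 1"
  shows "\<bar>g * ln g\<bar> \<le> \<bar>f * ln f\<bar> + f + 3"
proof (cases "g \<le> 1")
  case True
  have "\<bar>g * ln g\<bar> \<le> 2 * sqrt g" using assms True by (intro abs_x_ln_x_le_sqrt)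
  also have "\<dots> \<le> 2" using True by simp
  finally show ?thesis using assms by linarith
next
  case False
  then have g: "1 < g" by simp
  have "\<bar>g * ln g\<bar> = g * ln g" using g by simp
  also have "\<dots> \<le> (f + 1) * ln (f + 1)" using assms g by (intro mult_mono) auto
  also have "\<dots> \<le> \<bar>f * ln f\<bar> + f + 3"
  proof (cases "f \<le> 1")
    case True
    have "ln (f + 1) \<le> f" using ln_add_one_self_le_self[of f] assms by (simp add: add.commute)
    then have "(f + 1) * ln (f + 1) \<le> 2 * 1"
      using True assms by (intro mult_mono) auto
    then show ?thesis using assms by linarith
  next
    case False
    then have f: "1 < f" by simp
    have "ln (f + 1) = ln f + ln (1 + 1 / f)"
    proof -
      have "f + 1 = f * (1 + 1 / f)" using f by (simp add: field_simps)
      moreover have "0 < 1 + 1 / f" using f by (simp add: add_pos_pos)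
      ultimately show ?thesis using f by (simp add: ln_mult)
    qed
    also have "\<dots> \<le> ln f + 1 / f" using ln_add_one_self_le_self[of "1 / f"] f by simp
    finally have "(f + 1) * ln (f + 1) \<le> (f + 1) * (ln f + 1 / f)" using f by (intro mult_left_mono) auto
    also have "\<dots> = f * ln f + ln f + 1 + 1 / f" using f by (simp add: field_simps)
    also have "\<dots> \<le> f * ln f + f + 3"
    proof -
      have "1 / f \<le> 1" using f by simp
      then show ?thesis using ln_le_minus_one[of f] f by linarith
    qed
    finally show ?thesis by (smt (verit))
  qed
  finally show ?thesis .
qed

lemma (in prob_space) integrable_bounded:
  fixes k :: "'a \<Rightarrow> real"
  assumes "k \<in> borel_measurable M" "\<And>p. \<bar>k p\<bar> \<le> B"
  shows "integrable M k"
  using assms by (intro integrable_const_bound[where B=B]) auto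

section \<open>Moments of a test channel and truncation of its density\<close>

context test_channel
begin

lemma integral_J:
  assumes "k \<in> borel_measurable (PX \<Otimes>\<^sub>M Q)"
  shows "(\<integral>p. k p \<partial>J) = (\<integral>p. f p * k p \<partial>(PX \<Otimes>\<^sub>M Q))"
  unfolding J_def using assms by (subst integral_density) (auto simp: f_nonneg)

lemma integrable_J:
  assumes "k \<in> borel_measurable (PX \<Otimes>\<^sub>M Q)"
  shows "integrable J k \<longleftrightarrow> integrable (PX \<Otimes>\<^sub>M Q) (\<lambda>p. f p * k p)"
  unfolding J_def using assms by (subst integrable_density) (auto simp: f_nonneg)

lemma integrable_f: "integrable (PX \<Otimes>\<^sub>M Q) f"
proof -
  interpret J: prob_space J by (rule prob_space_J)
  show ?thesis using integrable_J[of "\<lambda>_. 1"] by simp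
qed

lemma integrable_f_section: "integrable Q (\<lambda>s. f (x, s))" "(\<integral>s. f (x, s) \<partial>Q) = 1"
proof -
  have [measurable]: "(\<lambda>s. f (x, s)) \<in> borel_measurable Q" by measurable
  show 1: "integrable Q (\<lambda>s. f (x, s))"
    by (rule integrableI_nonneg) (auto simp: f_nonneg f_normalized)
  show "(\<integral>s. f (x, s) \<partial>Q) = 1"
    using nn_integral_eq_integral[OF 1] f_normalized[of x] f_nonneg
    by (simp add: integral_nonneg_AE)
qed

lemma distr_J_fst: "distr J borel fst = PX"
proof (rule measure_eqI)
  fix A assume "A \<in> sets (distr J borel fst)"
  then have [measurable]: "A \<in> sets borel" by simp
  have m[measurable]: "fst \<in> J \<rightarrow>\<^sub>M borel" by measurable
  have "emeasure (distr J borel fst) A = (\<integral>\<^sup>+x. indicator A x \<partial>distr J borel fst)" by simp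
  also have "\<dots> = (\<integral>\<^sup>+p. indicator A (fst p) \<partial>J)"
    by (rule nn_integral_distr) auto
  also have "\<dots> = (\<integral>\<^sup>+p. ennreal (f p) * indicator A (fst p) \<partial>(PX \<Otimes>\<^sub>M Q))"
    by (rule nn_integral_J) measurable
  also have "\<dots> = (\<integral>\<^sup>+x. (\<integral>\<^sup>+s. ennreal (f (x, s)) * indicator A x \<partial>Q) \<partial>PX)"
    by (subst Q.nn_integral_fst[symmetric]) auto
  also have "\<dots> = (\<integral>\<^sup>+x. indicator A x \<partial>PX)"
    by (intro nn_integral_cong, subst nn_integral_multc) (auto simp: f_normalized)
  finally show "emeasure (distr J borel fst) A = emeasure PX A" by simp
qed simp

lemma integral_J_fst:
  fixes g :: "real \<Rightarrow> real"
  assumes "g \<in> borel_measurable borel"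
  shows "(\<integral>p. g (fst p) \<partial>J) = (\<integral>x. g x \<partial>PX)" "integrable J (\<lambda>p. g (fst p)) \<longleftrightarrow> integrable PX g"
proof -
  have m[measurable]: "fst \<in> J \<rightarrow>\<^sub>M borel" by measurable
  show "(\<integral>p. g (fst p) \<partial>J) = (\<integral>x. g x \<partial>PX)"
    by (subst distr_J_fst[symmetric], subst integral_distr) (use assms in auto)
  show "integrable J (\<lambda>p. g (fst p)) \<longleftrightarrow> integrable PX g"
    by (subst (2) distr_J_fst[symmetric], subst integrable_distr_eq) (use assms in auto)
qed

text \<open>The mass removed by truncating the density at \<open>L\<close> is given back in proportion to \<open>Q\<close>; the
  letter is then drawn from \<open>Q\<close> independently of \<open>x\<close>.\<close>

definition trunc :: "nat \<Rightarrow> real \<times> 's \<Rightarrow> real" where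
  "trunc L p = min (f p) (real L) + (1 - (\<integral>s. min (f (fst p, s)) (real L) \<partial>Q))"

lemma integrable_min_section: "integrable Q (\<lambda>s. min (f (x, s)) (real L))"
  by (rule Q.integrable_bounded[where B="real L"]) (auto simp: f_nonneg)

lemma min_section_bounds:
  "0 \<le> (\<integral>s. min (f (x, s)) (real L) \<partial>Q)" "(\<integral>s. min (f (x, s)) (real L) \<partial>Q) \<le> 1"
proof -
  show "0 \<le> (\<integral>s. min (f (x, s)) (real L) \<partial>Q)" by (intro integral_nonneg_AE) (auto simp: f_nonneg)
  have "(\<integral>s. min (f (x, s)) (real L) \<partial>Q) \<le> (\<integral>s. f (x, s) \<partial>Q)"
    by (intro integral_mono integrable_min_section integrable_f_section) auto
  then show "(\<integral>s. min (f (x, s)) (real L) \<partial>Q) \<le> 1" by (simp add: integrable_f_section)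
qed

lemma trunc_bounds: "0 \<le> trunc L p" "trunc L p \<le> f p + 1" "trunc L p \<le> real L + 1"
  using min_section_bounds[of "fst p" L] f_nonneg[of p] by (auto simp: trunc_def)

lemma trunc_measurable[measurable]: "trunc L \<in> borel_measurable (PX \<Otimes>\<^sub>M Q)"
proof -
  have "(\<lambda>x. \<integral>s. min (f (x, s)) (real L) \<partial>Q) \<in> borel_measurable PX"
    by (rule Q.borel_measurable_lebesgue_integral) measurable
  note this[measurable]
  show ?thesis unfolding trunc_def by measurable
qed

lemma test_channel_trunc: "test_channel PX Q (trunc L)"
proof
  fix x
  have i: "integrable Q (\<lambda>s. trunc L (x, s))"
    unfolding trunc_def using integrable_min_section by auto
  have "(\<integral>s. trunc L (x, s) \<partial>Q) = 1"
    unfolding trunc_def using integrable_min_section by (simp add: Q.prob_space)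
  then show "(\<integral>\<^sup>+s. ennreal (trunc L (x, s)) \<partial>Q) = 1"
    using nn_integral_eq_integral[OF i] trunc_bounds by simp
qed (use trunc_bounds in auto)

lemma trunc_tendsto: "(\<lambda>L. trunc L p) \<longlonglongrightarrow> f p"
proof -
  have lim: "(\<lambda>L. min (f q) (real L)) \<longlonglongrightarrow> f q" for q
  proof (rule tendsto_eventually)
    show "eventually (\<lambda>L. min (f q) (real L) = f q) sequentially"
      using eventually_ge_at_top[of "nat \<lceil>f q\<rceil>"] by eventually_elim linarith
  qed
  have "(\<lambda>L. \<integral>s. min (f (fst p, s)) (real L) \<partial>Q) \<longlonglongrightarrow> (\<integral>s. f (fst p, s) \<partial>Q)"
    by (rule integral_dominated_convergence[where w="\<lambda>s. f (fst p, s)"])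
      (use integrable_f_section lim in \<open>auto simp: f_nonneg\<close>)
  then have "(\<lambda>L. trunc L p) \<longlonglongrightarrow> f p + (1 - (\<integral>s. f (fst p, s) \<partial>Q))"
    unfolding trunc_def by (intro tendsto_intros lim)
  then show ?thesis by (simp add: integrable_f_section)
qed

lemma trunc_expectation_tendsto:
  fixes k :: "real \<times> 's \<Rightarrow> real"
  assumes [measurable]: "k \<in> borel_measurable (PX \<Otimes>\<^sub>M Q)" and B: "\<And>p. \<bar>k p\<bar> \<le> B"
  shows "(\<lambda>L. \<integral>p. k p \<partial>test_channel.J PX Q (trunc L)) \<longlonglongrightarrow> (\<integral>p. k p \<partial>J)"
proof -
  have "(\<lambda>L. \<integral>p. trunc L p * k p \<partial>(PX \<Otimes>\<^sub>M Q)) \<longlonglongrightarrow> (\<integral>p. f p * k p \<partial>(PX \<Otimes>\<^sub>M Q))"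
  proof (rule integral_dominated_convergence[where w="\<lambda>p. (f p + 1) * B"])
    show "integrable (PX \<Otimes>\<^sub>M Q) (\<lambda>p. (f p + 1) * B)" using integrable_f by auto
    show "AE p in PX \<Otimes>\<^sub>M Q. (\<lambda>L. trunc L p * k p) \<longlonglongrightarrow> f p * k p"
      by (intro AE_I2 tendsto_intros trunc_tendsto)
    show "AE p in PX \<Otimes>\<^sub>M Q. norm (trunc L p * k p) \<le> (f p + 1) * B" for L
      using trunc_bounds f_nonneg B by (intro AE_I2) (auto simp: abs_mult intro!: mult_mono)
  qed auto
  then show ?thesis
    by (simp add: test_channel.integral_J[OF test_channel_trunc] integral_J)
qed

text \<open>The measure changes with \<open>L\<close>. Written over the fixed measure
  \<open>PX \<Otimes>\<^sub>M Q\<close>, the integrand is \<open>trunc L p * ln (trunc L p)\<close>,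
  which converges by continuity of \<open>x * ln x\<close> and is dominated since
  \<open>trunc L p \<le> f p + 1\<close>.\<close>

lemma trunc_information:
  assumes "integrable J (\<lambda>p. ln (f p))"
  shows "(\<lambda>L. \<integral>p. ln (trunc L p) \<partial>test_channel.J PX Q (trunc L)) \<longlonglongrightarrow> (\<integral>p. ln (f p) \<partial>J)"
    and "integrable (test_channel.J PX Q (trunc L)) (\<lambda>p. ln (trunc L p))"
proof -
  define w where "w p = \<bar>f p * ln (f p)\<bar> + f p + 3" for p
  have w: "integrable (PX \<Otimes>\<^sub>M Q) w"
    using assms integrable_f unfolding w_def by (subst (asm) integrable_J) auto
  have le: "norm (trunc L p * ln (trunc L p)) \<le> w p" for L p
    unfolding w_def real_norm_def by (intro abs_x_ln_x_dominated f_nonneg trunc_bounds)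
  have "(\<lambda>L. \<integral>p. trunc L p * ln (trunc L p) \<partial>(PX \<Otimes>\<^sub>M Q)) \<longlonglongrightarrow> (\<integral>p. f p * ln (f p) \<partial>(PX \<Otimes>\<^sub>M Q))"
    by (rule integral_dominated_convergence[where w=w])
      (use w le trunc_bounds in \<open>auto intro!: AE_I2 tendsto_x_ln_x trunc_tendsto\<close>)
  then show "(\<lambda>L. \<integral>p. ln (trunc L p) \<partial>test_channel.J PX Q (trunc L)) \<longlonglongrightarrow> (\<integral>p. ln (f p) \<partial>J)"
    by (simp add: test_channel.integral_J[OF test_channel_trunc] integral_J)
  have "integrable (PX \<Otimes>\<^sub>M Q) (\<lambda>p. trunc L p * ln (trunc L p))"
    by (rule Bochner_Integration.integrable_bound[OF w]) (use le in \<open>auto intro!: AE_I2 intro: order_trans[OF _ abs_ge_self]\<close>)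
  then show "integrable (test_channel.J PX Q (trunc L)) (\<lambda>p. ln (trunc L p))"
    by (subst test_channel.integrable_J[OF test_channel_trunc]) auto
qed

end

text \<open>Identification with an arbitrary guarantee \<open>far\<close> for the answer
  \<open>No\<close>. This separates the coding argument, which only knows about sums over letters,
  from the geometry that turns such sums into distances.\<close>

definition reliable ::
  "real measure \<Rightarrow> real measure \<Rightarrow> real \<Rightarrow> (nat \<Rightarrow> (nat \<Rightarrow> real) \<Rightarrow> (nat \<Rightarrow> real) \<Rightarrow> bool) \<Rightarrow> bool" where
  "reliable PX PY R far \<longleftrightarrow> (\<exists>C \<kappa>. 0 < C \<and> 0 < \<kappa> \<and> \<kappa> < 1 \<and> (\<forall>n\<ge>1. \<exists>T g. id_system n R T g \<and>
    (\<forall>x\<in>space (vec_space n). \<forall>y. g (T x) y = No \<longrightarrow> far n x y) \<and>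
    prob_maybe n PX PY T g \<le> C * \<kappa> ^ n))"

lemma reliable_mono:
  assumes "reliable PX PY R far" "\<And>n x y. n \<ge> 1 \<Longrightarrow> far n x y \<Longrightarrow> far' n x y"
  shows "reliable PX PY R far'"
  using assms unfolding reliable_def by meson

text \<open>Each function is compared with its mean, relaxed by \<open>\<delta>\<close> so that the
  resulting test has mean \<open>- \<delta>\<close>. The encoder sees \<open>x\<close> and the
  codeword and tests \<open>u\<close> and \<open>k\<close>; the decoder sees \<open>y\<close> and
  the codeword and tests \<open>w\<close> and \<open>h\<close>. The relaxations of \<open>u\<close>
  and \<open>w\<close> add up to \<open>2 * \<delta>\<close>.\<close>

lemma (in test_channel) reliable_of_bounded_density:
  assumes "real_distribution PY" and "R > 0"
    and info: "integrable J (\<lambda>p. ln (f p))" "(\<integral>p. ln (f p) \<partial>J) < R * ln 2"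
    and fb: "\<And>p. f p \<le> L"
    and [measurable]: "u \<in> borel_measurable borel" "w \<in> borel_measurable borel"
      "k \<in> borel_measurable (PX \<Otimes>\<^sub>M Q)" "h \<in> borel_measurable (Q \<Otimes>\<^sub>M PY)"
    and B: "\<And>x. \<bar>u x\<bar> \<le> B" "\<And>y. \<bar>w y\<bar> \<le> B" "\<And>p. \<bar>k p\<bar> \<le> B" "\<And>q. \<bar>h q\<bar> \<le> B"
    and "\<delta> > 0"
  shows "reliable PX PY R (\<lambda>n x y. \<exists>s.
      (\<Sum>i<n. u (x i)) + (\<Sum>i<n. w (y i)) \<ge> real n * ((\<integral>x. u x \<partial>PX) + (\<integral>y. w y \<partial>PY) - 2 * \<delta>) \<and>
      (\<Sum>i<n. k (x i, s i)) \<le> real n * ((\<integral>p. k p \<partial>J) + \<delta>) \<and>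
      (\<Sum>i<n. h (s i, y i)) \<ge> real n * ((\<integral>p. (\<integral>y. h (snd p, y) \<partial>PY) \<partial>J) - \<delta>))"
proof -
  interpret PY: real_distribution PY by fact
  interpret J: prob_space J by (rule prob_space_J)
  interpret JY: pair_prob_space J PY ..
  define \<phi>1 where "\<phi>1 p = (\<integral>x. u x \<partial>PX) - \<delta> - u (fst p)" for p :: "real \<times> 's"
  define \<phi>2 where "\<phi>2 p = k p - ((\<integral>p. k p \<partial>J) + \<delta>)" for p
  define \<psi>1 where "\<psi>1 q = (\<integral>y. w y \<partial>PY) - \<delta> - w (snd q)" for q :: "'s \<times> real"
  define \<psi>2 where "\<psi>2 q = (\<integral>p. (\<integral>y. h (snd p, y) \<partial>PY) \<partial>J) - \<delta> - h q" for q
  have iu: "integrable J (\<lambda>p. u (fst p))" by (rule J.integrable_bounded[where B=B]) (use B in auto)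
  have ik: "integrable J k" by (rule J.integrable_bounded[where B=B]) (use B in auto)
  have iw: "integrable (J \<Otimes>\<^sub>M PY) (\<lambda>q. w (snd q))" by (rule JY.integrable_bounded[where B=B]) (use B in auto)
  have ih: "integrable (J \<Otimes>\<^sub>M PY) (\<lambda>q. h (snd (fst q), snd q))"
    by (rule JY.integrable_bounded[where B=B]) (use B in auto)
  have ew: "(\<integral>q. w (snd q) \<partial>(J \<Otimes>\<^sub>M PY)) = (\<integral>y. w y \<partial>PY)"
    using JY.integral_fst'[OF iw] by (simp add: J.prob_space)
  have eh: "(\<integral>q. h (snd (fst q), snd q) \<partial>(J \<Otimes>\<^sub>M PY)) = (\<integral>p. (\<integral>y. h (snd p, y) \<partial>PY) \<partial>J)"
    using JY.integral_fst'[OF ih] by simp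
  have eu: "(\<integral>p. u (fst p) \<partial>J) = (\<integral>x. u x \<partial>PX)" by (rule integral_J_fst) simp
  have ub: "- B \<le> u x" "- B \<le> w x" "k p \<le> B" "- B \<le> h q" for x p q
    using B(1)[of x] B(2)[of x] B(3)[of p] B(4)[of q] by linarith+
  have "\<exists>C \<kappa>. 0 < C \<and> 0 < \<kappa> \<and> \<kappa> < 1 \<and> (\<forall>n\<ge>1. \<exists>T g. id_system n R T g \<and>
    (\<forall>x\<in>space (vec_space n). \<forall>y. g (T x) y = No \<longrightarrow>
      (\<exists>s. (\<forall>\<phi>\<in>{\<phi>1, \<phi>2}. (\<Sum>i<n. \<phi> (x i, s i)) < 0) \<and> (\<forall>\<psi>\<in>{\<psi>1, \<psi>2}. (\<Sum>i<n. \<psi> (s i, y i)) < 0))) \<and>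
    prob_maybe n PX PY T g \<le> C * \<kappa> ^ n)"
  proof (rule id_coding[OF assms(1) _ _ assms(2) _ _ _ _ _ info fb])
    fix \<phi> assume "\<phi> \<in> {\<phi>1, \<phi>2}"
    then consider "\<phi> = \<phi>1" | "\<phi> = \<phi>2" by blast
    note cases = this
    show "integrable J \<phi> \<and> (\<integral>p. \<phi> p \<partial>J) < 0"
      using cases
    proof cases
      case 1
      then show ?thesis using iu eu \<open>\<delta> > 0\<close> by (simp add: \<phi>1_def[abs_def] J.prob_space)
    next
      case 2
      then show ?thesis using ik \<open>\<delta> > 0\<close> by (simp add: \<phi>2_def[abs_def] J.prob_space)
    qed
    show "\<exists>b. \<forall>p\<in>space J. \<phi> p \<le> b"
      using cases
    proof cases
      case 1
      have "\<phi>1 p \<le> (\<integral>x. u x \<partial>PX) - \<delta> + B" for p using ub(1)[of "fst p"] by (simp add: \<phi>1_def)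
      then show ?thesis unfolding 1 by blast
    next
      case 2
      have "\<phi>2 p \<le> B - ((\<integral>p. k p \<partial>J) + \<delta>)" for p using ub(3)[of "p"] by (simp add: \<phi>2_def)
      then show ?thesis unfolding 2 by blast
    qed
  next
    fix \<psi> assume "\<psi> \<in> {\<psi>1, \<psi>2}"
    then consider "\<psi> = \<psi>1" | "\<psi> = \<psi>2" by blast
    note cases = this
    show "\<psi> \<in> borel_measurable (Q \<Otimes>\<^sub>M PY)"
      using cases by cases (auto simp: \<psi>1_def[abs_def] \<psi>2_def[abs_def])
    show "integrable (J \<Otimes>\<^sub>M PY) (\<lambda>q. \<psi> (snd (fst q), snd q))
        \<and> (\<integral>q. \<psi> (snd (fst q), snd q) \<partial>(J \<Otimes>\<^sub>M PY)) < 0"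
      using cases
    proof cases
      case 1
      then show ?thesis using iw ew \<open>\<delta> > 0\<close> by (simp add: \<psi>1_def[abs_def] JY.prob_space)
    next
      case 2
      then show ?thesis using ih eh \<open>\<delta> > 0\<close> by (simp add: \<psi>2_def[abs_def] JY.prob_space)
    qed
    show "\<exists>b. \<forall>p\<in>space (Q \<Otimes>\<^sub>M PY). \<psi> p \<le> b"
      using cases
    proof cases
      case 1
      have "\<psi>1 p \<le> (\<integral>y. w y \<partial>PY) - \<delta> + B" for p using ub(2)[of "snd p"] by (simp add: \<psi>1_def)
      then show ?thesis unfolding 1 by blast
    next
      case 2
      have "\<psi>2 p \<le> (\<integral>p. (\<integral>y. h (snd p, y) \<partial>PY) \<partial>J) - \<delta> + B" for p using ub(4)[of p] by (simp add: \<psi>2_def)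
      then show ?thesis unfolding 2 by blast
    qed
  qed auto
  then have "reliable PX PY R (\<lambda>n x y. \<exists>s. (\<forall>\<phi>\<in>{\<phi>1, \<phi>2}. (\<Sum>i<n. \<phi> (x i, s i)) < 0) \<and>
      (\<forall>\<psi>\<in>{\<psi>1, \<psi>2}. (\<Sum>i<n. \<psi> (s i, y i)) < 0))"
    by (simp add: reliable_def)
  then show ?thesis
  proof (rule reliable_mono)
    fix n :: nat and x y :: "nat \<Rightarrow> real"
    assume "\<exists>s. (\<forall>\<phi>\<in>{\<phi>1, \<phi>2}. (\<Sum>i<n. \<phi> (x i, s i)) < 0) \<and> (\<forall>\<psi>\<in>{\<psi>1, \<psi>2}. (\<Sum>i<n. \<psi> (s i, y i)) < 0)"
    then obtain s where s: "(\<Sum>i<n. \<phi>1 (x i, s i)) < 0" "(\<Sum>i<n. \<phi>2 (x i, s i)) < 0"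
      "(\<Sum>i<n. \<psi>1 (s i, y i)) < 0" "(\<Sum>i<n. \<psi>2 (s i, y i)) < 0" by auto
    then show "\<exists>s. (\<Sum>i<n. u (x i)) + (\<Sum>i<n. w (y i)) \<ge> real n * ((\<integral>x. u x \<partial>PX) + (\<integral>y. w y \<partial>PY) - 2 * \<delta>) \<and>
      (\<Sum>i<n. k (x i, s i)) \<le> real n * ((\<integral>p. k p \<partial>J) + \<delta>) \<and>
      (\<Sum>i<n. h (s i, y i)) \<ge> real n * ((\<integral>p. (\<integral>y. h (snd p, y) \<partial>PY) \<partial>J) - \<delta>)"
      by (intro exI[of _ s]) (simp add: \<phi>1_def \<phi>2_def \<psi>1_def \<psi>2_def sum_subtractf sum.distrib algebra_simps)
  qed
qed

lemma (in test_channel) reliable_of_test_channel: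
  assumes "real_distribution PY" and "R > 0"
    and info: "integrable J (\<lambda>p. ln (f p))" "(\<integral>p. ln (f p) \<partial>J) < R * ln 2"
    and [measurable]: "u \<in> borel_measurable borel" "w \<in> borel_measurable borel"
      "k \<in> borel_measurable (PX \<Otimes>\<^sub>M Q)" "h \<in> borel_measurable (Q \<Otimes>\<^sub>M PY)"
    and B: "\<And>x. \<bar>u x\<bar> \<le> B" "\<And>y. \<bar>w y\<bar> \<le> B" "\<And>p. \<bar>k p\<bar> \<le> B" "\<And>q. \<bar>h q\<bar> \<le> B"
    and "\<delta> > 0"
  shows "reliable PX PY R (\<lambda>n x y. \<exists>s.
      (\<Sum>i<n. u (x i)) + (\<Sum>i<n. w (y i)) \<ge> real n * ((\<integral>x. u x \<partial>PX) + (\<integral>y. w y \<partial>PY) - \<delta>) \<and>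
      (\<Sum>i<n. k (x i, s i)) \<le> real n * ((\<integral>p. k p \<partial>J) + \<delta>) \<and>
      (\<Sum>i<n. h (s i, y i)) \<ge> real n * ((\<integral>p. (\<integral>y. h (snd p, y) \<partial>PY) \<partial>J) - \<delta>))"
proof -
  interpret PY: real_distribution PY by fact
  define H where "H p = (\<integral>y. h (snd p, y) \<partial>PY)" for p :: "real \<times> 's"
  have [measurable]: "(\<lambda>s. \<integral>y. h (s, y) \<partial>PY) \<in> borel_measurable Q"
    by (rule PY.borel_measurable_lebesgue_integral) measurable
  have Hm[measurable]: "H \<in> borel_measurable (PX \<Otimes>\<^sub>M Q)" unfolding H_def by measurable
  have "B \<ge> 0" using B(1)[of 0] by linarith
  have HB: "\<bar>H p\<bar> \<le> B" for p
  proof (cases "integrable PY (\<lambda>y. h (snd p, y))")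
    case True
    have "\<bar>H p\<bar> \<le> (\<integral>y. \<bar>h (snd p, y)\<bar> \<partial>PY)" unfolding H_def by (rule integral_abs_bound)
    also have "\<dots> \<le> (\<integral>y. B \<partial>PY)" using True B by (intro integral_mono) auto
    finally show ?thesis using PY.prob_space by simp
  next
    \<comment> \<open>Outside \<open>space Q\<close> the section of \<open>h\<close> need not be
      measurable; its integral is then 0 by default.\<close>
    case False
    then show ?thesis using \<open>B \<ge> 0\<close> by (simp add: H_def not_integrable_integral_eq)
  qed
  let ?J = "\<lambda>L. test_channel.J PX Q (trunc L)"
  have "eventually (\<lambda>L. (\<integral>p. ln (trunc L p) \<partial>?J L) < R * ln 2) sequentially"
    using order_tendstoD(2)[OF trunc_information(1)[OF info(1)] info(2)] .
  moreover have "eventually (\<lambda>L. (\<integral>p. k p \<partial>?J L) < (\<integral>p. k p \<partial>J) + \<delta> / 2) sequentially"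
    using \<open>\<delta> > 0\<close> by (intro order_tendstoD(2)[OF trunc_expectation_tendsto[where B=B]] B) auto
  moreover have "eventually (\<lambda>L. (\<integral>p. H p \<partial>?J L) > (\<integral>p. H p \<partial>J) - \<delta> / 2) sequentially"
    using \<open>\<delta> > 0\<close> by (intro order_tendstoD(1)[OF trunc_expectation_tendsto[where B=B]] HB) auto
  ultimately have "eventually (\<lambda>L. (\<integral>p. ln (trunc L p) \<partial>?J L) < R * ln 2 \<and>
      (\<integral>p. k p \<partial>?J L) < (\<integral>p. k p \<partial>J) + \<delta> / 2 \<and> (\<integral>p. H p \<partial>?J L) > (\<integral>p. H p \<partial>J) - \<delta> / 2) sequentially"
    by eventually_elim auto
  \<comment> \<open>One truncation level keeps the information below the rate and shifts the means
    of \<open>k\<close> and \<open>H\<close> by less than \<open>\<delta> / 2\<close>; the other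
    half of \<open>\<delta>\<close> is left to the tests. The means of \<open>u\<close> and
    \<open>w\<close> do not depend on the channel.\<close>
  then obtain L where L: "(\<integral>p. ln (trunc L p) \<partial>?J L) < R * ln 2"
      "(\<integral>p. k p \<partial>?J L) < (\<integral>p. k p \<partial>J) + \<delta> / 2" "(\<integral>p. H p \<partial>?J L) > (\<integral>p. H p \<partial>J) - \<delta> / 2"
    by (auto simp: eventually_sequentially)
  have "reliable PX PY R (\<lambda>n x y. \<exists>s.
      (\<Sum>i<n. u (x i)) + (\<Sum>i<n. w (y i)) \<ge> real n * ((\<integral>x. u x \<partial>PX) + (\<integral>y. w y \<partial>PY) - 2 * (\<delta> / 2)) \<and>
      (\<Sum>i<n. k (x i, s i)) \<le> real n * ((\<integral>p. k p \<partial>?J L) + \<delta> / 2) \<and>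
      (\<Sum>i<n. h (s i, y i)) \<ge> real n * ((\<integral>p. (\<integral>y. h (snd p, y) \<partial>PY) \<partial>?J L) - \<delta> / 2))"
    by (rule test_channel.reliable_of_bounded_density[OF test_channel_trunc assms(1,2)
          trunc_information(2)[OF info(1)] L(1) trunc_bounds(3)])
      (use B \<open>\<delta> > 0\<close> in auto)
  then show ?thesis
  proof (rule reliable_mono)
    fix n :: nat and x y :: "nat \<Rightarrow> real"
    assume "\<exists>s. (\<Sum>i<n. u (x i)) + (\<Sum>i<n. w (y i)) \<ge> real n * ((\<integral>x. u x \<partial>PX) + (\<integral>y. w y \<partial>PY) - 2 * (\<delta> / 2)) \<and>
      (\<Sum>i<n. k (x i, s i)) \<le> real n * ((\<integral>p. k p \<partial>?J L) + \<delta> / 2) \<and>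
      (\<Sum>i<n. h (s i, y i)) \<ge> real n * ((\<integral>p. (\<integral>y. h (snd p, y) \<partial>PY) \<partial>?J L) - \<delta> / 2)"
    then obtain s where s: "(\<Sum>i<n. u (x i)) + (\<Sum>i<n. w (y i)) \<ge> real n * ((\<integral>x. u x \<partial>PX) + (\<integral>y. w y \<partial>PY) - \<delta>)"
      "(\<Sum>i<n. k (x i, s i)) \<le> real n * ((\<integral>p. k p \<partial>?J L) + \<delta> / 2)"
      "(\<Sum>i<n. h (s i, y i)) \<ge> real n * ((\<integral>p. H p \<partial>?J L) - \<delta> / 2)" by (auto simp: H_def)
    note s(2)
    also have "real n * ((\<integral>p. k p \<partial>?J L) + \<delta> / 2) \<le> real n * ((\<integral>p. k p \<partial>J) + \<delta>)"
      using L by (intro mult_left_mono) auto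
    finally have k: "(\<Sum>i<n. k (x i, s i)) \<le> real n * ((\<integral>p. k p \<partial>J) + \<delta>)" .
    have "real n * ((\<integral>p. H p \<partial>J) - \<delta>) \<le> real n * ((\<integral>p. H p \<partial>?J L) - \<delta> / 2)"
      using L by (intro mult_left_mono) auto
    also note s(3)
    finally show "\<exists>s. (\<Sum>i<n. u (x i)) + (\<Sum>i<n. w (y i)) \<ge> real n * ((\<integral>x. u x \<partial>PX) + (\<integral>y. w y \<partial>PY) - \<delta>) \<and>
      (\<Sum>i<n. k (x i, s i)) \<le> real n * ((\<integral>p. k p \<partial>J) + \<delta>) \<and>
      (\<Sum>i<n. h (s i, y i)) \<ge> real n * ((\<integral>p. (\<integral>y. h (snd p, y) \<partial>PY) \<partial>J) - \<delta>)"
      using s(1) k by (auto simp: H_def)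
  qed
qed

section \<open>Finite second moments\<close>

text \<open>A removed letter becomes 0, so two clipped letters of which one was removed are at
  distance at most \<open>k\<close>. The charge of \<open>k\<close> squared in
  \<open>clip_loss\<close> pays for that, and its expectation vanishes because it is at most the
  square of the letter and is 0 for large \<open>k\<close>.\<close>

definition clip :: "nat \<Rightarrow> real \<Rightarrow> real" where
  "clip k t = (if \<bar>t\<bar> \<le> real k then t else 0)"

definition clip_loss :: "nat \<Rightarrow> real \<Rightarrow> real" where
  "clip_loss k t = (if \<bar>t\<bar> \<le> real k then 0 else (real k)\<^sup>2)"

lemma clip_measurable[measurable]: "clip k \<in> borel_measurable borel"
  and clip_loss_measurable[measurable]: "clip_loss k \<in> borel_measurable borel"
  unfolding clip_def clip_loss_def by measurable

lemma clip_bounds: "\<bar>clip k t\<bar> \<le> real k" "\<bar>clip k t\<bar> \<le> \<bar>t\<bar>" "(clip k t)\<^sup>2 \<le> t\<^sup>2" "(clip k t)\<^sup>2 \<le> (real k)\<^sup>2"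
  by (auto simp: clip_def abs_le_square_iff[symmetric])

lemma clip_loss_bounds: "0 \<le> clip_loss k t" "clip_loss k t \<le> (real k)\<^sup>2" "clip_loss k t \<le> t\<^sup>2"
  by (auto simp: clip_loss_def abs_le_square_iff[symmetric])

lemma eventually_clip: "eventually (\<lambda>k. clip k t = t) sequentially" "eventually (\<lambda>k. clip_loss k t = 0) sequentially"
proof -
  have "eventually (\<lambda>k. \<bar>t\<bar> \<le> real k) sequentially"
    using eventually_ge_at_top[of "nat \<lceil>\<bar>t\<bar>\<rceil>"] by eventually_elim linarith
  then show "eventually (\<lambda>k. clip k t = t) sequentially" "eventually (\<lambda>k. clip_loss k t = 0) sequentially"
    by (eventually_elim, simp add: clip_def clip_loss_def)+
qed

lemma clip_tendsto: "(\<lambda>k. clip k t) \<longlonglongrightarrow> t" "(\<lambda>k. clip_loss k t) \<longlonglongrightarrow> 0"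
  using eventually_clip by (auto intro: tendsto_eventually)

lemma abs_le_one_plus_square: "\<bar>t::real\<bar> \<le> 1 + t\<^sup>2"
proof -
  have "0 \<le> (\<bar>t\<bar> - 1)\<^sup>2" by simp
  then show ?thesis by (simp add: power2_diff)
qed

lemma (in prob_space) integrable_of_square:
  fixes g :: "'a \<Rightarrow> real"
  assumes [measurable]: "g \<in> borel_measurable M" and "integrable M (\<lambda>x. (g x)\<^sup>2)"
  shows "integrable M g"
  by (rule Bochner_Integration.integrable_bound[where f="\<lambda>x. 1 + (g x)\<^sup>2"])
    (use assms abs_le_one_plus_square in auto)

lemma (in prob_space) clip_moments:
  fixes g :: "'a \<Rightarrow> real"
  assumes [measurable]: "g \<in> borel_measurable M" and sq: "integrable M (\<lambda>x. (g x)\<^sup>2)"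
  shows "(\<lambda>k. \<integral>x. clip k (g x) \<partial>M) \<longlonglongrightarrow> (\<integral>x. g x \<partial>M)"
    and "(\<lambda>k. \<integral>x. (clip k (g x))\<^sup>2 \<partial>M) \<longlonglongrightarrow> (\<integral>x. (g x)\<^sup>2 \<partial>M)"
    and "(\<lambda>k. \<integral>x. clip_loss k (g x) \<partial>M) \<longlonglongrightarrow> 0"
proof -
  show "(\<lambda>k. \<integral>x. clip k (g x) \<partial>M) \<longlonglongrightarrow> (\<integral>x. g x \<partial>M)"
    by (rule integral_dominated_convergence[where w="\<lambda>x. \<bar>g x\<bar>"])
      (use integrable_of_square[OF assms] clip_tendsto clip_bounds in auto)
  show "(\<lambda>k. \<integral>x. (clip k (g x))\<^sup>2 \<partial>M) \<longlonglongrightarrow> (\<integral>x. (g x)\<^sup>2 \<partial>M)"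
    by (rule integral_dominated_convergence[where w="\<lambda>x. (g x)\<^sup>2"])
      (use sq clip_bounds in \<open>auto intro!: tendsto_intros clip_tendsto\<close>)
  have "(\<lambda>k. \<integral>x. clip_loss k (g x) \<partial>M) \<longlonglongrightarrow> (\<integral>x. 0 \<partial>M)"
    by (rule integral_dominated_convergence[where w="\<lambda>x. (g x)\<^sup>2"])
      (use sq clip_loss_bounds in \<open>auto intro!: clip_tendsto\<close>)
  then show "(\<lambda>k. \<integral>x. clip_loss k (g x) \<partial>M) \<longlonglongrightarrow> 0" by simp
qed

text \<open>For \<open>a b = 1\<close> the three quadratic terms add up to the squared distance of the truncations,
  which exceeds the squared distance at most where one of the letters is truncated.\<close>

lemma square_distance_ge:
  fixes a b x y :: real
  assumes "a * b = 1"
  shows "((1 - b\<^sup>2) * (clip k x)\<^sup>2 - clip_loss k x) + ((1 - a\<^sup>2) * (clip k y)\<^sup>2 - clip_loss k y)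
    + (a * clip k y - b * clip k x)\<^sup>2 \<le> (x - y)\<^sup>2"
proof -
  have "(a * clip k y - b * clip k x)\<^sup>2 = a\<^sup>2 * (clip k y)\<^sup>2 + b\<^sup>2 * (clip k x)\<^sup>2 - 2 * (a * b) * clip k x * clip k y"
    by (simp add: power2_eq_square algebra_simps)
  then have "(a * clip k y - b * clip k x)\<^sup>2 + (1 - b\<^sup>2) * (clip k x)\<^sup>2 + (1 - a\<^sup>2) * (clip k y)\<^sup>2 = (clip k x - clip k y)\<^sup>2"
    using assms by (simp add: power2_eq_square algebra_simps)
  moreover have "(clip k x - clip k y)\<^sup>2 - clip_loss k x - clip_loss k y \<le> (x - y)\<^sup>2"
  proof (cases "\<bar>x\<bar> \<le> real k \<and> \<bar>y\<bar> \<le> real k")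
    case True
    then show ?thesis by (simp add: clip_def clip_loss_def)
  next
    case False
    then have "(clip k x - clip k y)\<^sup>2 \<le> clip_loss k x + clip_loss k y"
      using clip_bounds(4)[of k x] clip_bounds(4)[of k y] by (auto simp: clip_def clip_loss_def)
    then show ?thesis using zero_le_power2[of "x - y"] by linarith
  qed
  ultimately show ?thesis by linarith
qed

text \<open>This is deterministic: Minkowski's inequality for the clipped and scaled vectors, whose
  lower bound may be squared because \<open>B \<le> A\<close>, is added to the linear terms, and the
  letterwise bound returns to the original vectors.\<close>

lemma distortion_gt:
  fixes x y z :: "nat \<Rightarrow> real"
  assumes "n \<ge> 1" "a * b = 1"
    and lin: "(\<Sum>i<n. (1 - b\<^sup>2) * (clip k (x i))\<^sup>2 - clip_loss k (x i)) + (\<Sum>i<n. (1 - a\<^sup>2) * (clip k (y i))\<^sup>2 - clip_loss k (y i))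
      \<ge> real n * \<alpha>"
    and B: "(\<Sum>i<n. (b * clip k (x i) - z i)\<^sup>2) \<le> real n * B"
    and A: "(\<Sum>i<n. (a * clip k (y i) - z i)\<^sup>2) \<ge> real n * A"
    and AB: "0 \<le> B" "B \<le> A" "\<alpha> + (sqrt A - sqrt B)\<^sup>2 > D"
  shows "distortion n x y > D"
proof -
  define X where "X i = b * clip k (x i)" for i
  define Y where "Y i = a * clip k (y i)" for i
  have n: "0 < real n" using assms(1) by simp
  have "L2_set (\<lambda>i. (Y i - X i) + (X i - z i)) {..<n} \<le> L2_set (\<lambda>i. Y i - X i) {..<n} + L2_set (\<lambda>i. X i - z i) {..<n}"
    by (rule L2_set_triangle_ineq)
  moreover have "L2_set (\<lambda>i. (Y i - X i) + (X i - z i)) {..<n} \<ge> sqrt (real n) * sqrt A"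
    using A unfolding L2_set_def X_def Y_def by (simp flip: real_sqrt_mult)
  moreover have "L2_set (\<lambda>i. X i - z i) {..<n} \<le> sqrt (real n) * sqrt B"
    using B unfolding L2_set_def X_def by (simp flip: real_sqrt_mult)
  ultimately have "sqrt (real n) * (sqrt A - sqrt B) \<le> L2_set (\<lambda>i. Y i - X i) {..<n}"
    by (simp add: right_diff_distrib)
  then have "(sqrt (real n) * (sqrt A - sqrt B))\<^sup>2 \<le> (L2_set (\<lambda>i. Y i - X i) {..<n})\<^sup>2"
    using AB by (intro power_mono mult_nonneg_nonneg) auto
  then have YX: "real n * (sqrt A - sqrt B)\<^sup>2 \<le> (\<Sum>i<n. (Y i - X i)\<^sup>2)"
    by (simp add: power_mult_distrib L2_set_def sum_nonneg)
  have "real n * D < real n * (\<alpha> + (sqrt A - sqrt B)\<^sup>2)" using AB n by simp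
  also have "\<dots> \<le> (\<Sum>i<n. ((1 - b\<^sup>2) * (clip k (x i))\<^sup>2 - clip_loss k (x i)) + ((1 - a\<^sup>2) * (clip k (y i))\<^sup>2 - clip_loss k (y i))
      + (a * clip k (y i) - b * clip k (x i))\<^sup>2)"
    using lin YX by (simp add: sum.distrib X_def Y_def distrib_left)
  also have "\<dots> \<le> (\<Sum>i<n. (x i - y i)\<^sup>2)"
    by (intro sum_mono square_distance_ge[OF assms(2)])
  finally have "D < (\<Sum>i<n. (x i - y i)\<^sup>2) / real n" using n by (simp add: field_simps)
  then show ?thesis by (simp add: distortion_def L2_set_def sum_nonneg)
qed

text \<open>One bound, with constants uniform in \<open>n\<close>, that yields both achievability
  and a positive exponent.\<close>

definition exponentially_identifiable :: "real measure \<Rightarrow> real measure \<Rightarrow> real \<Rightarrow> real \<Rightarrow> bool" where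
  "exponentially_identifiable PX PY D R \<longleftrightarrow> (\<exists>C \<kappa>. 0 < C \<and> 0 < \<kappa> \<and> \<kappa> < 1 \<and>
    (\<forall>n\<ge>1. \<exists>T g. id_system n R T g \<and> admissible n D T g \<and> prob_maybe n PX PY T g \<le> C * \<kappa> ^ n))"

lemma exponentially_identifiableI:
  assumes "reliable PX PY R (\<lambda>n x y. distortion n x y > D)"
  shows "exponentially_identifiable PX PY D R"
proof -
  have "admissible n D T g"
    if "\<forall>x\<in>space (vec_space n). \<forall>y. g (T x) y = No \<longrightarrow> distortion n x y > D" for n T g
    unfolding admissible_def using that by (metis answer.exhaust not_le)
  then show ?thesis
    using assms unfolding reliable_def exponentially_identifiable_def by meson
qed

text \<open>\<open>A\<close> is \<open>E(a Y - Z)^2\<close>, expanded for \<open>Y\<close>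
  independent of the reconstruction \<open>Z = z (snd p)\<close>. Clipping makes all tested
  functions bounded, and their means converge to the moments in the hypotheses as the cutoff grows.
  Since \<open>AB\<close> and \<open>D\<close> are strict, they survive at a finite cutoff.\<close>

theorem (in test_channel) identifiable_of_strict:
  fixes z :: "'s \<Rightarrow> real"
  assumes "real_distribution PY" and "R > 0"
    and X2: "integrable PX (\<lambda>x. x\<^sup>2)" and Y2: "integrable PY (\<lambda>y. y\<^sup>2)"
    and z[measurable]: "z \<in> borel_measurable Q" and Z2: "integrable J (\<lambda>p. (z (snd p))\<^sup>2)"
    and info: "integrable J (\<lambda>p. ln (f p))" "(\<integral>p. ln (f p) \<partial>J) < R * ln 2"
    and ab: "a * b = 1"
  defines "A \<equiv> a\<^sup>2 * (\<integral>y. y\<^sup>2 \<partial>PY) - 2 * a * (\<integral>y. y \<partial>PY) * (\<integral>p. z (snd p) \<partial>J) + (\<integral>p. (z (snd p))\<^sup>2 \<partial>J)"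
    and "B \<equiv> \<integral>p. (b * fst p - z (snd p))\<^sup>2 \<partial>J"
  assumes AB: "B < A"
    and D: "(1 - b\<^sup>2) * (\<integral>x. x\<^sup>2 \<partial>PX) + (1 - a\<^sup>2) * (\<integral>y. y\<^sup>2 \<partial>PY) + (sqrt A - sqrt B)\<^sup>2 > D"
  shows "exponentially_identifiable PX PY D R"
proof -
  interpret PY: real_distribution PY by fact
  interpret J: prob_space J by (rule prob_space_J)
  have [measurable]: "fst \<in> J \<rightarrow>\<^sub>M borel" by measurable
  have B0: "0 \<le> B" unfolding B_def by simp
  define u where "u k x = (1 - b\<^sup>2) * (clip k x)\<^sup>2 - clip_loss k x" for k x
  define w where "w k y = (1 - a\<^sup>2) * (clip k y)\<^sup>2 - clip_loss k y" for k y
  define e where "e k p = (b * clip k (fst p) - clip k (z (snd p)))\<^sup>2" for k and p :: "real \<times> 's"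
  define h where "h k q = (a * clip k (snd q) - clip k (z (fst q)))\<^sup>2" for k and q :: "'s \<times> real"
  have [measurable]: "u k \<in> borel_measurable borel" "w k \<in> borel_measurable borel"
    "e k \<in> borel_measurable (PX \<Otimes>\<^sub>M Q)" "h k \<in> borel_measurable (Q \<Otimes>\<^sub>M PY)" for k
    unfolding u_def[abs_def] w_def[abs_def] e_def[abs_def] h_def[abs_def] by measurable
  \<comment> \<open>A crude common bound for all four clipped functions; only its existence
    matters.\<close>
  define c where "c k = (2 + \<bar>1 - b\<^sup>2\<bar> + \<bar>1 - a\<^sup>2\<bar> + (\<bar>a\<bar> + \<bar>b\<bar> + 1)\<^sup>2) * (real k)\<^sup>2" for k
  have clip_sq: "(r * clip k t - clip k t')\<^sup>2 \<le> c k" if r: "\<bar>r\<bar> \<le> \<bar>a\<bar> + \<bar>b\<bar>" for r k t t'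
  proof -
    have "\<bar>r * clip k t\<bar> \<le> (\<bar>a\<bar> + \<bar>b\<bar>) * real k"
      unfolding abs_mult using r clip_bounds(1) by (intro mult_mono) auto
    then have "\<bar>r * clip k t - clip k t'\<bar> \<le> (\<bar>a\<bar> + \<bar>b\<bar> + 1) * real k"
      using clip_bounds(1)[of k t'] by (simp add: algebra_simps)
    then have "(r * clip k t - clip k t')\<^sup>2 \<le> ((\<bar>a\<bar> + \<bar>b\<bar> + 1) * real k)\<^sup>2"
      by (simp flip: abs_le_square_iff add: abs_mult)
    also have "\<dots> \<le> c k" unfolding c_def power_mult_distrib by (intro mult_right_mono) auto
    finally show ?thesis .
  qed
  have lin: "\<bar>r * (clip k t)\<^sup>2 - clip_loss k t\<bar> \<le> c k" if r: "\<bar>r\<bar> \<le> \<bar>1 - b\<^sup>2\<bar> + \<bar>1 - a\<^sup>2\<bar>" for r k t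
  proof -
    have "\<bar>r * (clip k t)\<^sup>2\<bar> \<le> (\<bar>1 - b\<^sup>2\<bar> + \<bar>1 - a\<^sup>2\<bar>) * (real k)\<^sup>2"
      unfolding abs_mult using r clip_bounds(4) by (intro mult_mono) auto
    then have "\<bar>r * (clip k t)\<^sup>2 - clip_loss k t\<bar> \<le> (1 + \<bar>1 - b\<^sup>2\<bar> + \<bar>1 - a\<^sup>2\<bar>) * (real k)\<^sup>2"
      using clip_loss_bounds(1,2)[of k t] by (simp add: algebra_simps)
    also have "\<dots> \<le> c k" unfolding c_def by (intro mult_right_mono) auto
    finally show ?thesis .
  qed
  have bd: "\<bar>u k x\<bar> \<le> c k" "\<bar>w k x\<bar> \<le> c k" "\<bar>e k p\<bar> \<le> c k" "\<bar>h k q\<bar> \<le> c k" for k x p q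
    unfolding u_def w_def e_def h_def by (auto intro!: lin clip_sq)
  \<comment> \<open>The tolerance of the tests shrinks as the cutoff grows, so that a single limit
    in \<open>k\<close> disposes of both.\<close>
  define \<delta> where "\<delta> k = inverse (real (Suc k))" for k
  have \<delta>: "\<delta> \<longlonglongrightarrow> 0" unfolding \<delta>_def by (rule LIMSEQ_inverse_real_of_nat)
  have \<delta>0: "0 < \<delta> k" for k by (simp add: \<delta>_def)
  have iclip: "integrable PX (\<lambda>x. (clip k x)\<^sup>2)" "integrable PX (clip_loss k)" for k
    using clip_bounds(4) clip_loss_bounds by (auto intro!: PX.integrable_bounded[where B="(real k)\<^sup>2"])
  have iclipY: "integrable PY (\<lambda>x. (clip k x)\<^sup>2)" "integrable PY (clip_loss k)" "integrable PY (clip k)" for k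
    using clip_bounds(4) clip_loss_bounds clip_bounds(1)
    by (auto intro!: PY.integrable_bounded[where B="(real k)\<^sup>2"] PY.integrable_bounded[where B="real k" and k="clip k"])
  have iclipJ: "integrable J (\<lambda>p. (clip k (z (snd p)))\<^sup>2)" "integrable J (\<lambda>p. clip k (z (snd p)))" for k
    using clip_bounds(4) clip_bounds(1)
    by (auto intro!: J.integrable_bounded[where B="(real k)\<^sup>2" and k="\<lambda>p. (clip k (z (snd p)))\<^sup>2"]
      J.integrable_bounded[where B="real k" and k="\<lambda>p. clip k (z (snd p))"])
  note mX = PX.clip_moments[of "\<lambda>x. x", simplified, OF X2]
  note mY = PY.clip_moments[of "\<lambda>x. x", simplified, OF Y2]
  have zm: "(\<lambda>p. z (snd p)) \<in> borel_measurable J" by measurable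
  note mZ = J.clip_moments[OF zm Z2]
  have "(\<lambda>k. (1 - b\<^sup>2) * (\<integral>x. (clip k x)\<^sup>2 \<partial>PX) - (\<integral>x. clip_loss k x \<partial>PX)) \<longlonglongrightarrow> (1 - b\<^sup>2) * (\<integral>x. x\<^sup>2 \<partial>PX) - 0"
    by (intro tendsto_intros mX)
  moreover have "(\<integral>x. u k x \<partial>PX) = (1 - b\<^sup>2) * (\<integral>x. (clip k x)\<^sup>2 \<partial>PX) - (\<integral>x. clip_loss k x \<partial>PX)" for k
    unfolding u_def using iclip by (subst Bochner_Integration.integral_diff) auto
  ultimately have ulim: "(\<lambda>k. \<integral>x. u k x \<partial>PX) \<longlonglongrightarrow> (1 - b\<^sup>2) * (\<integral>x. x\<^sup>2 \<partial>PX)" by simp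
  have "(\<lambda>k. (1 - a\<^sup>2) * (\<integral>x. (clip k x)\<^sup>2 \<partial>PY) - (\<integral>x. clip_loss k x \<partial>PY)) \<longlonglongrightarrow> (1 - a\<^sup>2) * (\<integral>x. x\<^sup>2 \<partial>PY) - 0"
    by (intro tendsto_intros mY)
  moreover have "(\<integral>x. w k x \<partial>PY) = (1 - a\<^sup>2) * (\<integral>x. (clip k x)\<^sup>2 \<partial>PY) - (\<integral>x. clip_loss k x \<partial>PY)" for k
    unfolding w_def using iclipY by (subst Bochner_Integration.integral_diff) auto
  ultimately have wlim: "(\<lambda>k. \<integral>x. w k x \<partial>PY) \<longlonglongrightarrow> (1 - a\<^sup>2) * (\<integral>x. x\<^sup>2 \<partial>PY)" by simp
  have elim: "(\<lambda>k. \<integral>p. e k p \<partial>J) \<longlonglongrightarrow> B"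
    unfolding B_def e_def
  proof (rule integral_dominated_convergence[where w="\<lambda>p. 2 * (b\<^sup>2 * (fst p)\<^sup>2) + 2 * (z (snd p))\<^sup>2"])
    have "integrable J (\<lambda>p. (fst p)\<^sup>2)" using integral_J_fst(2)[of "\<lambda>x. x\<^sup>2"] X2 by simp
    then show "integrable J (\<lambda>p. 2 * (b\<^sup>2 * (fst p)\<^sup>2) + 2 * (z (snd p))\<^sup>2)" using Z2 by auto
    show "AE p in J. (\<lambda>k. (b * clip k (fst p) - clip k (z (snd p)))\<^sup>2) \<longlonglongrightarrow> (b * fst p - z (snd p))\<^sup>2"
      by (intro AE_I2 tendsto_intros clip_tendsto)
    show "AE p in J. norm ((b * clip k (fst p) - clip k (z (snd p)))\<^sup>2) \<le> 2 * (b\<^sup>2 * (fst p)\<^sup>2) + 2 * (z (snd p))\<^sup>2" for k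
    proof (rule AE_I2)
      fix p
      have "(b * clip k (fst p) - clip k (z (snd p)))\<^sup>2 \<le> 2 * (b * clip k (fst p))\<^sup>2 + 2 * (clip k (z (snd p)))\<^sup>2"
        using zero_le_power2[of "b * clip k (fst p) + clip k (z (snd p))"]
        by (simp add: power2_sum power2_diff)
      also have "\<dots> \<le> 2 * (b\<^sup>2 * (fst p)\<^sup>2) + 2 * (z (snd p))\<^sup>2"
        unfolding power_mult_distrib using clip_bounds(3) by (intro add_mono mult_left_mono) auto
      finally show "norm ((b * clip k (fst p) - clip k (z (snd p)))\<^sup>2) \<le> 2 * (b\<^sup>2 * (fst p)\<^sup>2) + 2 * (z (snd p))\<^sup>2" by simp
    qed
  qed measurable
  define H where "H k = (\<integral>p. (\<integral>y. h k (snd p, y) \<partial>PY) \<partial>J)" for k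
  have inner: "(\<integral>y. h k (s, y) \<partial>PY) = a\<^sup>2 * (\<integral>y. (clip k y)\<^sup>2 \<partial>PY) - 2 * a * (\<integral>y. clip k y \<partial>PY) * clip k (z s) + (clip k (z s))\<^sup>2" for k s
  proof -
    have "h k (s, y) = a\<^sup>2 * (clip k y)\<^sup>2 - 2 * a * clip k (z s) * clip k y + (clip k (z s))\<^sup>2" for y
      by (simp add: h_def power2_diff power_mult_distrib algebra_simps)
    then show ?thesis using iclipY[of k] PY.prob_space by simp
  qed
  have Hk: "H k = a\<^sup>2 * (\<integral>y. (clip k y)\<^sup>2 \<partial>PY) - 2 * a * (\<integral>y. clip k y \<partial>PY) * (\<integral>p. clip k (z (snd p)) \<partial>J)
      + (\<integral>p. (clip k (z (snd p)))\<^sup>2 \<partial>J)" for k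
    unfolding H_def inner using iclipJ[of k] by (simp add: J.prob_space)
  have "(\<lambda>k. a\<^sup>2 * (\<integral>y. (clip k y)\<^sup>2 \<partial>PY) - 2 * a * (\<integral>y. clip k y \<partial>PY) * (\<integral>p. clip k (z (snd p)) \<partial>J)
      + (\<integral>p. (clip k (z (snd p)))\<^sup>2 \<partial>J)) \<longlonglongrightarrow> A"
    unfolding A_def by (intro tendsto_intros mY mZ)
  then have Hlim: "H \<longlonglongrightarrow> A" unfolding Hk[symmetric] .
  let ?G = "\<lambda>k. (\<integral>x. u k x \<partial>PX) + (\<integral>y. w k y \<partial>PY) - \<delta> k + (sqrt (H k - \<delta> k) - sqrt ((\<integral>p. e k p \<partial>J) + \<delta> k))\<^sup>2"
  have "?G \<longlonglongrightarrow> (1 - b\<^sup>2) * (\<integral>x. x\<^sup>2 \<partial>PX) + (1 - a\<^sup>2) * (\<integral>x. x\<^sup>2 \<partial>PY) - 0 + (sqrt (A - 0) - sqrt (B + 0))\<^sup>2"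
    by (intro tendsto_intros ulim wlim elim Hlim \<delta>)
  then have ev1: "eventually (\<lambda>k. ?G k > D) sequentially"
    by (rule order_tendstoD(1)) (use D in simp)
  have "(\<lambda>k. (H k - \<delta> k) - ((\<integral>p. e k p \<partial>J) + \<delta> k)) \<longlonglongrightarrow> (A - 0) - (B + 0)"
    by (intro tendsto_intros elim Hlim \<delta>)
  then have ev2: "eventually (\<lambda>k. (H k - \<delta> k) - ((\<integral>p. e k p \<partial>J) + \<delta> k) > 0) sequentially"
    by (rule order_tendstoD(1)) (use AB in simp)
  obtain k where k: "?G k > D" "(H k - \<delta> k) - ((\<integral>p. e k p \<partial>J) + \<delta> k) > 0"
    using eventually_conj[OF ev1 ev2] by (auto simp: eventually_sequentially)
  have e0: "0 \<le> (\<integral>p. e k p \<partial>J)" by (simp add: e_def)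
  have "reliable PX PY R (\<lambda>n x y. \<exists>s.
      (\<Sum>i<n. u k (x i)) + (\<Sum>i<n. w k (y i)) \<ge> real n * ((\<integral>x. u k x \<partial>PX) + (\<integral>y. w k y \<partial>PY) - \<delta> k) \<and>
      (\<Sum>i<n. e k (x i, s i)) \<le> real n * ((\<integral>p. e k p \<partial>J) + \<delta> k) \<and>
      (\<Sum>i<n. h k (s i, y i)) \<ge> real n * ((\<integral>p. (\<integral>y. h k (snd p, y) \<partial>PY) \<partial>J) - \<delta> k))"
    by (rule reliable_of_test_channel[OF assms(1,2) info, where B="c k"]) (use bd \<delta>0 in auto)
  then have "reliable PX PY R (\<lambda>n x y. distortion n x y > D)"
  proof (rule reliable_mono)
    fix n :: nat and x y :: "nat \<Rightarrow> real"
    assume n: "1 \<le> n" and "\<exists>s. (\<Sum>i<n. u k (x i)) + (\<Sum>i<n. w k (y i)) \<ge> real n * ((\<integral>x. u k x \<partial>PX) + (\<integral>y. w k y \<partial>PY) - \<delta> k) \<and>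
      (\<Sum>i<n. e k (x i, s i)) \<le> real n * ((\<integral>p. e k p \<partial>J) + \<delta> k) \<and>
      (\<Sum>i<n. h k (s i, y i)) \<ge> real n * ((\<integral>p. (\<integral>y. h k (snd p, y) \<partial>PY) \<partial>J) - \<delta> k)"
    then obtain s where s: "(\<Sum>i<n. u k (x i)) + (\<Sum>i<n. w k (y i)) \<ge> real n * ((\<integral>x. u k x \<partial>PX) + (\<integral>y. w k y \<partial>PY) - \<delta> k)"
      "(\<Sum>i<n. e k (x i, s i)) \<le> real n * ((\<integral>p. e k p \<partial>J) + \<delta> k)"
      "(\<Sum>i<n. h k (s i, y i)) \<ge> real n * (H k - \<delta> k)" unfolding H_def by blast
    show "distortion n x y > D"
      by (rule distortion_gt[OF n ab s(1)[unfolded u_def w_def] s(2)[unfolded e_def fst_conv snd_conv]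
          s(3)[unfolded h_def fst_conv snd_conv]])
        (use k e0 \<delta>0[of k] in \<open>auto simp: u_def w_def e_def\<close>)
  qed
  then show ?thesis by (rule exponentially_identifiableI)
qed

section \<open>Mixtures of test channels\<close>

locale channel_mixture = c0: test_channel PX Q0 f0 + c1: test_channel PX Q1 f1
  for PX :: "real measure" and Q0 :: "'s measure" and f0 :: "real \<times> 's \<Rightarrow> real"
    and Q1 :: "'t measure" and f1 :: "real \<times> 't \<Rightarrow> real" +
  fixes \<epsilon> :: real
  assumes \<epsilon>: "0 \<le> \<epsilon>" "\<epsilon> \<le> 1"
begin

text \<open>The label is part of the letter, so that the density of the mixture needs no Radon-Nikodym
  derivative and its information is the average of the two informations.\<close>

definition Q :: "(bool \<times> 's \<times> 't) measure" where
  "Q = measure_pmf (bernoulli_pmf \<epsilon>) \<Otimes>\<^sub>M (Q0 \<Otimes>\<^sub>M Q1)"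

text \<open>All three components of a letter are always present. The label selects the branch, and
  the component of the other branch keeps its reference law, independent of \<open>x\<close>; its
  density is 1 and it adds no information.\<close>

definition mix :: "(real \<times> 's \<Rightarrow> 'c) \<Rightarrow> (real \<times> 't \<Rightarrow> 'c) \<Rightarrow> real \<times> bool \<times> 's \<times> 't \<Rightarrow> 'c" where
  "mix g0 g1 = (\<lambda>(x, l, s, t). if l then g1 (x, t) else g0 (x, s))"

lemma mix_apply: "mix g0 g1 p = (if fst (snd p) then g1 (fst p, snd (snd (snd p))) else g0 (fst p, fst (snd (snd p))))"
  by (simp add: mix_def case_prod_beta)

lemma sets_Q[measurable_cong]: "sets Q = sets (count_space UNIV \<Otimes>\<^sub>M (Q0 \<Otimes>\<^sub>M Q1))"
  unfolding Q_def by (intro sets_pair_measure_cong) auto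

lemma prob_space_Q: "prob_space Q"
proof -
  interpret q: pair_prob_space Q0 Q1 ..
  interpret b: pair_prob_space "measure_pmf (bernoulli_pmf \<epsilon>)" "Q0 \<Otimes>\<^sub>M Q1" ..
  show ?thesis unfolding Q_def by (rule b.prob_space_axioms)
qed

lemma mix_measurable[measurable]:
  assumes [measurable]: "g0 \<in> (PX \<Otimes>\<^sub>M Q0) \<rightarrow>\<^sub>M N" "g1 \<in> (PX \<Otimes>\<^sub>M Q1) \<rightarrow>\<^sub>M N"
  shows "mix g0 g1 \<in> (PX \<Otimes>\<^sub>M Q) \<rightarrow>\<^sub>M N"
proof -
  have [measurable]: "Measurable.pred (PX \<Otimes>\<^sub>M Q) (\<lambda>p. fst (snd p))" by measurable
  show ?thesis unfolding mix_apply[abs_def] by measurable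
qed

lemma nn_integral_mix_section:
  fixes g0 g1 :: "_ \<Rightarrow> ennreal"
  assumes [measurable]: "g0 \<in> borel_measurable (PX \<Otimes>\<^sub>M Q0)" "g1 \<in> borel_measurable (PX \<Otimes>\<^sub>M Q1)"
  shows "(\<integral>\<^sup>+q. mix g0 g1 (x, q) \<partial>Q)
    = (\<integral>\<^sup>+t. g1 (x, t) \<partial>Q1) * ennreal \<epsilon> + (\<integral>\<^sup>+s. g0 (x, s) \<partial>Q0) * ennreal (1 - \<epsilon>)"
proof -
  interpret q: pair_prob_space Q0 Q1 ..
  interpret b: pair_prob_space "measure_pmf (bernoulli_pmf \<epsilon>)" "Q0 \<Otimes>\<^sub>M Q1" ..
  have [measurable]: "Measurable.pred (measure_pmf (bernoulli_pmf \<epsilon>) \<Otimes>\<^sub>M (Q0 \<Otimes>\<^sub>M Q1)) fst"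
    by (rule measurable_compose[OF measurable_fst]) simp
  have [measurable]: "(\<lambda>s. g0 (x, s)) \<in> borel_measurable Q0" "(\<lambda>t. g1 (x, t)) \<in> borel_measurable Q1"
    by measurable
  define k where "k q = (if fst q then g1 (x, snd (snd q)) else g0 (x, fst (snd q)))" for q
  have [measurable]: "(\<lambda>q. g1 (x, snd (snd q))) \<in> borel_measurable (measure_pmf (bernoulli_pmf \<epsilon>) \<Otimes>\<^sub>M (Q0 \<Otimes>\<^sub>M Q1))"
    "(\<lambda>q. g0 (x, fst (snd q))) \<in> borel_measurable (measure_pmf (bernoulli_pmf \<epsilon>) \<Otimes>\<^sub>M (Q0 \<Otimes>\<^sub>M Q1))"
    by measurable
  have [measurable]: "k \<in> borel_measurable (measure_pmf (bernoulli_pmf \<epsilon>) \<Otimes>\<^sub>M (Q0 \<Otimes>\<^sub>M Q1))"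
    unfolding k_def by measurable
  have "(\<integral>\<^sup>+q. mix g0 g1 (x, q) \<partial>Q) = (\<integral>\<^sup>+q. k q \<partial>Q)"
    unfolding mix_apply k_def fst_conv snd_conv ..
  also have "\<dots> = (\<integral>\<^sup>+l. (\<integral>\<^sup>+st. k (l, st) \<partial>(Q0 \<Otimes>\<^sub>M Q1)) \<partial>bernoulli_pmf \<epsilon>)"
    unfolding Q_def by (subst q.nn_integral_fst) auto
  also have "\<dots> = (\<integral>\<^sup>+l. (\<integral>\<^sup>+st. (if l then g1 (x, snd st) else g0 (x, fst st)) \<partial>(Q0 \<Otimes>\<^sub>M Q1)) \<partial>bernoulli_pmf \<epsilon>)"
    unfolding k_def fst_conv snd_conv ..
  also have "\<dots> = (\<integral>\<^sup>+st. g1 (x, snd st) \<partial>(Q0 \<Otimes>\<^sub>M Q1)) * ennreal \<epsilon>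
      + (\<integral>\<^sup>+st. g0 (x, fst st) \<partial>(Q0 \<Otimes>\<^sub>M Q1)) * ennreal (1 - \<epsilon>)"
    using \<epsilon> by (subst nn_integral_bernoulli_pmf) auto
  also have "(\<integral>\<^sup>+st. g1 (x, snd st) \<partial>(Q0 \<Otimes>\<^sub>M Q1)) = (\<integral>\<^sup>+t. g1 (x, t) \<partial>Q1)"
    by (subst c1.Q.nn_integral_fst[symmetric]) (auto simp: c0.Q.emeasure_space_1)
  also have "(\<integral>\<^sup>+st. g0 (x, fst st) \<partial>(Q0 \<Otimes>\<^sub>M Q1)) = (\<integral>\<^sup>+s. g0 (x, s) \<partial>Q0)"
    by (subst c1.Q.nn_integral_fst[symmetric]) (auto simp: c1.Q.emeasure_space_1)
  finally show ?thesis .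
qed

lemma test_channel_mix: "test_channel PX Q (mix f0 f1)"
proof -
  interpret Q: prob_space Q by (rule prob_space_Q)
  show ?thesis
  proof
    show "0 \<le> mix f0 f1 p" for p by (simp add: mix_apply c0.f_nonneg c1.f_nonneg)
    show "mix f0 f1 \<in> borel_measurable (PX \<Otimes>\<^sub>M Q)" by measurable
    fix x
    have "(\<integral>\<^sup>+q. ennreal (mix f0 f1 (x, q)) \<partial>Q)
        = (\<integral>\<^sup>+q. mix (\<lambda>p. ennreal (f0 p)) (\<lambda>p. ennreal (f1 p)) (x, q) \<partial>Q)"
      by (intro nn_integral_cong) (simp add: mix_apply)
    also have "\<dots> = ennreal \<epsilon> + ennreal (1 - \<epsilon>)"
      by (subst nn_integral_mix_section) (auto simp: c0.f_normalized c1.f_normalized)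
    also have "\<dots> = 1" using \<epsilon> by (simp flip: ennreal_plus)
    finally show "(\<integral>\<^sup>+q. ennreal (mix f0 f1 (x, q)) \<partial>Q) = 1" .
  qed
qed

sublocale mix: test_channel PX Q "mix f0 f1"
  by (rule test_channel_mix)

lemma nn_integral_mix_J:
  fixes g0 g1 :: "_ \<Rightarrow> ennreal"
  assumes [measurable]: "g0 \<in> borel_measurable (PX \<Otimes>\<^sub>M Q0)" "g1 \<in> borel_measurable (PX \<Otimes>\<^sub>M Q1)"
  shows "(\<integral>\<^sup>+p. mix g0 g1 p \<partial>mix.J) = (\<integral>\<^sup>+p. g1 p \<partial>c1.J) * ennreal \<epsilon> + (\<integral>\<^sup>+p. g0 p \<partial>c0.J) * ennreal (1 - \<epsilon>)"
proof -
  let ?g0 = "\<lambda>p. ennreal (f0 p) * g0 p" and ?g1 = "\<lambda>p. ennreal (f1 p) * g1 p"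
  have "(\<integral>\<^sup>+p. mix g0 g1 p \<partial>mix.J) = (\<integral>\<^sup>+p. mix ?g0 ?g1 p \<partial>(PX \<Otimes>\<^sub>M Q))"
    by (subst mix.nn_integral_J) (auto intro!: nn_integral_cong simp: mix_apply)
  also have "\<dots> = (\<integral>\<^sup>+x. (\<integral>\<^sup>+q. mix ?g0 ?g1 (x, q) \<partial>Q) \<partial>PX)"
    by (subst mix.Q.nn_integral_fst) auto
  also have "\<dots> = (\<integral>\<^sup>+x. (\<integral>\<^sup>+t. ?g1 (x, t) \<partial>Q1) * ennreal \<epsilon> + (\<integral>\<^sup>+s. ?g0 (x, s) \<partial>Q0) * ennreal (1 - \<epsilon>) \<partial>PX)"
    by (subst nn_integral_mix_section) auto
  also have "\<dots> = (\<integral>\<^sup>+x. (\<integral>\<^sup>+t. ?g1 (x, t) \<partial>Q1) \<partial>PX) * ennreal \<epsilon>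
      + (\<integral>\<^sup>+x. (\<integral>\<^sup>+s. ?g0 (x, s) \<partial>Q0) \<partial>PX) * ennreal (1 - \<epsilon>)"
    by (subst nn_integral_add) (auto simp: nn_integral_multc)
  also have "\<dots> = (\<integral>\<^sup>+p. g1 p \<partial>c1.J) * ennreal \<epsilon> + (\<integral>\<^sup>+p. g0 p \<partial>c0.J) * ennreal (1 - \<epsilon>)"
    using c0.Q.nn_integral_fst[of ?g0 PX] c1.Q.nn_integral_fst[of ?g1 PX]
    by (simp add: c0.nn_integral_J c1.nn_integral_J)
  finally show ?thesis .
qed

lemma integral_mix_J:
  fixes g0 g1 :: "_ \<Rightarrow> real"
  assumes g0: "integrable c0.J g0" and g1: "integrable c1.J g1"
  shows "integrable mix.J (mix g0 g1)"
    and "(\<integral>p. mix g0 g1 p \<partial>mix.J) = \<epsilon> * (\<integral>p. g1 p \<partial>c1.J) + (1 - \<epsilon>) * (\<integral>p. g0 p \<partial>c0.J)"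
proof -
  have m0[measurable]: "g0 \<in> borel_measurable (PX \<Otimes>\<^sub>M Q0)"
    using borel_measurable_integrable[OF g0] by measurable
  have m1[measurable]: "g1 \<in> borel_measurable (PX \<Otimes>\<^sub>M Q1)"
    using borel_measurable_integrable[OF g1] by measurable
  \<comment> \<open>Mixing commutes with applying \<open>h\<close>. The absolute value gives
    integrability; the identity and the negation give the positive and negative parts of the
    integral.\<close>
  have comp: "(\<integral>\<^sup>+p. ennreal (h (mix g0 g1 p)) \<partial>mix.J)
      = (\<integral>\<^sup>+p. ennreal (h (g1 p)) \<partial>c1.J) * ennreal \<epsilon> + (\<integral>\<^sup>+p. ennreal (h (g0 p)) \<partial>c0.J) * ennreal (1 - \<epsilon>)"
    if [measurable]: "h \<in> borel_measurable borel" for h :: "real \<Rightarrow> real"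
  proof -
    have "(\<integral>\<^sup>+p. ennreal (h (mix g0 g1 p)) \<partial>mix.J)
        = (\<integral>\<^sup>+p. mix (\<lambda>p. ennreal (h (g0 p))) (\<lambda>p. ennreal (h (g1 p))) p \<partial>mix.J)"
      by (intro nn_integral_cong) (simp add: mix_apply)
    then show ?thesis by (subst (asm) nn_integral_mix_J) auto
  qed
  have fin: "(\<integral>\<^sup>+p. ennreal \<bar>g0 p\<bar> \<partial>c0.J) < \<infinity>" "(\<integral>\<^sup>+p. ennreal \<bar>g1 p\<bar> \<partial>c1.J) < \<infinity>"
    using g0 g1 unfolding integrable_iff_bounded by auto
  show 1: "integrable mix.J (mix g0 g1)"
  proof (rule integrableI_bounded)
    show "mix g0 g1 \<in> borel_measurable mix.J" by measurable
    show "(\<integral>\<^sup>+p. ennreal (norm (mix g0 g1 p)) \<partial>mix.J) < \<infinity>"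
      unfolding real_norm_def using fin by (subst comp) (auto simp: ennreal_mult_less_top)
  qed
  have fp: "(\<integral>\<^sup>+p. ennreal (g0 p) \<partial>c0.J) < \<infinity>" "(\<integral>\<^sup>+p. ennreal (- g0 p) \<partial>c0.J) < \<infinity>"
    by (rule le_less_trans[OF nn_integral_mono fin(1)]; simp add: ennreal_leI)+
  have fq: "(\<integral>\<^sup>+p. ennreal (g1 p) \<partial>c1.J) < \<infinity>" "(\<integral>\<^sup>+p. ennreal (- g1 p) \<partial>c1.J) < \<infinity>"
    by (rule le_less_trans[OF nn_integral_mono fin(2)]; simp add: ennreal_leI)+
  have e2: "enn2real (v * ennreal \<epsilon> + w * ennreal (1 - \<epsilon>)) = enn2real v * \<epsilon> + enn2real w * (1 - \<epsilon>)"
    if "v < \<infinity>" "w < \<infinity>" for v w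
    using that \<epsilon> by (subst enn2real_plus) (auto simp: ennreal_mult_less_top enn2real_mult)
  show "(\<integral>p. mix g0 g1 p \<partial>mix.J) = \<epsilon> * (\<integral>p. g1 p \<partial>c1.J) + (1 - \<epsilon>) * (\<integral>p. g0 p \<partial>c0.J)"
    unfolding real_lebesgue_integral_def[OF 1] real_lebesgue_integral_def[OF g0] real_lebesgue_integral_def[OF g1]
    using comp[of "\<lambda>x. x"] comp[of "\<lambda>x. - x"] fp fq
    by (simp add: e2) (simp add: algebra_simps)
qed

end

text \<open>The letters are uniform on the range of \<open>\<phi>\<close> instead of having the law of \<open>\<phi> X\<close>: this can only
  increase the information, which is then the logarithm of a cardinality.\<close>

locale quantizer = PX: real_distribution PX for PX :: "real measure" +
  fixes \<phi> :: "real \<Rightarrow> real"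
  assumes simple: "simple_function PX \<phi>"
begin

abbreviation V :: "real set" where "V \<equiv> range \<phi>"

lemma finite_V: "finite V"
  using simple_functionD(1)[OF simple] by simp

lemma card_V: "0 < card V" using finite_V by (simp add: card_gt_0_iff)

lemma \<phi>_measurable[measurable]: "\<phi> \<in> borel_measurable borel"
  using borel_measurable_simple_function[OF simple] by measurable

definition Q :: "real measure" where "Q = measure_pmf (pmf_of_set V)"

lemma sets_Q[simp, measurable_cong]: "sets Q = UNIV" and space_Q[simp]: "space Q = UNIV"
  by (simp_all add: Q_def)

lemma \<phi>_measurable_Q[measurable]: "\<phi> \<in> PX \<rightarrow>\<^sub>M Q"
  using measurable_simple_function[OF simple] measurable_cong_sets[of PX PX Q "count_space UNIV"] by simp

text \<open>The density of the graph of \<open>\<phi>\<close> against the uniform law on its range.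
  The sum over indicators is chosen for measurability; \<open>f_eq\<close> is the form used for
  computing.\<close>

definition f :: "real \<times> real \<Rightarrow> real" where
  "f p = (\<Sum>v\<in>V. real (card V) * (indicator {v} (\<phi> (fst p)) * indicator {v} (snd p)))"

lemma f_eq: "f (x, t) = (if t = \<phi> x then real (card V) else 0)"
proof (cases "t = \<phi> x")
  case True
  then have "f (x, t) = (\<Sum>v\<in>V. if v = \<phi> x then real (card V) else 0)"
    unfolding f_def by (intro sum.cong) (auto simp: indicator_def)
  also have "\<dots> = real (card V)" using finite_V by simp
  finally show ?thesis using True by simp
next
  case False
  then show ?thesis unfolding f_def by (auto intro!: sum.neutral simp: indicator_def)
qed

lemma nn_integral_Q: "(\<integral>\<^sup>+t. ennreal (f (x, t)) * g t \<partial>Q) = g (\<phi> x)"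
proof -
  have "(\<integral>\<^sup>+t. ennreal (f (x, t)) * g t \<partial>Q) = (\<Sum>t\<in>V. ennreal (f (x, t)) * g t) / of_nat (card V)"
    unfolding Q_def using finite_V by (subst nn_integral_pmf_of_set) auto
  also have "(\<Sum>t\<in>V. ennreal (f (x, t)) * g t) = (\<Sum>t\<in>V. if t = \<phi> x then of_nat (card V) * g t else 0)"
    by (intro sum.cong) (auto simp: f_eq ennreal_of_nat_eq_real_of_nat)
  also have "\<dots> = of_nat (card V) * g (\<phi> x)" using finite_V by simp
  also have "\<dots> / of_nat (card V) = g (\<phi> x)"
    using card_V by (simp add: ennreal_mult_divide_eq mult.commute)
  finally show ?thesis .
qed

sublocale test_channel PX Q f
proof -
  interpret Q: prob_space Q unfolding Q_def by (rule prob_space_measure_pmf)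
  show "test_channel PX Q f"
  proof
    have i[measurable]: "(indicator {v} :: real \<Rightarrow> real) \<in> borel_measurable Q" for v
      by (auto simp: measurable_def)
    have "(\<lambda>p. indicator {v} (snd p) :: real) \<in> borel_measurable (PX \<Otimes>\<^sub>M Q)" for v
      by (rule measurable_compose[OF measurable_snd i])
    moreover have "(\<lambda>p. indicator {v} (\<phi> (fst p)) :: real) \<in> borel_measurable (PX \<Otimes>\<^sub>M Q)" for v
      by (rule measurable_compose[OF measurable_fst]) measurable
    ultimately show "f \<in> borel_measurable (PX \<Otimes>\<^sub>M Q)"
      unfolding f_def[abs_def] by (intro borel_measurable_sum borel_measurable_times) auto
    show "0 \<le> f p" for p unfolding f_def by (intro sum_nonneg) auto
    show "(\<integral>\<^sup>+s. ennreal (f (x, s)) \<partial>Q) = 1" for x using nn_integral_Q[of x "\<lambda>_. 1"] by simp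
  qed
qed

lemma J_eq: "J = distr PX (PX \<Otimes>\<^sub>M Q) (\<lambda>x. (x, \<phi> x))"
proof (rule measure_eqI)
  fix A assume "A \<in> sets J"
  then have [measurable]: "A \<in> sets (PX \<Otimes>\<^sub>M Q)" by simp
  have "emeasure J A = (\<integral>\<^sup>+p. indicator A p \<partial>J)" using \<open>A \<in> sets J\<close> by simp
  also have "\<dots> = (\<integral>\<^sup>+p. ennreal (f p) * indicator A p \<partial>(PX \<Otimes>\<^sub>M Q))"
    by (rule nn_integral_J) measurable
  also have "\<dots> = (\<integral>\<^sup>+x. (\<integral>\<^sup>+t. ennreal (f (x, t)) * indicator A (x, t) \<partial>Q) \<partial>PX)"
    by (subst Q.nn_integral_fst) auto
  also have "\<dots> = (\<integral>\<^sup>+x. indicator A (x, \<phi> x) \<partial>PX)" by (simp add: nn_integral_Q)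
  also have "\<dots> = (\<integral>\<^sup>+p. indicator A p \<partial>distr PX (PX \<Otimes>\<^sub>M Q) (\<lambda>x. (x, \<phi> x)))"
    by (subst nn_integral_distr) auto
  finally show "emeasure J A = emeasure (distr PX (PX \<Otimes>\<^sub>M Q) (\<lambda>x. (x, \<phi> x))) A" by simp
qed simp

lemma integral_J_quantizer:
  fixes g :: "real \<times> real \<Rightarrow> real"
  assumes [measurable]: "g \<in> borel_measurable (PX \<Otimes>\<^sub>M Q)"
  shows "(\<integral>p. g p \<partial>J) = (\<integral>x. g (x, \<phi> x) \<partial>PX)"
    and "integrable J g \<longleftrightarrow> integrable PX (\<lambda>x. g (x, \<phi> x))"
proof -
  show "(\<integral>p. g p \<partial>J) = (\<integral>x. g (x, \<phi> x) \<partial>PX)"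
    unfolding J_eq by (subst integral_distr) auto
  show "integrable J g \<longleftrightarrow> integrable PX (\<lambda>x. g (x, \<phi> x))"
    unfolding J_eq by (subst integrable_distr_eq) auto
qed

lemma integrable_\<phi>: "integrable PX \<phi>" "integrable PX (\<lambda>x. (\<phi> x)\<^sup>2)"
proof -
  have b: "\<bar>\<phi> x\<bar> \<le> (\<Sum>v\<in>V. \<bar>v\<bar>)" for x using finite_V by (intro member_le_sum) auto
  then have "\<bar>(\<phi> x)\<^sup>2\<bar> \<le> (\<Sum>v\<in>V. \<bar>v\<bar>)\<^sup>2" for x
    using power_mono[OF b[of x] abs_ge_zero, of 2] by simp
  then show "integrable PX (\<lambda>x. (\<phi> x)\<^sup>2)"
    by (intro PX.integrable_bounded) auto
  show "integrable PX \<phi>" using b by (intro PX.integrable_bounded) auto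
qed

lemma information: "integrable J (\<lambda>p. ln (f p))" "(\<integral>p. ln (f p) \<partial>J) = ln (real (card V))"
  by (subst integral_J_quantizer; simp add: f_eq PX.prob_space[simplified])+

end

section \<open>From equality to strict inequality\<close>

text \<open>Let \<open>U = a Y\<close> and \<open>V = b X\<close>. With \<open>v = E(U - \<mu>)\<^sup>2\<close>, \<open>w = E(V - \<mu>)\<^sup>2\<close> and \<open>\<mu> = E U\<close>, the reconstruction
  \<open>g = V + c (V - \<mu>)\<close> has \<open>E(U - g)\<^sup>2 = v + (1 + c)\<^sup>2 w\<close> and \<open>E(V - g)\<^sup>2 = c\<^sup>2 w\<close>; the choice
  \<open>c = \<beta> / \<Delta>\<close> maximizes the left-hand side.\<close>

lemma ex_improving_direction:
  fixes v w \<beta> \<Delta> :: real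
  assumes "0 < \<beta>" "0 \<le> \<Delta>" "0 \<le> v" "0 \<le> w" "v + w \<noteq> \<Delta>\<^sup>2"
    and gap: "0 < \<Delta> \<Longrightarrow> 0 \<le> \<Delta> * v + (\<beta> + \<Delta>) * (w - \<Delta>\<^sup>2)"
    and gap0: "0 < \<Delta> \<Longrightarrow> \<Delta> * v + (\<beta> + \<Delta>) * (w - \<Delta>\<^sup>2) = 0 \<Longrightarrow> w = \<Delta>\<^sup>2"
  shows "\<exists>c. \<Delta> < (v + (1 + c)\<^sup>2 * w) / (\<beta> + \<Delta>) - c\<^sup>2 * w / \<beta>"
proof (cases "\<Delta> = 0")
  case True
  then have "0 < v + w" using assms by (simp add: order_less_le)
  then show ?thesis using True assms by (intro exI[of _ 0]) simp
next
  case False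
  then have \<Delta>: "0 < \<Delta>" using assms by simp
  have "\<Delta> * v + (\<beta> + \<Delta>) * (w - \<Delta>\<^sup>2) \<noteq> 0"
  proof
    assume 0: "\<Delta> * v + (\<beta> + \<Delta>) * (w - \<Delta>\<^sup>2) = 0"
    from gap0[OF \<Delta> this] have "w = \<Delta>\<^sup>2" .
    with 0 \<Delta> have "v = 0" by simp
    with \<open>w = \<Delta>\<^sup>2\<close> assms(5) show False by simp
  qed
  then have pos: "0 < \<Delta> * v + (\<beta> + \<Delta>) * (w - \<Delta>\<^sup>2)" using gap[OF \<Delta>] by simp
  \<comment> \<open>\<open>c = \<beta> / \<Delta>\<close> is the stationary point, where
    \<open>(1 + c) / (\<beta> + \<Delta>) = c / \<beta>\<close>.\<close>
  have "(1 + \<beta> / \<Delta>)\<^sup>2 = (\<beta> + \<Delta>)\<^sup>2 / \<Delta>\<^sup>2" using \<Delta> by (simp add: field_simps power2_eq_square)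
  then have "(v + (1 + \<beta> / \<Delta>)\<^sup>2 * w) / (\<beta> + \<Delta>) - (\<beta> / \<Delta>)\<^sup>2 * w / \<beta>
      = v / (\<beta> + \<Delta>) + ((\<beta> + \<Delta>) * w / \<Delta>\<^sup>2 - \<beta> * w / \<Delta>\<^sup>2)"
    using \<Delta> assms(1) by (simp add: add_divide_distrib power2_eq_square power_divide)
  also have "(\<beta> + \<Delta>) * w / \<Delta>\<^sup>2 - \<beta> * w / \<Delta>\<^sup>2 = w / \<Delta>"
    using \<Delta> by (simp add: power2_eq_square field_simps)
  also have "v / (\<beta> + \<Delta>) + w / \<Delta> = \<Delta> + (\<Delta> * v + (\<beta> + \<Delta>) * (w - \<Delta>\<^sup>2)) / (\<Delta> * (\<beta> + \<Delta>))"
  proof -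
    have "\<beta> + \<Delta> \<noteq> 0" using \<Delta> assms(1) by simp
    then show ?thesis using \<Delta> by (simp add: divide_simps) (simp add: power2_eq_square algebra_simps)
  qed
  also have "\<dots> > \<Delta>" using pos \<Delta> assms(1) by simp
  finally show ?thesis by blast
qed

text \<open>Simple functions can approach \<open>g\<close> pointwise with absolute value at most
  \<open>2 * \<bar>g x\<bar>\<close>, which dominates all three integrands. The finite range is what
  makes the information finite: an affine function of \<open>X\<close> itself may carry infinite
  information.\<close>

lemma (in prob_space) simple_approximation:
  fixes g h :: "'a \<Rightarrow> real"
  assumes [measurable]: "g \<in> borel_measurable M" "h \<in> borel_measurable M"
    and g2: "integrable M (\<lambda>x. (g x)\<^sup>2)" and h2: "integrable M (\<lambda>x. (h x)\<^sup>2)"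
  shows "\<exists>\<phi>. (\<forall>i. simple_function M (\<phi> i)) \<and>
    (\<lambda>i. \<integral>x. \<phi> i x \<partial>M) \<longlonglongrightarrow> (\<integral>x. g x \<partial>M) \<and>
    (\<lambda>i. \<integral>x. (\<phi> i x)\<^sup>2 \<partial>M) \<longlonglongrightarrow> (\<integral>x. (g x)\<^sup>2 \<partial>M) \<and>
    (\<lambda>i. \<integral>x. (h x - \<phi> i x)\<^sup>2 \<partial>M) \<longlonglongrightarrow> (\<integral>x. (h x - g x)\<^sup>2 \<partial>M)"
proof -
  obtain \<phi> where \<phi>: "\<And>i. simple_function M (\<phi> i)" "\<And>x. x \<in> space M \<Longrightarrow> (\<lambda>i. \<phi> i x) \<longlonglongrightarrow> g x"
    and d: "\<And>i x. x \<in> space M \<Longrightarrow> dist (\<phi> i x) 0 \<le> 2 * dist (g x) 0"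
    using borel_measurable_implies_sequence_metric[OF assms(1), of 0] by blast
  have [measurable]: "\<phi> i \<in> borel_measurable M" for i using \<phi>(1) by (rule borel_measurable_simple_function)
  have b: "\<bar>\<phi> i x\<bar> \<le> 2 * \<bar>g x\<bar>" if "x \<in> space M" for i x using d[OF that] by simp
  have b2: "(\<phi> i x)\<^sup>2 \<le> 4 * (g x)\<^sup>2" if "x \<in> space M" for i x
    using power_mono[OF b[OF that, of i] abs_ge_zero, where n=2] by (simp add: power_mult_distrib)
  have "(\<lambda>i. \<integral>x. \<phi> i x \<partial>M) \<longlonglongrightarrow> (\<integral>x. g x \<partial>M)"
    by (rule integral_dominated_convergence[where w="\<lambda>x. 2 * \<bar>g x\<bar>"])
      (use integrable_of_square[OF assms(1) g2] \<phi> b in auto)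
  moreover have "(\<lambda>i. \<integral>x. (\<phi> i x)\<^sup>2 \<partial>M) \<longlonglongrightarrow> (\<integral>x. (g x)\<^sup>2 \<partial>M)"
    by (rule integral_dominated_convergence[where w="\<lambda>x. 4 * (g x)\<^sup>2"])
      (use g2 \<phi> b2 in \<open>auto intro!: tendsto_intros\<close>)
  moreover have "(\<lambda>i. \<integral>x. (h x - \<phi> i x)\<^sup>2 \<partial>M) \<longlonglongrightarrow> (\<integral>x. (h x - g x)\<^sup>2 \<partial>M)"
  proof (rule integral_dominated_convergence[where w="\<lambda>x. 2 * (h x)\<^sup>2 + 8 * (g x)\<^sup>2"])
    show "integrable M (\<lambda>x. 2 * (h x)\<^sup>2 + 8 * (g x)\<^sup>2)" using g2 h2 by auto
    show "AE x in M. norm ((h x - \<phi> i x)\<^sup>2) \<le> 2 * (h x)\<^sup>2 + 8 * (g x)\<^sup>2" for i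
    proof (rule AE_I2)
      fix x assume x: "x \<in> space M"
      have "(h x - \<phi> i x)\<^sup>2 \<le> 2 * (h x)\<^sup>2 + 2 * (\<phi> i x)\<^sup>2"
        using zero_le_power2[of "h x + \<phi> i x"] by (simp add: power2_sum power2_diff)
      then show "norm ((h x - \<phi> i x)\<^sup>2) \<le> 2 * (h x)\<^sup>2 + 8 * (g x)\<^sup>2" using b2[OF x, of i] by simp
    qed
  qed (use \<phi> in \<open>auto intro!: tendsto_intros\<close>)
  ultimately show ?thesis using \<phi>(1) by blast
qed

lemma (in test_channel) integrable_square_error:
  fixes z :: "'s \<Rightarrow> real"
  assumes X2: "integrable PX (\<lambda>x. x\<^sup>2)" and [measurable]: "z \<in> borel_measurable Q"
    and Z2: "integrable J (\<lambda>p. (z (snd p))\<^sup>2)"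
  shows "integrable J (\<lambda>p. fst p * z (snd p))" "integrable J (\<lambda>p. (b * fst p - z (snd p))\<^sup>2)"
    "integrable J (\<lambda>p. z (snd p))" "integrable J fst"
proof -
  interpret J: prob_space J by (rule prob_space_J)
  have fstm[measurable]: "fst \<in> J \<rightarrow>\<^sub>M borel" by measurable
  have X2J: "integrable J (\<lambda>p. (fst p)\<^sup>2)" using integral_J_fst(2)[of "\<lambda>x. x\<^sup>2"] X2 by simp
  show "integrable J (\<lambda>p. z (snd p))" by (rule J.integrable_of_square[OF _ Z2]) simp
  show "integrable J fst" by (rule J.integrable_of_square[OF fstm X2J])
  show 1: "integrable J (\<lambda>p. fst p * z (snd p))"
  proof (rule Bochner_Integration.integrable_bound[where f="\<lambda>p. (fst p)\<^sup>2 + (z (snd p))\<^sup>2"])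
    show "integrable J (\<lambda>p. (fst p)\<^sup>2 + (z (snd p))\<^sup>2)" using X2J Z2 by auto
    have "\<bar>s * t\<bar> \<le> s\<^sup>2 + t\<^sup>2" for s t :: real
    proof -
      have "0 \<le> (\<bar>s\<bar> - \<bar>t\<bar>)\<^sup>2" by simp
      then have "2 * \<bar>s * t\<bar> \<le> s\<^sup>2 + t\<^sup>2" by (simp add: power2_diff abs_mult)
      then show ?thesis by (smt (verit) abs_ge_zero)
    qed
    then show "AE p in J. norm (fst p * z (snd p)) \<le> norm ((fst p)\<^sup>2 + (z (snd p))\<^sup>2)" by simp
  qed measurable
  have "(\<lambda>p. (b * fst p - z (snd p))\<^sup>2) = (\<lambda>p. b\<^sup>2 * (fst p)\<^sup>2 - 2 * b * (fst p * z (snd p)) + (z (snd p))\<^sup>2)"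
    by (simp add: fun_eq_iff power2_diff power_mult_distrib algebra_simps)
  then show "integrable J (\<lambda>p. (b * fst p - z (snd p))\<^sup>2)" using 1 X2J Z2 by simp
qed

text \<open>If the constraint holds with equality, \<open>X'\<close> is replaced with a small probability by a
  quantization of the best affine function of \<open>X\<close>. This makes the constraint strict, because the
  derivative of its slack in the mixing probability is positive, at a small cost in information.\<close>

theorem (in test_channel) identifiable_of_feasible:
  fixes z :: "'s \<Rightarrow> real"
  assumes "real_distribution PY" and "R > 0"
    and X2: "integrable PX (\<lambda>x. x\<^sup>2)" and Y2: "integrable PY (\<lambda>y. y\<^sup>2)"
    and z[measurable]: "z \<in> borel_measurable Q" and Z2: "integrable J (\<lambda>p. (z (snd p))\<^sup>2)"
    and info: "integrable J (\<lambda>p. ln (f p))" "(\<integral>p. ln (f p) \<partial>J) < R * ln 2"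
    and ab: "a * b = 1"
  defines "A \<equiv> a\<^sup>2 * (\<integral>y. y\<^sup>2 \<partial>PY) - 2 * a * (\<integral>y. y \<partial>PY) * (\<integral>p. z (snd p) \<partial>J) + (\<integral>p. (z (snd p))\<^sup>2 \<partial>J)"
    and "B \<equiv> \<integral>p. (b * fst p - z (snd p))\<^sup>2 \<partial>J"
  assumes bal: "b\<^sup>2 * (\<integral>x. x\<^sup>2 \<partial>PX) = a\<^sup>2 * (\<integral>y. y\<^sup>2 \<partial>PY)"
    and "0 \<le> \<Delta>" and feas: "sqrt B + \<Delta> \<le> sqrt A"
    and D: "D \<le> (1 - b\<^sup>2) * (\<integral>x. x\<^sup>2 \<partial>PX) + (1 - a\<^sup>2) * (\<integral>y. y\<^sup>2 \<partial>PY) + \<Delta>\<^sup>2"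
    and W: "2 * (a\<^sup>2 * (\<integral>y. y\<^sup>2 \<partial>PY)) - 2 * (\<integral>x. x \<partial>PX) * (\<integral>y. y \<partial>PY) \<noteq> \<Delta>\<^sup>2"
  shows "exponentially_identifiable PX PY D R"
proof -
  interpret PY: real_distribution PY by fact
  interpret J: prob_space J by (rule prob_space_J)
  have [measurable]: "fst \<in> J \<rightarrow>\<^sub>M borel" by measurable
  \<comment> \<open>In terms of \<open>U = a Y\<close> and \<open>V = b X\<close>: \<open>s2\<close>
    is their common second moment, \<open>\<mu>\<close> and \<open>\<nu>\<close> are the means of
    \<open>U\<close> and \<open>V\<close>, \<open>v\<close> is the variance of \<open>U\<close>, and
    \<open>w = E(V - \<mu>)^2\<close>. For independent \<open>U\<close>, \<open>V\<close> the sum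
    \<open>v + w\<close> is \<open>E(U - V)^2\<close>, so \<open>W\<close> says that it differs from
    \<open>\<Delta>\<close> squared.\<close>
  define s2 where "s2 = a\<^sup>2 * (\<integral>y. y\<^sup>2 \<partial>PY)"
  define \<mu> where "\<mu> = a * (\<integral>y. y \<partial>PY)"
  define \<nu> where "\<nu> = b * (\<integral>x. x \<partial>PX)"
  define v where "v = s2 - \<mu>\<^sup>2"
  define w where "w = s2 - 2 * \<mu> * \<nu> + \<mu>\<^sup>2"
  have iX: "integrable PX (\<lambda>x. x)" by (rule PX.integrable_of_square[OF _ X2]) simp
  have iY: "integrable PY (\<lambda>y. y)" by (rule PY.integrable_of_square[OF _ Y2]) simp
  have s2X: "b\<^sup>2 * (\<integral>x. x\<^sup>2 \<partial>PX) = s2" using bal by (simp add: s2_def)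
  have vw: "v + w \<noteq> \<Delta>\<^sup>2"
  proof -
    have "\<mu> * \<nu> = (\<integral>x. x \<partial>PX) * (\<integral>y. y \<partial>PY) * (a * b)" by (simp add: \<mu>_def \<nu>_def)
    then have "2 * (\<integral>x. x \<partial>PX) * (\<integral>y. y \<partial>PY) = 2 * \<mu> * \<nu>" using ab by simp
    then show ?thesis using W by (simp add: v_def w_def s2_def)
  qed
  have "0 \<le> (\<integral>y. (y - (\<integral>y. y \<partial>PY))\<^sup>2 \<partial>PY)" by simp
  also have "\<dots> = (\<integral>y. y\<^sup>2 \<partial>PY) - (\<integral>y. y \<partial>PY)\<^sup>2"
    using Y2 iY PY.prob_space by (simp add: power2_diff) (simp add: power2_eq_square)
  finally have "0 \<le> a\<^sup>2 * ((\<integral>y. y\<^sup>2 \<partial>PY) - (\<integral>y. y \<partial>PY)\<^sup>2)" by simp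
  then have v0: "0 \<le> v" by (simp add: v_def s2_def \<mu>_def power_mult_distrib algebra_simps)
  have w_eq: "(\<integral>x. (b * x - \<mu>)\<^sup>2 \<partial>PX) = w"
  proof -
    have "(\<integral>x. (b * x - \<mu>)\<^sup>2 \<partial>PX) = (\<integral>x. b\<^sup>2 * x\<^sup>2 - 2 * \<mu> * b * x + \<mu>\<^sup>2 \<partial>PX)"
      by (simp add: power2_diff power_mult_distrib algebra_simps)
    also have "\<dots> = b\<^sup>2 * (\<integral>x. x\<^sup>2 \<partial>PX) - 2 * \<mu> * b * (\<integral>x. x \<partial>PX) + \<mu>\<^sup>2"
      using X2 iX PX.prob_space by simp
    finally show ?thesis by (simp add: w_def s2X \<nu>_def)
  qed
  then have w0: "0 \<le> w" by (metis integral_nonneg_AE AE_I2 zero_le_power2)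
  note ints = integrable_square_error[OF X2 z Z2]
  define m where "m = (\<integral>p. z (snd p) \<partial>J)"
  define q where "q = (\<integral>p. (z (snd p))\<^sup>2 \<partial>J)"
  define r where "r = b * (\<integral>p. fst p * z (snd p) \<partial>J)"
  have EX: "(\<integral>p. fst p \<partial>J) = (\<integral>x. x \<partial>PX)" "(\<integral>p. (fst p)\<^sup>2 \<partial>J) = (\<integral>x. x\<^sup>2 \<partial>PX)"
    using integral_J_fst(1)[of "\<lambda>x. x"] integral_J_fst(1)[of "\<lambda>x. x\<^sup>2"] by auto
  have X2J: "integrable J (\<lambda>p. (fst p)\<^sup>2)" using integral_J_fst(2)[of "\<lambda>x. x\<^sup>2"] X2 by simp
  have A_eq: "A = s2 - 2 * \<mu> * m + q" by (simp add: A_def s2_def \<mu>_def m_def q_def)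
  have quad: "(\<integral>p. (z (snd p) - (k * fst p + l))\<^sup>2 \<partial>J)
      = q - 2 * k * (\<integral>p. fst p * z (snd p) \<partial>J) - 2 * l * m + k\<^sup>2 * (\<integral>x. x\<^sup>2 \<partial>PX) + 2 * k * l * (\<integral>x. x \<partial>PX) + l\<^sup>2" for k l
  proof -
    have "(\<integral>p. (z (snd p) - (k * fst p + l))\<^sup>2 \<partial>J)
      = (\<integral>p. (z (snd p))\<^sup>2 - 2 * k * (fst p * z (snd p)) - 2 * l * z (snd p) + k\<^sup>2 * (fst p)\<^sup>2 + 2 * k * l * fst p + l\<^sup>2 \<partial>J)"
      by (intro Bochner_Integration.integral_cong) (auto simp: power2_eq_square algebra_simps)
    also have "\<dots> = q - 2 * k * (\<integral>p. fst p * z (snd p) \<partial>J) - 2 * l * m + k\<^sup>2 * (\<integral>x. x\<^sup>2 \<partial>PX) + 2 * k * l * (\<integral>x. x \<partial>PX) + l\<^sup>2"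
      using ints Z2 X2J J.prob_space by (simp add: EX q_def m_def)
    finally show ?thesis .
  qed
  have B_eq: "B = s2 - 2 * r + q"
  proof -
    have "B = (\<integral>p. (z (snd p) - (b * fst p + 0))\<^sup>2 \<partial>J)" unfolding B_def by (simp add: power2_commute)
    also have "\<dots> = s2 - 2 * r + q" unfolding quad by (simp add: r_def flip: s2X)
    finally show ?thesis .
  qed
  have B0: "0 \<le> B" unfolding B_def by simp
  define \<beta> where "\<beta> = sqrt B"
  have \<beta>: "0 \<le> \<beta>" "B = \<beta>\<^sup>2" using B0 by (auto simp: \<beta>_def)
  have A0: "0 \<le> A"
  proof -
    have "0 \<le> sqrt A" using feas \<open>0 \<le> \<Delta>\<close> B0 by (meson add_nonneg_nonneg order_trans real_sqrt_ge_zero)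
    then show ?thesis by simp
  qed
  show ?thesis
  proof (cases "sqrt B + \<Delta> < sqrt A")
    case True
    then have "\<Delta>\<^sup>2 < (sqrt A - sqrt B)\<^sup>2" using \<open>0 \<le> \<Delta>\<close> by (intro power_strict_mono) auto
    moreover have "sqrt B < sqrt A" using True \<open>0 \<le> \<Delta>\<close> by linarith
    ultimately show ?thesis
      using D unfolding A_def B_def
      by (intro identifiable_of_strict[OF assms(1,2) X2 Y2 z Z2 info ab]) auto
  next
    case False
    then have eq: "sqrt A = \<beta> + \<Delta>" using feas by (simp add: \<beta>_def)
    then have A_sq: "A = (\<beta> + \<Delta>)\<^sup>2" using A0 by (metis real_sqrt_pow2)
    \<comment> \<open>The square roots in the slack must be differentiable. If \<open>B = 0\<close>,
      the reconstruction is \<open>V\<close> itself, so \<open>A = v + w\<close>, and equality in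
      the constraint would contradict \<open>vw\<close>.\<close>
    have "\<beta> \<noteq> 0"
    proof
      assume "\<beta> = 0"
      then have "B = 0" using \<beta> by simp
      then have "AE p in J. (b * fst p - z (snd p))\<^sup>2 = 0"
        using ints(2)[of b] unfolding B_def by (subst (asm) integral_nonneg_eq_0_iff_AE) auto
      then have ae: "AE p in J. z (snd p) = b * fst p" by eventually_elim simp
      then have "m = (\<integral>p. b * fst p \<partial>J)" unfolding m_def by (intro integral_cong_AE) auto
      moreover have "q = (\<integral>p. (b * fst p)\<^sup>2 \<partial>J)"
        unfolding q_def using ae by (intro integral_cong_AE) auto
      ultimately have "m = \<nu>" "q = s2" by (auto simp: EX \<nu>_def power_mult_distrib s2X)
      then have "A = v + w" by (simp add: A_eq v_def w_def)
      then show False using vw A_sq \<open>\<beta> = 0\<close> by simp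
    qed
    then have \<beta>0: "0 < \<beta>" using \<beta> by simp
    have r_eq: "2 * r = s2 + q - \<beta>\<^sup>2" using B_eq \<beta> by simp
    have m_eq: "2 * \<mu> * m = s2 + q - (\<beta> + \<Delta>)\<^sup>2" using A_eq A_sq by simp
    \<comment> \<open>Equality in the constraint determines the mixed moments \<open>r\<close> and
      \<open>\<mu> * m\<close>, so the mean square distance between \<open>Z\<close> and
      \<open>V + c (V - \<mu>)\<close> depends on \<open>v\<close>, \<open>w\<close>,
      \<open>\<beta>\<close>, \<open>\<Delta>\<close> only. At \<open>c = \<beta> / \<Delta>\<close>
      it is a positive multiple of the gap in \<open>ex_improving_direction\<close>, which is
      therefore nonnegative.\<close>
    have dist: "(\<integral>p. (z (snd p) - ((1 + c) * b * fst p + (- (c * \<mu>))))\<^sup>2 \<partial>J)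
        = c\<^sup>2 * w + c * (v + w) + (1 + c) * \<beta>\<^sup>2 - c * (\<beta> + \<Delta>)\<^sup>2" for c
    proof -
      have "(\<integral>p. (z (snd p) - ((1 + c) * b * fst p + (- (c * \<mu>))))\<^sup>2 \<partial>J)
        = q - (1 + c) * (2 * r) + c * (2 * \<mu> * m) + (1 + c)\<^sup>2 * s2 - 2 * (1 + c) * c * \<mu> * \<nu> + c\<^sup>2 * \<mu>\<^sup>2"
        unfolding quad r_def \<nu>_def s2X[symmetric] by (simp add: power_mult_distrib)
      also have "\<dots> = c\<^sup>2 * w + c * (v + w) + (1 + c) * \<beta>\<^sup>2 - c * (\<beta> + \<Delta>)\<^sup>2"
        unfolding r_eq m_eq w_def v_def by (simp add: power2_eq_square algebra_simps)
      finally show ?thesis .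
    qed
    have gap_eq: "\<Delta> * v + (\<beta> + \<Delta>) * (w - \<Delta>\<^sup>2)
        = \<Delta>\<^sup>2 / \<beta> * (\<integral>p. (z (snd p) - ((1 + \<beta> / \<Delta>) * b * fst p + (- (\<beta> / \<Delta> * \<mu>))))\<^sup>2 \<partial>J)" if "0 < \<Delta>"
      unfolding dist using that \<beta>0 by (simp add: divide_simps) (simp add: power2_eq_square algebra_simps)
    have gap: "0 \<le> \<Delta> * v + (\<beta> + \<Delta>) * (w - \<Delta>\<^sup>2)" if "0 < \<Delta>"
      unfolding gap_eq[OF that] using that \<beta>0 by simp
    \<comment> \<open>A zero gap means that \<open>Z\<close> already is the best affine function
      almost surely. Then \<open>B = c\<^sup>2 * w\<close> with
      \<open>c = \<beta> / \<Delta>\<close>, and \<open>B = \<beta>\<^sup>2\<close> leaves only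
      \<open>w = \<Delta>\<^sup>2\<close>.\<close>
    have gap0: "w = \<Delta>\<^sup>2" if "0 < \<Delta>" "\<Delta> * v + (\<beta> + \<Delta>) * (w - \<Delta>\<^sup>2) = 0"
    proof -
      define c where "c = \<beta> / \<Delta>"
      have "(\<integral>p. (z (snd p) - ((1 + c) * b * fst p + (- (c * \<mu>))))\<^sup>2 \<partial>J) = 0"
        using that(2) gap_eq[OF that(1)] that(1) \<beta>0 by (simp add: c_def)
      moreover have "integrable J (\<lambda>p. (z (snd p) - ((1 + c) * b * fst p + (- (c * \<mu>))))\<^sup>2)"
      proof -
        have "(\<lambda>p. (z (snd p) - ((1 + c) * b * fst p + (- (c * \<mu>))))\<^sup>2)
          = (\<lambda>p. ((1 + c) * b * fst p - z (snd p))\<^sup>2 + 2 * c * \<mu> * z (snd p) - 2 * c * \<mu> * (1 + c) * b * fst p + c\<^sup>2 * \<mu>\<^sup>2)"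
          by (simp add: fun_eq_iff power2_eq_square algebra_simps)
        then show ?thesis using ints(2)[of "(1 + c) * b"] ints(3,4) by simp
      qed
      ultimately have "AE p in J. (z (snd p) - ((1 + c) * b * fst p + (- (c * \<mu>))))\<^sup>2 = 0"
        by (subst (asm) integral_nonneg_eq_0_iff_AE) auto
      then have "AE p in J. (b * fst p - z (snd p))\<^sup>2 = c\<^sup>2 * (b * fst p - \<mu>)\<^sup>2"
      proof eventually_elim
        case (elim p)
        then have "b * fst p - z (snd p) = - (c * (b * fst p - \<mu>))" by (simp add: algebra_simps)
        then show ?case by (simp only: power2_minus power_mult_distrib)
      qed
      then have "B = (\<integral>p. c\<^sup>2 * (b * fst p - \<mu>)\<^sup>2 \<partial>J)" unfolding B_def by (intro integral_cong_AE) auto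
      also have "\<dots> = c\<^sup>2 * w" using integral_J_fst(1)[of "\<lambda>x. c\<^sup>2 * (b * x - \<mu>)\<^sup>2"] w_eq by simp
      finally have "\<beta>\<^sup>2 = \<beta>\<^sup>2 * (w / \<Delta>\<^sup>2)" using \<beta> by (simp add: c_def power_divide)
      moreover have "t = 1" if "s = s * t" "0 < s" for s t :: real using that by simp
      ultimately have "w / \<Delta>\<^sup>2 = 1" using \<beta>0 zero_less_power by blast
      then show "w = \<Delta>\<^sup>2" using that(1) by simp
    qed
    \<comment> \<open>By \<open>Ag\<close> and \<open>Bg\<close> below, the two fractions are
      \<open>E(U - g)^2 / (\<beta> + \<Delta>)\<close> and \<open>E(V - g)^2 / \<beta>\<close> for
      \<open>g = V + c (V - \<mu>)\<close>. Being strict, the inequality passes to a simple function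
      \<open>\<eta>\<close> near \<open>g\<close>.\<close>
    obtain c where c: "\<Delta> < (v + (1 + c)\<^sup>2 * w) / (\<beta> + \<Delta>) - c\<^sup>2 * w / \<beta>"
      using ex_improving_direction[OF \<beta>0 \<open>0 \<le> \<Delta>\<close> v0 w0 vw gap gap0] by blast
    define g where "g x = (1 + c) * b * x - c * \<mu>" for x
    have [measurable]: "g \<in> borel_measurable borel" unfolding g_def by measurable
    have g2: "(\<lambda>x. (g x)\<^sup>2) = (\<lambda>x. (1 + c)\<^sup>2 * (b\<^sup>2 * x\<^sup>2) - 2 * c * (1 + c) * \<mu> * b * x + c\<^sup>2 * \<mu>\<^sup>2)"
      by (simp add: g_def fun_eq_iff power2_eq_square algebra_simps)
    have ig2: "integrable PX (\<lambda>x. (g x)\<^sup>2)" unfolding g2 using X2 iX by simp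
    have ib2: "integrable PX (\<lambda>x. (b * x)\<^sup>2)" using X2 by (simp add: power_mult_distrib)
    have Eg: "(\<integral>x. g x \<partial>PX) = (1 + c) * \<nu> - c * \<mu>" unfolding g_def using iX PX.prob_space by (simp add: \<nu>_def)
    have Eg2: "(\<integral>x. (g x)\<^sup>2 \<partial>PX) = (1 + c)\<^sup>2 * s2 - 2 * c * (1 + c) * \<mu> * \<nu> + c\<^sup>2 * \<mu>\<^sup>2"
      unfolding g2 using X2 iX PX.prob_space by (simp add: \<nu>_def flip: s2X)
    have Bg: "(\<integral>x. (b * x - g x)\<^sup>2 \<partial>PX) = c\<^sup>2 * w"
    proof -
      have "(\<lambda>x. (b * x - g x)\<^sup>2) = (\<lambda>x. c\<^sup>2 * (b * x - \<mu>)\<^sup>2)"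
        by (simp add: fun_eq_iff g_def power2_eq_square algebra_simps)
      then show ?thesis by (simp add: w_eq)
    qed
    have Ag: "s2 - 2 * \<mu> * (\<integral>x. g x \<partial>PX) + (\<integral>x. (g x)\<^sup>2 \<partial>PX) = v + (1 + c)\<^sup>2 * w"
      unfolding Eg Eg2 v_def w_def by (simp add: power2_eq_square algebra_simps)
    obtain \<phi> where \<phi>: "\<And>i. simple_function PX (\<phi> i)"
      "(\<lambda>i. \<integral>x. \<phi> i x \<partial>PX) \<longlonglongrightarrow> (\<integral>x. g x \<partial>PX)" "(\<lambda>i. \<integral>x. (\<phi> i x)\<^sup>2 \<partial>PX) \<longlonglongrightarrow> (\<integral>x. (g x)\<^sup>2 \<partial>PX)"
      "(\<lambda>i. \<integral>x. (b * x - \<phi> i x)\<^sup>2 \<partial>PX) \<longlonglongrightarrow> (\<integral>x. (b * x - g x)\<^sup>2 \<partial>PX)"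
      using PX.simple_approximation[of g "\<lambda>x. b * x", OF _ _ ig2 ib2] by auto
    have "\<beta> + \<Delta> \<noteq> 0" using \<beta>0 \<open>0 \<le> \<Delta>\<close> by simp
    have "(\<lambda>i. (s2 - 2 * \<mu> * (\<integral>x. \<phi> i x \<partial>PX) + (\<integral>x. (\<phi> i x)\<^sup>2 \<partial>PX)) / (\<beta> + \<Delta>) - (\<integral>x. (b * x - \<phi> i x)\<^sup>2 \<partial>PX) / \<beta>)
        \<longlonglongrightarrow> (s2 - 2 * \<mu> * (\<integral>x. g x \<partial>PX) + (\<integral>x. (g x)\<^sup>2 \<partial>PX)) / (\<beta> + \<Delta>) - (\<integral>x. (b * x - g x)\<^sup>2 \<partial>PX) / \<beta>"
      using \<beta>0 \<open>\<beta> + \<Delta> \<noteq> 0\<close> by (intro tendsto_intros \<phi>) auto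
    then have "eventually (\<lambda>i. \<Delta> < (s2 - 2 * \<mu> * (\<integral>x. \<phi> i x \<partial>PX) + (\<integral>x. (\<phi> i x)\<^sup>2 \<partial>PX)) / (\<beta> + \<Delta>)
        - (\<integral>x. (b * x - \<phi> i x)\<^sup>2 \<partial>PX) / \<beta>) sequentially"
      by (rule order_tendstoD(1)) (use c in \<open>simp add: Ag Bg\<close>)
    then obtain \<eta> where \<eta>: "simple_function PX \<eta>" and
      gain: "\<Delta> < (s2 - 2 * \<mu> * (\<integral>x. \<eta> x \<partial>PX) + (\<integral>x. (\<eta> x)\<^sup>2 \<partial>PX)) / (\<beta> + \<Delta>) - (\<integral>x. (b * x - \<eta> x)\<^sup>2 \<partial>PX) / \<beta>"
      using \<phi>(1) by (auto simp: eventually_sequentially)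
    interpret q: quantizer PX \<eta> by unfold_locales (rule \<eta>)
    define A1 where "A1 = s2 - 2 * \<mu> * (\<integral>x. \<eta> x \<partial>PX) + (\<integral>x. (\<eta> x)\<^sup>2 \<partial>PX)"
    define B1 where "B1 = (\<integral>x. (b * x - \<eta> x)\<^sup>2 \<partial>PX)"
    \<comment> \<open>Both squared errors are affine in the channel, so \<open>S \<epsilon>\<close>
      is the left-hand root minus the right-hand root for the mixture with weight
      \<open>\<epsilon>\<close>. It starts at \<open>\<Delta>\<close>, and its derivative there is
      half of the margin in \<open>gain\<close>.\<close>
    define S where "S \<epsilon> = sqrt (\<epsilon> * A1 + (1 - \<epsilon>) * A) - sqrt (\<epsilon> * B1 + (1 - \<epsilon>) * B)" for \<epsilon>
    have "A > 0" "B > 0" using A_sq \<beta> \<beta>0 \<open>0 \<le> \<Delta>\<close> by auto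
    then have "(S has_real_derivative ((A1 - A) / (2 * sqrt A) - (B1 - B) / (2 * sqrt B))) (at 0)"
      unfolding S_def[abs_def] by (auto intro!: derivative_eq_intros simp: field_simps)
    moreover have "(A1 - A) / (2 * sqrt A) - (B1 - B) / (2 * sqrt B) > 0"
    proof -
      have "(A1 - A) / (2 * sqrt A) - (B1 - B) / (2 * sqrt B) = (A1 / (\<beta> + \<Delta>) - B1 / \<beta> - \<Delta>) / 2"
      proof -
        have *: "(t - s\<^sup>2) / (2 * s) = (t / s - s) / 2" if "s \<noteq> 0" for s t :: real
          using that by (simp add: field_simps power2_eq_square)
        show ?thesis
          unfolding eq \<beta>_def[symmetric]
          unfolding A_sq \<beta>(2) *[OF \<open>\<beta> + \<Delta> \<noteq> 0\<close>] *[OF \<open>\<beta> \<noteq> 0\<close>]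
          by (simp add: diff_divide_distrib add_divide_distrib)
      qed
      moreover have "0 < (A1 / (\<beta> + \<Delta>) - B1 / \<beta> - \<Delta>) / 2" using gain by (simp add: A1_def B1_def)
      ultimately show ?thesis by (simp only:)
    qed
    ultimately have "\<exists>d>0. \<forall>h>0. h < d \<longrightarrow> S 0 < S (0 + h)" by (rule DERIV_pos_inc_right)
    then obtain d where d: "d > 0" "\<And>h. 0 < h \<Longrightarrow> h < d \<Longrightarrow> S 0 < S h"
      by auto
    define I0 where "I0 = (\<integral>p. ln (f p) \<partial>J)"
    define I1 where "I1 = ln (real (card (range \<eta>)))"
    \<comment> \<open>The information of the mixture is affine in \<open>\<epsilon>\<close> and
      starts strictly below the rate, so a small weight is affordable however large
      \<open>I1\<close> is.\<close>
    have "((\<lambda>\<epsilon>. \<epsilon> * I1 + (1 - \<epsilon>) * I0) \<longlongrightarrow> 0 * I1 + (1 - 0) * I0) (at_right 0)"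
      by (intro tendsto_intros)
    then have ev_info: "eventually (\<lambda>\<epsilon>. \<epsilon> * I1 + (1 - \<epsilon>) * I0 < R * ln 2) (at_right 0)"
      by (rule order_tendstoD(2)) (use info(2) in \<open>simp add: I0_def\<close>)
    have "eventually (\<lambda>\<epsilon>. 0 < \<epsilon> \<and> \<epsilon> < min d 1) (at_right (0::real))"
      using d(1) by (auto simp: eventually_at_right_field intro!: exI[of _ "min d 1"])
    from eventually_happens[OF eventually_conj[OF ev_info this]]
    obtain \<epsilon> where \<epsilon>: "0 < \<epsilon>" "\<epsilon> < d" "\<epsilon> < 1" "\<epsilon> * I1 + (1 - \<epsilon>) * I0 < R * ln 2"
      by auto
    interpret mx: channel_mixture PX Q f q.Q q.f \<epsilon>
      by unfold_locales (use \<epsilon> in auto)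
    \<comment> \<open>The label decides which component of the letter is the reconstruction;
      therefore every integrand needed below is a \<open>mx.mix\<close>.\<close>
    define z' where "z' = (\<lambda>(l, s, t). if l then t else z s)"
    have z'_apply: "z' p = (if fst p then snd (snd p) else z (fst (snd p)))" for p by (simp add: z'_def case_prod_beta)
    have sndm[measurable]: "snd \<in> borel_measurable (PX \<Otimes>\<^sub>M q.Q)"
      by (rule measurable_compose[OF measurable_snd]) (simp add: measurable_def)
    have idm[measurable]: "(\<lambda>t. t) \<in> borel_measurable q.Q" by (simp add: measurable_def)
    have z'm: "z' \<in> borel_measurable mx.Q"
    proof -
      have [measurable]: "Measurable.pred mx.Q fst" by measurable
      have [measurable]: "(\<lambda>p. snd (snd p)) \<in> borel_measurable mx.Q"
      proof -
        have "(\<lambda>p. snd (snd p)) \<in> mx.Q \<rightarrow>\<^sub>M q.Q" by measurable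
        then show ?thesis by (rule measurable_compose[OF _ idm])
      qed
      show ?thesis unfolding z'_apply[abs_def] by measurable
    qed
    have e1: "(\<lambda>p. z' (snd p)) = mx.mix (\<lambda>p. z (snd p)) snd"
      and e2: "(\<lambda>p. (z' (snd p))\<^sup>2) = mx.mix (\<lambda>p. (z (snd p))\<^sup>2) (\<lambda>p. (snd p)\<^sup>2)"
      and e3: "(\<lambda>p. (b * fst p - z' (snd p))\<^sup>2) = mx.mix (\<lambda>p. (b * fst p - z (snd p))\<^sup>2) (\<lambda>p. (b * fst p - snd p)\<^sup>2)"
      and e4: "(\<lambda>p. ln (mx.mix f q.f p)) = mx.mix (\<lambda>p. ln (f p)) (\<lambda>p. ln (q.f p))"
      by (auto simp: fun_eq_iff mx.mix_apply z'_apply)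
    have q1: "(\<integral>p. snd p \<partial>q.J) = (\<integral>x. \<eta> x \<partial>PX)" "integrable q.J snd"
      using q.integral_J_quantizer[of snd] q.integrable_\<phi> by auto
    have q2: "(\<integral>p. (snd p)\<^sup>2 \<partial>q.J) = (\<integral>x. (\<eta> x)\<^sup>2 \<partial>PX)" "integrable q.J (\<lambda>p. (snd p)\<^sup>2)"
      using q.integral_J_quantizer[of "\<lambda>p. (snd p)\<^sup>2"] q.integrable_\<phi> by auto
    have "integrable PX (\<lambda>x. (b * x - \<eta> x)\<^sup>2)"
    proof (rule Bochner_Integration.integrable_bound[where f="\<lambda>x. 2 * (b * x)\<^sup>2 + 2 * (\<eta> x)\<^sup>2"])
      show "integrable PX (\<lambda>x. 2 * (b * x)\<^sup>2 + 2 * (\<eta> x)\<^sup>2)" using ib2 q.integrable_\<phi> by auto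
      have "(s - t)\<^sup>2 \<le> 2 * s\<^sup>2 + 2 * t\<^sup>2" for s t :: real
        using zero_le_power2[of "s + t"] by (simp add: power2_sum power2_diff)
      then show "AE x in PX. norm ((b * x - \<eta> x)\<^sup>2) \<le> norm (2 * (b * x)\<^sup>2 + 2 * (\<eta> x)\<^sup>2)" by simp
      have "\<eta> \<in> borel_measurable PX" using \<eta> by (rule borel_measurable_simple_function)
      then show "(\<lambda>x. (b * x - \<eta> x)\<^sup>2) \<in> borel_measurable PX"
        by (intro borel_measurable_power borel_measurable_diff borel_measurable_times) auto
    qed
    then have q3: "(\<integral>p. (b * fst p - snd p)\<^sup>2 \<partial>q.J) = B1" "integrable q.J (\<lambda>p. (b * fst p - snd p)\<^sup>2)"
      using q.integral_J_quantizer[of "\<lambda>p. (b * fst p - snd p)\<^sup>2"] by (auto simp: B1_def)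
    note M1 = mx.integral_mix_J[OF ints(3) q1(2), folded e1]
    note M2 = mx.integral_mix_J[OF Z2 q2(2), folded e2]
    note M3 = mx.integral_mix_J[OF ints(2) q3(2), of b, folded e3]
    note M4 = mx.integral_mix_J[OF info(1) q.information(1), folded e4]
    have A': "a\<^sup>2 * (\<integral>y. y\<^sup>2 \<partial>PY) - 2 * a * (\<integral>y. y \<partial>PY) * (\<integral>p. z' (snd p) \<partial>mx.mix.J) + (\<integral>p. (z' (snd p))\<^sup>2 \<partial>mx.mix.J)
        = \<epsilon> * A1 + (1 - \<epsilon>) * A"
      unfolding M1(2) M2(2) q1(1) q2(1) A_eq A1_def m_def[symmetric] q_def[symmetric] s2_def[symmetric]
      by (simp add: \<mu>_def algebra_simps)
    have B': "(\<integral>p. (b * fst p - z' (snd p))\<^sup>2 \<partial>mx.mix.J) = \<epsilon> * B1 + (1 - \<epsilon>) * B"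
      unfolding M3(2) q3(1) B_def ..
    have "S 0 = \<Delta>" using eq by (simp add: S_def \<beta>_def)
    then have S: "\<Delta> < sqrt (\<epsilon> * A1 + (1 - \<epsilon>) * A) - sqrt (\<epsilon> * B1 + (1 - \<epsilon>) * B)"
      using d(2)[OF \<epsilon>(1,2)] by (simp add: S_def)
    then have S2: "\<Delta>\<^sup>2 < (sqrt (\<epsilon> * A1 + (1 - \<epsilon>) * A) - sqrt (\<epsilon> * B1 + (1 - \<epsilon>) * B))\<^sup>2"
      using \<open>0 \<le> \<Delta>\<close> by (intro power_strict_mono) auto
    have S1: "\<epsilon> * B1 + (1 - \<epsilon>) * B < \<epsilon> * A1 + (1 - \<epsilon>) * A"
      using S \<open>0 \<le> \<Delta>\<close> by (subst real_sqrt_less_iff[symmetric]) linarith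
    show ?thesis
    proof (rule mx.mix.identifiable_of_strict[OF assms(1,2) X2 Y2 z'm M2(1) M4(1) _ ab])
      show "(\<integral>p. ln (mx.mix f q.f p) \<partial>mx.mix.J) < R * ln 2"
        unfolding M4(2) q.information(2) using \<epsilon>(4) by (simp add: I0_def I1_def)
    qed (use S1 S2 D in \<open>unfold A' B', linarith+\<close>)
  qed
qed

section \<open>Kernels as test channels\<close>

text \<open>Gibbs' inequality from \<open>f - 1 \<le> f * ln f\<close>, both sides integrated
  against the product law. It is what forces rates above the bound to be positive.\<close>

lemma (in test_channel) information_nonneg:
  assumes "integrable J (\<lambda>p. ln (f p))"
  shows "0 \<le> (\<integral>p. ln (f p) \<partial>J)"
proof -
  interpret J: prob_space J by (rule prob_space_J)
  have "(\<integral>p. f p \<partial>(PX \<Otimes>\<^sub>M Q)) = 1"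
    using integral_J[of "\<lambda>_. 1"] J.prob_space by simp
  then have "0 = (\<integral>p. f p - 1 \<partial>(PX \<Otimes>\<^sub>M Q))"
    using integrable_f by (simp add: PXQ.prob_space)
  also have "\<dots> \<le> (\<integral>p. f p * ln (f p) \<partial>(PX \<Otimes>\<^sub>M Q))"
  proof (rule integral_mono)
    show "integrable (PX \<Otimes>\<^sub>M Q) (\<lambda>p. f p * ln (f p))" using assms by (subst (asm) integrable_J) auto
    show "f p - 1 \<le> f p * ln (f p)" for p
    proof (cases "f p = 0")
      case False
      then have "0 < f p" using f_nonneg[of p] by simp
      then have "f p * (- ln (f p)) \<le> f p * (1 / f p - 1)"
        using ln_le_minus_one[of "1 / f p"] by (intro mult_left_mono) (auto simp: ln_div)
      then show ?thesis using \<open>0 < f p\<close> by (simp add: algebra_simps)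
    qed simp
  qed (use integrable_f in auto)
  also have "\<dots> = (\<integral>p. ln (f p) \<partial>J)" by (simp add: integral_J)
  finally show ?thesis .
qed

text \<open>The monad laws of \<open>bind\<close>: given \<open>x\<close>, the first coordinate is
  constant, so projecting to it turns the kernel into \<open>return\<close>.\<close>

lemma joint_law_facts:
  assumes "real_distribution PX" and K: "K \<in> borel \<rightarrow>\<^sub>M prob_algebra borel"
  shows "prob_space (joint_law PX K)" "sets (joint_law PX K) = sets (borel \<Otimes>\<^sub>M borel)"
    "distr (joint_law PX K) borel fst = PX"
proof -
  interpret PX: real_distribution PX by fact
  define k where "k x = distr (K x) (borel \<Otimes>\<^sub>M borel) (\<lambda>x'. (x, x'))" for x :: real
  have Ks: "K \<in> PX \<rightarrow>\<^sub>M subprob_algebra borel"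
    using measurable_prob_algebraD[OF K] by (simp cong: measurable_cong_sets)
  have Kx: "prob_space (K x)" "sets (K x) = sets borel" for x
    using measurable_space[OF K, of x] by (auto simp: space_prob_algebra)
  have km: "k \<in> PX \<rightarrow>\<^sub>M subprob_algebra (borel \<Otimes>\<^sub>M borel)"
    unfolding k_def by (rule measurable_distr2[OF _ Ks]) measurable
  have J: "joint_law PX K = PX \<bind> k" unfolding joint_law_def k_def ..
  have pm: "(\<lambda>x'. (x, x')) \<in> K x \<rightarrow>\<^sub>M borel \<Otimes>\<^sub>M borel" for x
    unfolding measurable_cong_sets[OF Kx(2) refl] by measurable
  show "sets (joint_law PX K) = sets (borel \<Otimes>\<^sub>M borel)"
    unfolding J by (rule sets_bind) (auto simp: k_def)
  show "prob_space (joint_law PX K)"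
    unfolding J by (rule PX.prob_space_bind[OF _ km])
      (auto simp: k_def intro!: prob_space.prob_space_distr Kx pm)
  have "distr (PX \<bind> k) borel fst = PX \<bind> (\<lambda>x. distr (k x) borel fst)"
    by (rule distr_bind[OF km]) auto
  also have "(\<lambda>x. distr (k x) borel fst) = return borel"
  proof
    fix x
    have "distr (k x) borel fst = distr (K x) borel (\<lambda>_. x)"
      unfolding k_def using pm[of x] by (subst distr_distr) (auto simp: comp_def)
    also have "\<dots> = return borel x" by (rule prob_space.distr_const[OF Kx(1)]) simp
    finally show "distr (k x) borel fst = return borel x" .
  qed
  also have "PX \<bind> return borel = PX" by (rule bind_return'') simp
  finally show "distr (joint_law PX K) borel fst = PX" by (simp add: J)
qed

text \<open>Finite mutual information includes absolute continuity, so a Radon-Nikodym density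
  against the product of the marginals exists, with the output law as \<open>Q\<close>. It is
  normalized for almost every \<open>x\<close> only and has to be repaired on a null set.\<close>

lemma ex_test_channel:
  assumes PX: "real_distribution PX" and J0: "prob_space J0" and sJ: "sets J0 = sets (borel \<Otimes>\<^sub>M borel)"
    and marginal: "distr J0 borel fst = PX" and fin: "mutual_info J0 < \<infinity>"
  shows "\<exists>Q f. sets Q = sets borel \<and> test_channel PX Q f \<and> test_channel.J PX Q f = J0 \<and>
    integrable J0 (\<lambda>p. ln (f p)) \<and> mutual_info J0 = ereal ((\<integral>p. ln (f p) \<partial>J0) / ln 2)"
proof -
  interpret PX: real_distribution PX by fact
  interpret J0: prob_space J0 by fact
  define Q where "Q = distr J0 borel snd"
  have [measurable]: "fst \<in> J0 \<rightarrow>\<^sub>M borel" "snd \<in> J0 \<rightarrow>\<^sub>M borel"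
    using measurable_cong_sets[OF sJ refl] by auto
  interpret Q: prob_space Q unfolding Q_def by (rule J0.prob_space_distr) measurable
  have sQ[simp, measurable_cong]: "sets Q = sets borel" by (simp add: Q_def)
  interpret PQ: pair_prob_space PX Q ..
  define P where "P = PX \<Otimes>\<^sub>M Q"
  have sP: "sets P = sets (borel \<Otimes>\<^sub>M borel)" unfolding P_def by (rule sets_pair_measure_cong) auto
  have P: "distr J0 borel fst \<Otimes>\<^sub>M distr J0 borel snd = P" by (simp add: marginal P_def Q_def)
  interpret P: prob_space P unfolding P_def by (rule PQ.prob_space_axioms)
  have ac: "absolutely_continuous P J0" and ed: "integrable J0 (entropy_density 2 P J0)"
    and mi: "mutual_info J0 = ereal (J0.mutual_information 2 borel borel fst snd)"
    using fin unfolding mutual_info_def P Let_def by (auto split: if_splits)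
  define f0 where "f0 p = enn2real (RN_deriv P J0 p)" for p
  have f0m[measurable]: "f0 \<in> borel_measurable (PX \<Otimes>\<^sub>M Q)"
    unfolding f0_def P_def by measurable
  have RN: "AE p in P. RN_deriv P J0 p \<noteq> \<infinity>"
    by (rule P.RN_deriv_finite[OF J0.sigma_finite_measure_axioms ac]) (simp add: sP sJ)
  have dens0: "density P (\<lambda>p. ennreal (f0 p)) = J0"
  proof -
    have "density P (\<lambda>p. ennreal (f0 p)) = density P (RN_deriv P J0)"
      using RN by (intro density_cong) (auto simp: f0_def P_def less_top)
    also have "\<dots> = J0" by (rule P.density_RN_deriv[OF ac]) (simp add: sP sJ)
    finally show ?thesis .
  qed
  \<comment> \<open>The mass of the section at \<open>x\<close>. As the first marginal of
    \<open>J0\<close> is \<open>PX\<close>, weighting \<open>PX\<close> by \<open>m\<close> does not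
    change it, so \<open>m = 1\<close> almost everywhere.\<close>
  define m where "m x = (\<integral>\<^sup>+s. ennreal (f0 (x, s)) \<partial>Q)" for x
  have mm[measurable]: "m \<in> borel_measurable PX" unfolding m_def by measurable
  have "density PX m = PX"
  proof (rule measure_eqI)
    fix A assume "A \<in> sets (density PX m)"
    then have A[measurable]: "A \<in> sets borel" by simp
    have "emeasure (density PX m) A = (\<integral>\<^sup>+x. m x * indicator A x \<partial>PX)"
      by (rule emeasure_density) auto
    also have "\<dots> = (\<integral>\<^sup>+x. (\<integral>\<^sup>+s. ennreal (f0 (x, s)) * indicator A x \<partial>Q) \<partial>PX)"
      unfolding m_def by (intro nn_integral_cong, subst nn_integral_multc) auto
    also have "\<dots> = (\<integral>\<^sup>+p. ennreal (f0 p) * indicator A (fst p) \<partial>P)"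
      unfolding P_def by (subst Q.nn_integral_fst[symmetric]) auto
    also have "\<dots> = (\<integral>\<^sup>+p. indicator A (fst p) \<partial>J0)"
      by (subst dens0[symmetric], subst nn_integral_density) (auto simp: P_def)
    also have "\<dots> = (\<integral>\<^sup>+x. indicator A x \<partial>distr J0 borel fst)"
      by (subst nn_integral_distr) auto
    also have "\<dots> = emeasure PX A" by (simp add: marginal)
    finally show "emeasure (density PX m) A = emeasure PX A" .
  qed simp
  then have "density PX m = density PX (\<lambda>_. 1)" by (simp add: density_1)
  then have m1: "AE x in PX. m x = 1" by (subst (asm) PX.density_unique_iff) auto
  \<comment> \<open>On the exceptional null set the channel outputs \<open>Q\<close> regardless of
    \<open>x\<close>, with constant density 1.\<close>
  define f where "f p = (if m (fst p) = 1 then f0 p else 1)" for p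
  have fm[measurable]: "f \<in> borel_measurable (PX \<Otimes>\<^sub>M Q)" unfolding f_def by measurable
  have "AE p in P. m (fst p) = 1"
    unfolding P_def
  proof (rule PQ.AE_pair_measure)
    show "{p \<in> space (PX \<Otimes>\<^sub>M Q). m (fst p) = 1} \<in> sets (PX \<Otimes>\<^sub>M Q)" by measurable
  qed (use m1 in simp)
  then have ff0: "AE p in P. f p = f0 p" by eventually_elim (simp add: f_def)
  have tc: "test_channel PX Q f"
  proof
    show "0 \<le> f p" for p by (simp add: f_def f0_def)
    show "(\<integral>\<^sup>+s. ennreal (f (x, s)) \<partial>Q) = 1" for x
    proof (cases "m x = 1")
      case True
      then have "(\<integral>\<^sup>+s. ennreal (f (x, s)) \<partial>Q) = m x" by (simp add: f_def m_def)
      then show ?thesis using True by simp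
    next
      case False
      then show ?thesis by (simp add: f_def Q.emeasure_space_1[simplified])
    qed
  qed (rule fm)
  have J: "test_channel.J PX Q f = J0"
    unfolding test_channel.J_def[OF tc] P_def[symmetric] dens0[symmetric]
    using ff0 by (intro density_cong) (auto simp: P_def)
  have "AE p in J0. f p = f0 p"
    by (rule absolutely_continuous_AE[OF _ ac ff0]) (simp add: sP sJ)
  \<comment> \<open>Conversion from bits to nats; the null set of the repair is also null for
    \<open>J0\<close> by absolute continuity.\<close>
  then have lnf: "AE p in J0. ln (f p) = entropy_density 2 P J0 p * ln 2"
    by eventually_elim (simp add: entropy_density_def f0_def log_def)
  have [measurable]: "f \<in> borel_measurable J0"
    using fm by (simp add: P_def[symmetric] cong: measurable_cong_sets[OF sJ[folded sP] refl])
  have [measurable]: "entropy_density 2 P J0 \<in> borel_measurable J0"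
    using ed by (rule borel_measurable_integrable)
  have int: "integrable J0 (\<lambda>p. ln (f p))"
    by (subst integrable_cong_AE[OF _ _ lnf]) (use ed in auto)
  have "(\<integral>p. ln (f p) \<partial>J0) = (\<integral>p. entropy_density 2 P J0 p * ln 2 \<partial>J0)"
    by (rule integral_cong_AE[OF _ _ lnf]) auto
  also have "\<dots> = J0.mutual_information 2 borel borel fst snd * ln 2"
    unfolding J0.mutual_information_def KL_divergence_def P by (simp add: distr_id2 sJ)
  finally have "mutual_info J0 = ereal ((\<integral>p. ln (f p) \<partial>J0) / ln 2)" by (simp add: mi)
  then show ?thesis using sQ tc J int by blast
qed

text \<open>Since the infimum lies below \<open>R\<close>, a single feasible kernel does, and it
  becomes a test channel. The rest translates its constraint into moments of \<open>X\<close>,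
  \<open>Y\<close> and \<open>X'\<close>, using that \<open>Y\<close> is independent of the
  pair.\<close>

lemma exponentially_identifiable_of_rate_bound:
  fixes R :: real
  assumes PX: "real_distribution PX" and PY: "real_distribution PY"
    and X2: "integrable PX (\<lambda>x. x\<^sup>2)" and Y2: "integrable PY (\<lambda>y. y\<^sup>2)"
    and sX: "rms PX > 0" and sY: "rms PY > 0"
    and D: "D \<ge> (rms PX - rms PY)\<^sup>2"
    and Dne: "D \<noteq> (\<integral>(x, y). (x - y)\<^sup>2 \<partial>(PX \<Otimes>\<^sub>M PY))"
    and R: "rate_bound D PX PY < ereal R"
  shows "R > 0 \<and> exponentially_identifiable PX PY D R"
proof -
  interpret PX: real_distribution PX by fact
  interpret PY: real_distribution PY by fact
  interpret XY: pair_prob_space PX PY ..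
  have "\<exists>K\<in>{K. K \<in> borel \<rightarrow>\<^sub>M prob_algebra borel \<and> feasible D PX PY K}.
      mutual_info (joint_law PX K) < ereal R"
    using R unfolding rate_bound_def INF_less_iff .
  then obtain K where K: "K \<in> borel \<rightarrow>\<^sub>M prob_algebra borel" and feas: "feasible D PX PY K"
    and KR: "mutual_info (joint_law PX K) < ereal R"
    by blast
  define J0 where "J0 = joint_law PX K"
  note J0 = joint_law_facts[OF PX K, folded J0_def]
  have "mutual_info J0 < \<infinity>" using KR unfolding J0_def by (rule order_less_trans) simp
  from ex_test_channel[OF PX J0 this] obtain Q f where
    sQ[measurable_cong]: "sets Q = sets borel" and tc: "test_channel PX Q f" and J: "test_channel.J PX Q f = J0"
    and info: "integrable J0 (\<lambda>p. ln (f p))" "mutual_info J0 = ereal ((\<integral>p. ln (f p) \<partial>J0) / ln 2)"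
    by blast
  interpret ch: test_channel PX Q f by (rule tc)
  have "(\<integral>p. ln (f p) \<partial>J0) / ln 2 < R" using KR info(2) by (simp add: J0_def)
  then have rate: "(\<integral>p. ln (f p) \<partial>J0) < R * ln 2" by (simp add: divide_less_eq)
  have "0 \<le> (\<integral>p. ln (f p) \<partial>J0)" using ch.information_nonneg info(1) unfolding J by simp
  then have "0 < R * ln 2" using rate by linarith
  then have R0: "R > 0" by (simp add: zero_less_mult_iff)
  define \<sigma>X where "\<sigma>X = rms PX"
  define \<sigma>Y where "\<sigma>Y = rms PY"
  define a where "a = sqrt (\<sigma>X / \<sigma>Y)"
  define b where "b = sqrt (\<sigma>Y / \<sigma>X)"
  define \<Delta> where "\<Delta> = sqrt (D - (\<sigma>X - \<sigma>Y)\<^sup>2)"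
  have \<sigma>: "0 < \<sigma>X" "0 < \<sigma>Y" using sX sY by (auto simp: \<sigma>X_def \<sigma>Y_def)
  have ab: "a * b = 1" unfolding a_def b_def using \<sigma> by (simp flip: real_sqrt_mult)
  have a2: "a\<^sup>2 = \<sigma>X / \<sigma>Y" and b2: "b\<^sup>2 = \<sigma>Y / \<sigma>X" using \<sigma> by (auto simp: a_def b_def)
  have EX2: "(\<integral>x. x\<^sup>2 \<partial>PX) = \<sigma>X\<^sup>2" and EY2: "(\<integral>y. y\<^sup>2 \<partial>PY) = \<sigma>Y\<^sup>2"
    unfolding \<sigma>X_def \<sigma>Y_def rms_def by simp_all
  have aY: "a\<^sup>2 * (\<integral>y. y\<^sup>2 \<partial>PY) = \<sigma>X * \<sigma>Y" and bX: "b\<^sup>2 * (\<integral>x. x\<^sup>2 \<partial>PX) = \<sigma>X * \<sigma>Y"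
    unfolding a2 b2 EX2 EY2 using \<sigma> by (auto simp: power2_eq_square)
  have \<Delta>2: "\<Delta>\<^sup>2 = D - (\<sigma>X - \<sigma>Y)\<^sup>2" using D by (simp add: \<Delta>_def \<sigma>X_def \<sigma>Y_def)
  have iX: "integrable PX (\<lambda>x. x)" by (rule PX.integrable_of_square[OF _ X2]) simp
  have iY: "integrable PY (\<lambda>y. y)" by (rule PY.integrable_of_square[OF _ Y2]) simp
  \<comment> \<open>Subtracting \<open>(\<sigma>X - \<sigma>Y)\<^sup>2\<close> from both
    \<open>E(X - Y)^2\<close> and \<open>D\<close> turns \<open>Dne\<close> into the condition
    \<open>W\<close> on \<open>a Y\<close> and \<open>b X\<close>.\<close>
  have "(\<integral>(x, y). (x - y)\<^sup>2 \<partial>(PX \<Otimes>\<^sub>M PY)) = \<sigma>X\<^sup>2 + \<sigma>Y\<^sup>2 - 2 * (\<integral>x. x \<partial>PX) * (\<integral>y. y \<partial>PY)"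
  proof -
    have ex: "integrable (PX \<Otimes>\<^sub>M PY) (\<lambda>(x, y). x\<^sup>2)"
      using X2 by (intro XY.Fubini_integrable) (auto simp: PY.prob_space[simplified])
    have ey: "integrable (PX \<Otimes>\<^sub>M PY) (\<lambda>(x, y). y\<^sup>2)"
      using Y2 by (intro XY.Fubini_integrable) auto
    have "integrable (PX \<Otimes>\<^sub>M PY) (\<lambda>(x, y). (x - y)\<^sup>2)"
    proof (rule Bochner_Integration.integrable_bound[where f="\<lambda>p. 2 * (case p of (x, y) \<Rightarrow> x\<^sup>2) + 2 * (case p of (x, y) \<Rightarrow> y\<^sup>2)"])
      show "integrable (PX \<Otimes>\<^sub>M PY) (\<lambda>p. 2 * (case p of (x, y) \<Rightarrow> x\<^sup>2) + 2 * (case p of (x, y) \<Rightarrow> y\<^sup>2))"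
        using ex ey by simp
      have "(s - t)\<^sup>2 \<le> 2 * s\<^sup>2 + 2 * t\<^sup>2" for s t :: real
        using zero_le_power2[of "s + t"] by (simp add: power2_sum power2_diff)
      then show "AE p in PX \<Otimes>\<^sub>M PY. norm (case p of (x, y) \<Rightarrow> (x - y)\<^sup>2)
          \<le> norm (2 * (case p of (x, y) \<Rightarrow> x\<^sup>2) + 2 * (case p of (x, y) \<Rightarrow> y\<^sup>2))"
        by (intro AE_I2) (auto split: prod.split)
    qed measurable
    from XY.integral_fst'[OF this]
    have "(\<integral>(x, y). (x - y)\<^sup>2 \<partial>(PX \<Otimes>\<^sub>M PY)) = (\<integral>x. (\<integral>y. (x - y)\<^sup>2 \<partial>PY) \<partial>PX)" by simp
    also have "\<dots> = (\<integral>x. x\<^sup>2 - 2 * (\<integral>y. y \<partial>PY) * x + \<sigma>Y\<^sup>2 \<partial>PX)"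
    proof (intro Bochner_Integration.integral_cong refl)
      fix x
      have "(\<integral>y. (x - y)\<^sup>2 \<partial>PY) = (\<integral>y. x\<^sup>2 - 2 * x * y + y\<^sup>2 \<partial>PY)"
        by (intro Bochner_Integration.integral_cong) (auto simp: power2_diff)
      then show "(\<integral>y. (x - y)\<^sup>2 \<partial>PY) = x\<^sup>2 - 2 * (\<integral>y. y \<partial>PY) * x + \<sigma>Y\<^sup>2"
        using iY Y2 PY.prob_space by (simp add: EY2)
    qed
    also have "\<dots> = \<sigma>X\<^sup>2 + \<sigma>Y\<^sup>2 - 2 * (\<integral>x. x \<partial>PX) * (\<integral>y. y \<partial>PY)"
      using iX X2 PX.prob_space by (simp add: EX2)
    finally show ?thesis .
  qed
  then have W: "2 * (a\<^sup>2 * (\<integral>y. y\<^sup>2 \<partial>PY)) - 2 * (\<integral>x. x \<partial>PX) * (\<integral>y. y \<partial>PY) \<noteq> \<Delta>\<^sup>2"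
    using Dne unfolding aY \<Delta>2 by (simp add: power2_diff)
  interpret J0: prob_space J0 by (rule J0(1))
  interpret YJ: pair_prob_space PY J0 ..
  have f1: "integrable (PY \<Otimes>\<^sub>M J0) (\<lambda>(y, x, x'). (a * y - x')\<^sup>2)"
    and f2: "integrable (PY \<Otimes>\<^sub>M J0) (\<lambda>(y, x, x'). (b * x - x')\<^sup>2)"
    and f3: "sqrt (\<integral>(y, x, x'). (b * x - x')\<^sup>2 \<partial>(PY \<Otimes>\<^sub>M J0)) + \<Delta> \<le> sqrt (\<integral>(y, x, x'). (a * y - x')\<^sup>2 \<partial>(PY \<Otimes>\<^sub>M J0))"
    using feas unfolding feasible_def Let_def J0_def a_def b_def \<Delta>_def \<sigma>X_def \<sigma>Y_def by auto
  have c2: "(\<lambda>(y :: real, x, x'). (b * x - x')\<^sup>2) = case_prod (\<lambda>y p. (b * fst p - snd p)\<^sup>2)"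
    and c1: "(\<lambda>(y, x :: real, x'). (a * y - x')\<^sup>2) = case_prod (\<lambda>y p. (a * y - snd p)\<^sup>2)"
    by (auto simp: fun_eq_iff)
  have g2: "integrable (PY \<Otimes>\<^sub>M J0) (case_prod (\<lambda>y p. (b * fst p - snd p)\<^sup>2))"
    using f2 unfolding c2 .
  have iB: "integrable J0 (\<lambda>p. (b * fst p - snd p)\<^sup>2)"
    using YJ.integrable_snd[OF g2] by (simp add: PY.prob_space[simplified])
  have B: "(\<integral>(y, x, x'). (b * x - x')\<^sup>2 \<partial>(PY \<Otimes>\<^sub>M J0)) = (\<integral>p. (b * fst p - snd p)\<^sup>2 \<partial>J0)"
    unfolding c2 YJ.integral_snd[OF g2, symmetric] by (simp add: PY.prob_space[simplified])
  have [measurable]: "fst \<in> J0 \<rightarrow>\<^sub>M borel" "snd \<in> J0 \<rightarrow>\<^sub>M borel"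
    using measurable_cong_sets[OF J0(2) refl] by auto
  have X2J: "integrable J0 (\<lambda>p. (fst p)\<^sup>2)" using ch.integral_J_fst(2)[of "\<lambda>x. x\<^sup>2"] X2 by (simp add: J)
  \<comment> \<open>The kernel is not assumed square integrable: this follows from its finite error
    and the second moment of \<open>X\<close>.\<close>
  have Z2: "integrable J0 (\<lambda>p. (snd p)\<^sup>2)"
  proof (rule Bochner_Integration.integrable_bound[where f="\<lambda>p. 2 * (b * fst p - snd p)\<^sup>2 + 2 * (b\<^sup>2 * (fst p)\<^sup>2)"])
    show "integrable J0 (\<lambda>p. 2 * (b * fst p - snd p)\<^sup>2 + 2 * (b\<^sup>2 * (fst p)\<^sup>2))" using iB X2J by simp
    have "t\<^sup>2 \<le> 2 * (b * s - t)\<^sup>2 + 2 * (b\<^sup>2 * s\<^sup>2)" for s t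
      using zero_le_power2[of "2 * (b * s) - t"] by (simp add: power2_eq_square algebra_simps)
    then show "AE p in J0. norm ((snd p)\<^sup>2) \<le> norm (2 * (b * fst p - snd p)\<^sup>2 + 2 * (b\<^sup>2 * (fst p)\<^sup>2))"
      by simp
  qed measurable
  have Z: "integrable J0 snd" by (rule J0.integrable_of_square[OF _ Z2]) measurable
  have g1: "integrable (PY \<Otimes>\<^sub>M J0) (case_prod (\<lambda>y p. (a * y - snd p)\<^sup>2))"
    using f1 unfolding c1 .
  have "(\<integral>(y, x, x'). (a * y - x')\<^sup>2 \<partial>(PY \<Otimes>\<^sub>M J0)) = (\<integral>p. (\<integral>y. (a * y - snd p)\<^sup>2 \<partial>PY) \<partial>J0)"
    unfolding c1 YJ.integral_snd[OF g1, symmetric] ..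
  also have "\<dots> = (\<integral>p. a\<^sup>2 * (\<integral>y. y\<^sup>2 \<partial>PY) - 2 * a * (\<integral>y. y \<partial>PY) * snd p + (snd p)\<^sup>2 \<partial>J0)"
  proof (intro Bochner_Integration.integral_cong refl)
    fix p :: "real \<times> real"
    have "(\<integral>y. (a * y - snd p)\<^sup>2 \<partial>PY) = (\<integral>y. a\<^sup>2 * y\<^sup>2 - 2 * a * snd p * y + (snd p)\<^sup>2 \<partial>PY)"
      by (intro Bochner_Integration.integral_cong) (auto simp: power2_diff power_mult_distrib)
    then show "(\<integral>y. (a * y - snd p)\<^sup>2 \<partial>PY) = a\<^sup>2 * (\<integral>y. y\<^sup>2 \<partial>PY) - 2 * a * (\<integral>y. y \<partial>PY) * snd p + (snd p)\<^sup>2"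
      using iY Y2 PY.prob_space by simp
  qed
  also have "\<dots> = a\<^sup>2 * (\<integral>y. y\<^sup>2 \<partial>PY) - 2 * a * (\<integral>y. y \<partial>PY) * (\<integral>p. snd p \<partial>J0) + (\<integral>p. (snd p)\<^sup>2 \<partial>J0)"
    using Z Z2 J0.prob_space by simp
  finally have A: "(\<integral>(y, x, x'). (a * y - x')\<^sup>2 \<partial>(PY \<Otimes>\<^sub>M J0))
      = a\<^sup>2 * (\<integral>y. y\<^sup>2 \<partial>PY) - 2 * a * (\<integral>y. y \<partial>PY) * (\<integral>p. snd p \<partial>J0) + (\<integral>p. (snd p)\<^sup>2 \<partial>J0)" .
  have "exponentially_identifiable PX PY D R"
  proof (rule ch.identifiable_of_feasible[OF PY R0 X2 Y2, where z="\<lambda>s. s" and a=a and b=b and \<Delta>=\<Delta>, unfolded J])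
    show "(\<lambda>s. s) \<in> borel_measurable Q" by (simp add: measurable_ident_sets sQ)
    show "D \<le> (1 - b\<^sup>2) * (\<integral>x. x\<^sup>2 \<partial>PX) + (1 - a\<^sup>2) * (\<integral>y. y\<^sup>2 \<partial>PY) + \<Delta>\<^sup>2"
      unfolding left_diff_distrib aY bX unfolding EX2 EY2 \<Delta>2 by (simp add: power2_diff)
    show "0 \<le> \<Delta>" using D by (simp add: \<Delta>_def \<sigma>X_def \<sigma>Y_def)
  qed (use Z2 info rate ab aY bX f3 A B W in simp_all)
  then show ?thesis using R0 by simp
qed

section \<open>From exponential decay to the rate and the exponent\<close>

lemma achievableI:
  assumes "exponentially_identifiable PX PY D R"
  shows "achievable D PX PY R"
proof -
  obtain C \<kappa> where \<kappa>: "0 < \<kappa>" "\<kappa> < 1"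
    and ex: "\<And>n. n \<ge> 1 \<Longrightarrow> \<exists>T g. id_system n R T g \<and> admissible n D T g \<and> prob_maybe n PX PY T g \<le> C * \<kappa> ^ n"
    using assms unfolding exponentially_identifiable_def by blast
  then obtain T g where Tg: "\<And>n. n \<ge> 1 \<Longrightarrow> id_system n R (T n) (g n) \<and> admissible n D (T n) (g n)
      \<and> prob_maybe n PX PY (T n) (g n) \<le> C * \<kappa> ^ n"
    by metis
  have "(\<lambda>n. C * \<kappa> ^ n) \<longlonglongrightarrow> C * 0" using \<kappa> by (intro tendsto_intros) (auto intro: LIMSEQ_realpow_zero)
  then have lim: "(\<lambda>n. C * \<kappa> ^ n) \<longlonglongrightarrow> 0" by simp
  have "eventually (\<lambda>n. norm (prob_maybe n PX PY (T n) (g n)) \<le> C * \<kappa> ^ n) sequentially"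
    using eventually_ge_at_top[of 1] by eventually_elim (use Tg in \<open>auto simp: prob_maybe_def\<close>)
  then have "(\<lambda>n. prob_maybe n PX PY (T n) (g n)) \<longlonglongrightarrow> 0"
    using lim by (rule Lim_null_comparison)
  then show ?thesis unfolding achievable_def using Tg by blast
qed

text \<open>Taking logarithms of \<open>C * \<kappa> ^ n\<close>, the constant costs only
  \<open>log 2 C / n\<close>; half of \<open>\<gamma> = - log 2 \<kappa>\<close> remains as a bound
  for all large \<open>n\<close>.\<close>

lemma id_exponent_pos:
  assumes "exponentially_identifiable PX PY D R"
  shows "id_exponent R D PX PY > 0"
proof -
  obtain C \<kappa> where C: "0 < C" and \<kappa>: "0 < \<kappa>" "\<kappa> < 1"
    and ex: "\<And>n. n \<ge> 1 \<Longrightarrow> \<exists>T g. id_system n R T g \<and> admissible n D T g \<and> prob_maybe n PX PY T g \<le> C * \<kappa> ^ n"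
    using assms unfolding exponentially_identifiable_def by blast
  define I where "I n = (INF (T, g)\<in>{(T, g). id_system n R T g \<and> admissible n D T g}. ereal (prob_maybe n PX PY T g))" for n
  have Ile: "I n \<le> ereal (C * \<kappa> ^ n)" if "n \<ge> 1" for n
  proof -
    obtain T g where Tg: "id_system n R T g" "admissible n D T g" "prob_maybe n PX PY T g \<le> C * \<kappa> ^ n"
      using ex[OF \<open>n \<ge> 1\<close>] by blast
    have "I n \<le> (case (T, g) of (T, g) \<Rightarrow> ereal (prob_maybe n PX PY T g))"
      unfolding I_def by (rule INF_lower) (use Tg in auto)
    then show ?thesis using Tg(3) by (auto intro: order_trans)
  qed
  define \<gamma> where "\<gamma> = - log 2 \<kappa>"
  have \<gamma>: "0 < \<gamma>" using \<kappa> by (simp add: \<gamma>_def)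
  have bound: "ereal (\<gamma> - log 2 C / real n) \<le> - ereal (1 / real n) * elog2 (I n)" if n: "n \<ge> 1" for n
  proof (cases "I n \<le> 0")
    \<comment> \<open>The infimum may be 0; \<open>elog2\<close> is then
      \<open>- \<infinity>\<close> and the exponent term \<open>\<infinity>\<close>.\<close>
    case True
    then have "elog2 (I n) = - \<infinity>" by (simp add: elog2_def)
    then show ?thesis using n by simp
  next
    case False
    then obtain i where i: "I n = ereal i" "0 < i" using Ile[OF n] by (cases "I n") auto
    then have "i \<le> C * \<kappa> ^ n" using Ile[OF n] by simp
    then have "log 2 i \<le> log 2 (C * \<kappa> ^ n)" using i by simp
    also have "\<dots> = log 2 C - real n * \<gamma>" using C \<kappa> by (simp add: log_mult log_nat_power \<gamma>_def)
    finally have "log 2 i / real n \<le> (log 2 C - real n * \<gamma>) / real n" using n by (intro divide_right_mono) auto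
    then have "\<gamma> - log 2 C / real n \<le> - (log 2 i / real n)" using n by (simp add: diff_divide_distrib)
    then show ?thesis using i by (simp add: elog2_def)
  qed
  have "(\<lambda>n. \<gamma> - log 2 C / real n) \<longlonglongrightarrow> \<gamma> - 0"
    by (intro tendsto_intros lim_const_over_n)
  then have "eventually (\<lambda>n. \<gamma> / 2 < \<gamma> - log 2 C / real n) sequentially"
    using \<gamma> by (intro order_tendstoD(1)) auto
  then have "eventually (\<lambda>n. ereal (\<gamma> / 2) \<le> - ereal (1 / real n) * elog2 (I n)) sequentially"
    using eventually_ge_at_top[of 1]
  proof eventually_elim
    case (elim n)
    then have "ereal (\<gamma> / 2) \<le> ereal (\<gamma> - log 2 C / real n)" by simp
    also note bound[OF elim(2)]
    finally show ?case .
  qed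
  then have "ereal (\<gamma> / 2) \<le> limsup (\<lambda>n. - ereal (1 / real n) * elog2 (I n))"
    by (intro le_Limsup) auto
  moreover have "0 < ereal (\<gamma> / 2)" using \<gamma> by simp
  ultimately show ?thesis unfolding id_exponent_def I_def by (meson order_less_le_trans)
qed

theorem theorem3:
  fixes PX PY :: "real measure" and D :: real
  assumes "real_distribution PX" and "real_distribution PY"
    and "integrable PX (\<lambda>x. x\<^sup>2)" and "integrable PY (\<lambda>y. y\<^sup>2)"
    and "rms PX > 0" and "rms PY > 0"
    and "D \<ge> (rms PX - rms PY)\<^sup>2"
    and "D \<noteq> (\<integral>(x, y). (x - y)\<^sup>2 \<partial>(PX \<Otimes>\<^sub>M PY))"
  shows "id_rate D PX PY \<le> rate_bound D PX PY \<and>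
    (\<forall>R::real. ereal R > rate_bound D PX PY \<longrightarrow> id_exponent R D PX PY > 0)"
proof
  have ident: "exponentially_identifiable PX PY D R" if "ereal R > rate_bound D PX PY" for R :: real
    using exponentially_identifiable_of_rate_bound[OF assms that] by simp
  show "\<forall>R::real. ereal R > rate_bound D PX PY \<longrightarrow> id_exponent R D PX PY > 0"
    using ident id_exponent_pos by blast
  show "id_rate D PX PY \<le> rate_bound D PX PY"
  proof (rule ccontr)
    assume "\<not> ?thesis"
    then obtain R where R: "rate_bound D PX PY < ereal R" "ereal R < id_rate D PX PY"
      using ereal_dense2 by (meson not_le)
    have "id_rate D PX PY \<le> ereal R"
      unfolding id_rate_def by (rule INF_lower) (use achievableI[OF ident[OF R(1)]] in simp)
    then show False using R(2) by simp
  qed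
qed

end
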